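(* Let $d\ge 1$, let $\Omega\subset\mathbb{R}^d$ be a bounded domain, let $0<\lambda_1\le\lambda_2\le\cdots$ be the eigenvalues of the Dirichlet Laplacian on $\Omega$, and let $j\ge1$ be an integer. Suppose that $z\ge\left(1+\frac4d\right)\overline{\lambda_j}$. Then $$R_2(z)\ \ge\ \frac{j\,z^{2+\frac d2}}{\left(1+\frac d4\right)^2\left(\left(1+\frac4d\right)\overline{\lambda_j}\right)^{\frac d2}},$$ and therefore $$R_1(z)\ \ge\ \frac{j\,z^{1+\frac d2}}{\left(1+\frac d4\right)\left(\left(1+\frac4d\right)\overline{\lambda_j}\right)^{\frac d2}}$$ and $$\mathcal{N}(z)\ \ge\ j\left(\frac{z}{\left(1+\frac4d\right)\overline{\lambda_j}}\right)^{\frac d2}.$$ Moreover, for all integers $k\ge j\ge1$, $$\frac{\lambda_{k+1}}{\overline{\lambda_j}}\ \le\ \left(1+\frac4d\right)\left(\frac kj\right)^{\frac2d}.$$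
   Context: $\{\lambda_k\}_{k\ge1}$ are the eigenvalues, in nondecreasing order and repeated according to multiplicity, of $-\Delta$ on $\Omega$ with Dirichlet boundary conditions on $\partial\Omega$. $\overline{\lambda_j}:=\frac1j\sum_{\ell\le j}\lambda_\ell$ is the mean of the first $j$ eigenvalues. With $x_+:=\max(0,x)$, the Riesz mean of order $\sigma>0$ is $R_\sigma(z):=\sum_k(z-\lambda_k)_+^\sigma$, and the eigenvalue counting function is $\mathcal{N}(z):=R_0(z):=\lim_{\sigma\downarrow0}R_\sigma(z)$, i.e. the number of $k$ with $\lambda_k<z$. *)

theory Defs
  imports "HOL-Analysis.Analysis"
begin

subsection \<open>Test functions and Sobolev spaces\<close>

definition gradient :: "('a::euclidean_space \<Rightarrow> real) \<Rightarrow> 'a \<Rightarrow> 'a" where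
  "gradient f x = (THE D. GDERIV f x :> D)"

primrec C_class :: "nat \<Rightarrow> ('a::euclidean_space \<Rightarrow> real) \<Rightarrow> bool" where
  "C_class 0 f \<longleftrightarrow> continuous_on UNIV f"
| "C_class (Suc m) f \<longleftrightarrow>
     (\<forall>x. f differentiable at x) \<and> (\<forall>i\<in>Basis. C_class m (\<lambda>x. gradient f x \<bullet> i))"

definition test_function :: "'a::euclidean_space set \<Rightarrow> ('a \<Rightarrow> real) \<Rightarrow> bool" where
  "test_function \<Omega> \<phi> \<longleftrightarrow> (\<forall>m. C_class m \<phi>) \<and>
     compact (closure {x. \<phi> x \<noteq> 0}) \<and> closure {x. \<phi> x \<noteq> 0} \<subseteq> \<Omega>"

text \<open>Elements of the following function spaces are functions, not classes modulo null sets,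
  and their values outside \<open>\<Omega>\<close> are irrelevant.\<close>

definition L2 :: "'a::euclidean_space set \<Rightarrow> ('a \<Rightarrow> 'b::euclidean_space) set" where
  "L2 \<Omega> = {f. f \<in> borel_measurable (lebesgue_on \<Omega>) \<and>
              integrable (lebesgue_on \<Omega>) (\<lambda>x. (norm (f x))\<^sup>2)}"

definition has_weak_gradient ::
    "'a::euclidean_space set \<Rightarrow> ('a \<Rightarrow> real) \<Rightarrow> ('a \<Rightarrow> 'a) \<Rightarrow> bool" where
  "has_weak_gradient \<Omega> u g \<longleftrightarrow> u \<in> L2 \<Omega> \<and> g \<in> L2 \<Omega> \<and>
     (\<forall>\<phi>. test_function \<Omega> \<phi> \<longrightarrow> (\<forall>i\<in>Basis.
        (LINT x|lebesgue_on \<Omega>. u x * (gradient \<phi> x \<bullet> i)) =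
        - (LINT x|lebesgue_on \<Omega>. (g x \<bullet> i) * \<phi> x)))"

text \<open>\<open>H10_with_gradient \<Omega> u g\<close>: \<open>u\<close> lies in \<open>H\<^sup>1\<^sub>0(\<Omega>)\<close>, the closure of the test functions in
  \<open>H\<^sup>1(\<Omega>)\<close>, and \<open>g\<close> is its weak gradient.\<close>

definition H10_with_gradient ::
    "'a::euclidean_space set \<Rightarrow> ('a \<Rightarrow> real) \<Rightarrow> ('a \<Rightarrow> 'a) \<Rightarrow> bool" where
  "H10_with_gradient \<Omega> u g \<longleftrightarrow> has_weak_gradient \<Omega> u g \<and>
     (\<exists>\<phi>. (\<forall>n::nat. test_function \<Omega> (\<phi> n)) \<and>
        (\<lambda>n. (LINT x|lebesgue_on \<Omega>. (u x - \<phi> n x)\<^sup>2) +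
             (LINT x|lebesgue_on \<Omega>. (norm (g x - gradient (\<phi> n) x))\<^sup>2)) \<longlonglongrightarrow> 0)"


subsection \<open>The Dirichlet Laplacian and its eigenvalues\<close>

text \<open>\<open>dirichlet_laplacian \<Omega> u f\<close>: \<open>u\<close> lies in the domain of the self-adjoint operator \<open>-\<Delta>\<close> on
  \<open>L\<^sup>2(\<Omega>)\<close> with Dirichlet boundary conditions (the Friedrichs extension), and \<open>-\<Delta> u = f\<close>.
  No boundary regularity is needed.\<close>

definition dirichlet_laplacian ::
    "'a::euclidean_space set \<Rightarrow> ('a \<Rightarrow> real) \<Rightarrow> ('a \<Rightarrow> real) \<Rightarrow> bool" where
  "dirichlet_laplacian \<Omega> u f \<longleftrightarrow> f \<in> L2 \<Omega> \<and>
     (\<exists>g. H10_with_gradient \<Omega> u g \<and>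
        (\<forall>\<phi>. test_function \<Omega> \<phi> \<longrightarrow>
           (LINT x|lebesgue_on \<Omega>. g x \<bullet> gradient \<phi> x) = (LINT x|lebesgue_on \<Omega>. f x * \<phi> x)))"

definition dirichlet_eigenspace :: "'a::euclidean_space set \<Rightarrow> real \<Rightarrow> ('a \<Rightarrow> real) set" where
  "dirichlet_eigenspace \<Omega> \<mu> = {u. dirichlet_laplacian \<Omega> u (\<lambda>x. \<mu> * u x)}"

text \<open>Dimension modulo null sets: \<open>u 0, \<dots>, u (m - 1)\<close> represent a basis of the image of \<open>V\<close>
  in \<open>L\<^sup>2(\<Omega>)\<close>.\<close>

definition has_dimension_ae ::
    "'a::euclidean_space set \<Rightarrow> ('a \<Rightarrow> real) set \<Rightarrow> nat \<Rightarrow> bool" where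
  "has_dimension_ae \<Omega> V m \<longleftrightarrow>
     (\<exists>u :: nat \<Rightarrow> 'a \<Rightarrow> real.
        (\<forall>i<m. u i \<in> V) \<and>
        (\<forall>c. (AE x in lebesgue_on \<Omega>. (\<Sum>i<m. c i * u i x) = 0) \<longrightarrow> (\<forall>i<m. c i = 0)) \<and>
        (\<forall>v\<in>V. \<exists>c. AE x in lebesgue_on \<Omega>. v x = (\<Sum>i<m. c i * u i x)))"

text \<open>\<open>lam 1 \<le> lam 2 \<le> \<dots>\<close> lists the eigenvalues with multiplicity: every real \<open>\<mu>\<close> occurs
  \<open>dim ker (-\<Delta> - \<mu>)\<close> times (zero times if it is not an eigenvalue). The value \<open>lam 0\<close> is
  never used.\<close>

definition dirichlet_eigenvalues :: "'a::euclidean_space set \<Rightarrow> (nat \<Rightarrow> real) \<Rightarrow> bool" where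
  "dirichlet_eigenvalues \<Omega> lam \<longleftrightarrow> mono_on {1..} lam \<and>
     (\<forall>\<mu>. finite {k. 1 \<le> k \<and> lam k = \<mu>} \<and>
          has_dimension_ae \<Omega> (dirichlet_eigenspace \<Omega> \<mu>) (card {k. 1 \<le> k \<and> lam k = \<mu>}))"


subsection \<open>Means, Riesz means and the counting function\<close>

definition eigenvalue_mean :: "(nat \<Rightarrow> real) \<Rightarrow> nat \<Rightarrow> real" where
  "eigenvalue_mean lam j = (\<Sum>l=1..j. lam l) / real j"

definition riesz_mean :: "(nat \<Rightarrow> real) \<Rightarrow> real \<Rightarrow> real \<Rightarrow> real" where
  "riesz_mean lam \<sigma> z = (\<Sum>\<^sub>\<infinity>k\<in>{1..}. (max 0 (z - lam k)) powr \<sigma>)"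

definition counting_function :: "(nat \<Rightarrow> real) \<Rightarrow> real \<Rightarrow> real" where
  "counting_function lam z = Lim (at_right 0) (\<lambda>\<sigma>. riesz_mean lam \<sigma> z)"

lemma counting_function_eq_card:
  assumes "finite {k. 1 \<le> k \<and> lam k < z}"
  shows "counting_function lam z = real (card {k. 1 \<le> k \<and> lam k < z})"
proof -
  let ?S = "{k. 1 \<le> k \<and> lam k < z}"
  have R: "riesz_mean lam \<sigma> z = (\<Sum>k\<in>?S. (z - lam k) powr \<sigma>)" for \<sigma>
  proof -
    have "riesz_mean lam \<sigma> z = (\<Sum>\<^sub>\<infinity>k\<in>?S. (z - lam k) powr \<sigma>)"
      unfolding riesz_mean_def by (rule infsum_cong_neutral) (auto simp: max_def)
    then show ?thesis
      using assms by simp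
  qed
  have "((\<lambda>\<sigma>. \<Sum>k\<in>?S. (z - lam k) powr \<sigma>) \<longlongrightarrow> (\<Sum>k\<in>?S. (z - lam k) powr 0)) (at_right 0)"
    by (intro tendsto_sum tendsto_powr tendsto_const tendsto_ident_at) auto
  also have "(\<Sum>k\<in>?S. (z - lam k) powr 0) = (\<Sum>k\<in>?S. 1)"
    by (rule sum.cong) auto
  finally show ?thesis
    unfolding counting_function_def R by (intro tendsto_Lim) auto
qed

end

theory Submission
  imports Defs
begin

text \<open>Using \<open>x\<^sub>i u\<^sub>k\<close>, projected off the eigenfunctions with eigenvalue below \<open>z\<close>, as trial functions for
  the Rayleigh quotient and summing over the coordinates \<open>i\<close> gives Yang's inequality
  \<open>\<Sum>\<^sub>k (z - \<lambda>\<^sub>k)\<^sub>+\<^sup>2 \<le> (4/d) \<Sum>\<^sub>k (z - \<lambda>\<^sub>k)\<^sub>+ \<lambda>\<^sub>k\<close>, that is, \<open>(1 + d/4) R\<^sub>2(z) \<le> z R\<^sub>1(z)\<close>. Since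
  \<open>R\<^sub>2' = 2 R\<^sub>1\<close>, the quotient \<open>R\<^sub>2(z) / z\<^bsup>2+d/2\<^esup>\<close> is nondecreasing; its value at
  \<open>z = (1 + 4/d) m\<close>, where \<open>m\<close> is the mean of the first \<open>j\<close> eigenvalues, is bounded below by the
  Cauchy-Schwarz inequality. The
  bounds for \<open>R\<^sub>1\<close> and \<open>N\<close> follow from Yang's inequality and \<open>R\<^sub>1\<^sup>2 \<le> N R\<^sub>2\<close>, the bound for \<open>\<lambda>\<^sub>k\<^sub>+\<^sub>1\<close> from
  \<open>N(\<lambda>\<^sub>k\<^sub>+\<^sub>1) \<le> k\<close>.

  The Rayleigh quotient bound needs that the form domain contains no other low spectrum. This comes
  from compactness: on a cell of side \<open>h\<close> the variance of \<open>u\<close> is a mean of squared differences over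
  short translations, so up to finitely many linear functionals (the means over the cells)
  \<open>\<parallel>u\<parallel>\<^sup>2 \<le> C h\<^sup>2 \<parallel>\<nabla>u\<parallel>\<^sup>2\<close>.\<close>

subsection \<open>Yang's inequality in a Hilbert space\<close>

text \<open>The list \<open>lam\<close> is given only through the dimensions of the eigenspaces:
  neither discreteness below \<open>z\<close>, nor a min-max principle, nor an expansion in
  eigenfunctions comes with it. The gap is therefore proved by contradiction. A minimizer of the
  Rayleigh quotient on the complement of the listed eigenfunctions would be a further eigenfunction
  below \<open>z\<close>, which the multiplicities exclude. The estimate that makes minimizers exist
  also bounds the size of orthonormal families of bounded energy, so that the Riesz means are finite
  sums.

  Projecting \<open>x_i u_k\<close> leaves double sums over pairs of eigenvalues without a definite
  sign. Projecting the derivative of \<open>u_k\<close> in the same way leaves a second double sum,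
  and by antisymmetry the two cancel exactly.

  The factor \<open>1 + 4/d\<close> comes from maximization:
  \<open>(s - m)^2 / s powr (2 + d/2)\<close> has its maximum over \<open>s > m\<close> at
  \<open>s = (1 + 4/d) m\<close>, the best point from which to start the nondecreasing
  quotient.\<close>

lemma sum_orthonormal:
  fixes u :: "'k \<Rightarrow> 'p::real_inner"
  assumes "finite K" "j \<in> K"
    and "\<And>i j. i \<in> K \<Longrightarrow> j \<in> K \<Longrightarrow> u i \<bullet> u j = (if i = j then 1 else 0)"
  shows "(\<Sum>k\<in>K. c k *\<^sub>R u k) \<bullet> u j = c j"
proof -
  have "(\<Sum>k\<in>K. c k *\<^sub>R u k) \<bullet> u j = (\<Sum>k\<in>K. if k = j then c k else 0)"
    unfolding inner_sum_left by (rule sum.cong) (use assms in auto)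
  then show ?thesis using assms by simp
qed

text \<open>\<open>H\<close> is the graph of the gradient. \<open>X\<close> and \<open>X'\<close> stand for multiplication by a coordinate \<open>x\<^sub>i\<close> of
  functions and of vector fields, \<open>J u = u e\<^sub>i\<close> and \<open>D h = h \<bullet> e\<^sub>i\<close>; so \<open>XH\<close> is the product rule for
  \<open>x\<^sub>i u\<close> and \<open>parts\<close> is integration by parts.\<close>

lemma yang_one_direction:
  fixes u :: "'k \<Rightarrow> 'p::real_inner" and g :: "'k \<Rightarrow> 'q::real_inner" and H :: "('p \<times> 'q) set"
    and lam :: "'k \<Rightarrow> real"
  assumes fin: "finite K" and H: "subspace H"
    and on: "\<And>i j. i \<in> K \<Longrightarrow> j \<in> K \<Longrightarrow> u i \<bullet> u j = (if i = j then 1 else 0)"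
    and uH: "\<And>i. i \<in> K \<Longrightarrow> (u i, g i) \<in> H"
    and eig: "\<And>i v h. i \<in> K \<Longrightarrow> (v, h) \<in> H \<Longrightarrow> g i \<bullet> h = lam i * (u i \<bullet> v)"
    and gap: "\<And>v h. (v, h) \<in> H \<Longrightarrow> (\<forall>i\<in>K. v \<bullet> u i = 0) \<Longrightarrow> z * (v \<bullet> v) \<le> h \<bullet> h"
    and less: "\<And>i. i \<in> K \<Longrightarrow> lam i < z"
    and XH: "\<And>v h. (v, h) \<in> H \<Longrightarrow> (X v, J v + X' h) \<in> H"
    and X_sym: "\<And>v w. X v \<bullet> w = v \<bullet> X w"
    and X'_sym: "\<And>h k. X' h \<bullet> k = h \<bullet> X' k"
    and J_adj: "\<And>v h. J v \<bullet> h = v \<bullet> D h"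
    and parts: "\<And>v h w k. (v, h) \<in> H \<Longrightarrow> (w, k) \<in> H \<Longrightarrow> v \<bullet> D k = - (D h \<bullet> w)"
    and D_XH: "\<And>v h. D (J v + X' h) = v + X (D h)"
  shows "(\<Sum>i\<in>K. (z - lam i)\<^sup>2) \<le> 4 * (\<Sum>i\<in>K. (z - lam i) * (D (g i) \<bullet> D (g i)))"
proof -
  define a where "a i j = X (u i) \<bullet> u j" for i j
  define t where "t i j = D (g i) \<bullet> u j" for i j
  define G where "G i = J (u i) + X' (g i)" for i
  define w where "w i = X (u i) - (\<Sum>j\<in>K. a i j *\<^sub>R u j)" for i
  define h where "h i = G i - (\<Sum>j\<in>K. a i j *\<^sub>R g j)" for i
  define y where "y i = D (g i) - (\<Sum>j\<in>K. t i j *\<^sub>R u j)" for i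
  define P where "P i = 1 + (\<Sum>j\<in>K. (lam i - lam j) * (a i j)\<^sup>2)" for i
  have a_sym: "a i j = a j i" for i j
    by (metis a_def X_sym inner_commute)
  have GH: "(X (u i), G i) \<in> H" if "i \<in> K" for i
    unfolding G_def using XH uH that by blast
  have wH: "(w i, h i) \<in> H" if "i \<in> K" for i
  proof -
    have "(X (u i), G i) - (\<Sum>j\<in>K. a i j *\<^sub>R (u j, g j)) \<in> H"
      by (intro subspace_diff[OF H] subspace_sum[OF H] subspace_scale[OF H] GH uH that)
    moreover have "(X (u i), G i) - (\<Sum>j\<in>K. a i j *\<^sub>R (u j, g j)) = (w i, h i)"
      unfolding w_def h_def by (simp add: prod_eq_iff fst_sum snd_sum)
    ultimately show ?thesis by simp
  qed
  \<comment> \<open>Weak form of the commutator identity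
    \<open>-\<Delta> (x u) = \<lambda> x u - 2 D g\<close>, where \<open>D g\<close> is the
    derivative of \<open>u\<close> in the chosen direction.\<close>
  have key: "G i \<bullet> k = lam i * (X (u i) \<bullet> v) - 2 * (D (g i) \<bullet> v)" if "i \<in> K" "(v, k) \<in> H" for i v k
  proof -
    have "g i \<bullet> (J v + X' k) = lam i * (u i \<bullet> X v)"
      by (rule eig[OF that(1) XH[OF that(2)]])
    moreover have "g i \<bullet> J v = D (g i) \<bullet> v"
      by (metis J_adj inner_commute)
    moreover have "u i \<bullet> D k = - (D (g i) \<bullet> v)"
      by (rule parts[OF uH[OF that(1)] that(2)])
    ultimately show ?thesis
      unfolding G_def inner_add_left J_adj X'_sym X_sym by (simp add: inner_add_right)
  qed
  \<comment> \<open>Testing the commutator identity with another eigenvector ties the matrix of the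
    derivative to that of the coordinate, so only \<open>a\<close> survives in the final
    sums.\<close>
  have comm: "2 * t i j = (lam i - lam j) * a i j" if "i \<in> K" "j \<in> K" for i j
  proof -
    have "g j \<bullet> G i = lam j * (u j \<bullet> X (u i))"
      by (rule eig[OF that(2) GH[OF that(1)]])
    then have "G i \<bullet> g j = lam j * a i j"
      unfolding a_def by (simp add: inner_commute)
    with key[OF that(1) uH[OF that(2)]] show ?thesis
      unfolding a_def t_def by (simp add: algebra_simps)
  qed
  have w_orth: "w i \<bullet> u j = 0" if "i \<in> K" "j \<in> K" for i j
    unfolding w_def inner_diff_left
    by (subst sum_orthonormal[OF fin that(2)]) (simp_all add: on a_def)
  have w_orth_sum: "(\<Sum>j\<in>K. c j *\<^sub>R u j) \<bullet> w i = 0" if "i \<in> K" for i c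
    unfolding inner_sum_left using w_orth[OF that] by (simp add: inner_commute)
  \<comment> \<open>The 1 in \<open>P i\<close> is \<open>-2 (D (g i) \<bullet> X (u i))\<close>:
    integrate by parts and use that \<open>D\<close> and \<open>X\<close> commute up to the
    identity. The sum in \<open>P i\<close> is the effect of the projection.\<close>
  have Pw: "-2 * (D (g i) \<bullet> w i) = P i" if "i \<in> K" for i
  proof -
    have "u i \<bullet> D (G i) = - (D (g i) \<bullet> X (u i))"
      by (rule parts[OF uH[OF that] GH[OF that]])
    then have "u i \<bullet> u i + X (u i) \<bullet> D (g i) = - (D (g i) \<bullet> X (u i))"
      unfolding G_def D_XH inner_add_right X_sym .
    then have 1: "-2 * (D (g i) \<bullet> X (u i)) = 1"
      using on[OF that that] by (simp add: inner_commute)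
    have "D (g i) \<bullet> w i = D (g i) \<bullet> X (u i) - (\<Sum>j\<in>K. a i j * t i j)"
      unfolding w_def inner_diff_right inner_sum_right t_def by simp
    moreover have "(\<Sum>j\<in>K. (lam i - lam j) * (a i j)\<^sup>2) = (\<Sum>j\<in>K. 2 * (a i j * t i j))"
    proof (rule sum.cong[OF refl])
      fix j assume "j \<in> K"
      have "2 * (a i j * t i j) = (2 * t i j) * a i j" by simp
      also have "\<dots> = (lam i - lam j) * (a i j)\<^sup>2"
        unfolding comm[OF that \<open>j \<in> K\<close>] by (simp add: power2_eq_square)
      finally show "(lam i - lam j) * (a i j)\<^sup>2 = 2 * (a i j * t i j)" by simp
    qed
    ultimately show ?thesis
      using 1 unfolding P_def by (simp add: sum_distrib_left)
  qed
  \<comment> \<open>Since \<open>h i\<close> is orthogonal to every \<open>g j\<close>, the energy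
    of the trial vector can be computed from \<open>G i\<close> alone. It exceeds
    \<open>lam i * (w i \<bullet> w i)\<close> by \<open>P i\<close>, and the gap bounds it
    below.\<close>
  have wP: "(z - lam i) * (w i \<bullet> w i) \<le> P i" if "i \<in> K" for i
  proof -
    have "g j \<bullet> h i = 0" if "j \<in> K" for j
      using eig[OF that wH[OF \<open>i \<in> K\<close>]] w_orth[OF \<open>i \<in> K\<close> that] by (simp add: inner_commute)
    then have "h i \<bullet> h i = G i \<bullet> h i"
      by (subst (1) h_def) (simp add: inner_diff_left inner_sum_left)
    also have "\<dots> = lam i * (X (u i) \<bullet> w i) + P i"
      using key[OF that wH[OF that]] Pw[OF that] by simp
    also have "X (u i) \<bullet> w i = w i \<bullet> w i"
      by (subst (2) w_def) (simp add: inner_diff_left w_orth_sum[OF that])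
    finally show ?thesis
      using gap[OF wH[OF that]] w_orth[OF that] by (simp add: algebra_simps)
  qed
  \<comment> \<open>Cauchy-Schwarz for \<open>y i\<close> and \<open>w i\<close>, written as one
    nonnegative square so that \<open>w i = 0\<close> is covered. As \<open>w i\<close> is
    orthogonal to the eigenvectors, \<open>D (g i)\<close> may be replaced by its projection
    \<open>y i\<close>; the squares \<open>t i j\<close> gained in this way become the second double
    sum.\<close>
  have Py: "(z - lam i) * P i \<le> 4 * (D (g i) \<bullet> D (g i) - (\<Sum>j\<in>K. (t i j)\<^sup>2))" if "i \<in> K" for i
  proof -
    have "y i \<bullet> (\<Sum>j\<in>K. t i j *\<^sub>R u j) = 0"
      unfolding y_def inner_diff_left inner_sum_right inner_scaleR_right
      by (simp add: sum_subtractf[symmetric] algebra_simps t_def[symmetric]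
          sum_orthonormal[OF fin _ on] cong: sum.cong)
    then have "y i \<bullet> y i = y i \<bullet> D (g i)"
      by (subst (2) y_def) (simp add: inner_diff_right)
    also have "\<dots> = D (g i) \<bullet> D (g i) - (\<Sum>j\<in>K. (t i j)\<^sup>2)"
      unfolding y_def by (simp add: inner_diff_left inner_diff_right inner_sum_left inner_sum_right t_def
          power2_eq_square inner_commute)
    finally have yy: "y i \<bullet> y i = D (g i) \<bullet> D (g i) - (\<Sum>j\<in>K. (t i j)\<^sup>2)" .
    have yw: "-2 * (y i \<bullet> w i) = P i"
      using Pw[OF that] unfolding y_def by (simp add: inner_diff_left w_orth_sum[OF that])
    have "0 \<le> (2 *\<^sub>R y i + (z - lam i) *\<^sub>R w i) \<bullet> (2 *\<^sub>R y i + (z - lam i) *\<^sub>R w i)"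
      by simp
    also have "\<dots> = 4 * (y i \<bullet> y i) + 2 * (z - lam i) * (2 * (y i \<bullet> w i))
        + (z - lam i) * ((z - lam i) * (w i \<bullet> w i))"
      by (simp add: inner_add_left inner_add_right inner_commute algebra_simps)
    also have "\<dots> \<le> 4 * (y i \<bullet> y i) + 2 * (z - lam i) * (- P i) + (z - lam i) * P i"
    proof -
      have "2 * (y i \<bullet> w i) = - P i" using yw by simp
      moreover have "(z - lam i) * ((z - lam i) * (w i \<bullet> w i)) \<le> (z - lam i) * P i"
        using wP[OF that] less[OF that] by (intro mult_left_mono) auto
      ultimately show ?thesis by simp
    qed
    finally show ?thesis
      using yy by (simp add: algebra_simps)
  qed
  let ?A = "\<Sum>i\<in>K. \<Sum>j\<in>K. (z - lam i)\<^sup>2 * (lam i - lam j) * (a i j)\<^sup>2"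
  let ?B = "\<Sum>i\<in>K. \<Sum>j\<in>K. (z - lam i) * (lam i - lam j)\<^sup>2 * (a i j)\<^sup>2"
  have A_swap: "?A = (\<Sum>i\<in>K. \<Sum>j\<in>K. (z - lam j)\<^sup>2 * (lam j - lam i) * (a i j)\<^sup>2)"
    by (subst sum.swap) (simp add: a_sym)
  have B_swap: "?B = (\<Sum>i\<in>K. \<Sum>j\<in>K. (z - lam j) * (lam i - lam j)\<^sup>2 * (a i j)\<^sup>2)"
    by (subst sum.swap) (simp add: a_sym power2_commute)
  \<comment> \<open>Each double sum is added to its transpose. As \<open>a\<close> is symmetric and
    \<open>(z - lam i)^2 - (z - lam j)^2 = (lam j - lam i) (2 z - lam i - lam j)\<close>, the
    summands are opposite.\<close>
  have "2 * ?A + 2 * ?B = 0"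
    unfolding mult_2 by (subst (2) A_swap, subst (2) B_swap)
      (simp add: sum.distrib[symmetric], rule sum.neutral, rule ballI, rule sum.neutral, rule ballI,
        simp add: power2_eq_square algebra_simps)
  then have AB: "?A = - ?B" by simp
  have "(\<Sum>i\<in>K. (z - lam i) * ((z - lam i) * P i)) \<le>
      (\<Sum>i\<in>K. (z - lam i) * (4 * (D (g i) \<bullet> D (g i) - (\<Sum>j\<in>K. (t i j)\<^sup>2))))"
    by (intro sum_mono mult_left_mono Py) (use less in \<open>auto simp: less_imp_le\<close>)
  moreover have "(\<Sum>i\<in>K. (z - lam i) * ((z - lam i) * P i)) = (\<Sum>i\<in>K. (z - lam i)\<^sup>2) + ?A"
    unfolding P_def by (simp add: power2_eq_square algebra_simps sum.distrib sum_distrib_left sum_subtractf)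
  moreover have "(\<Sum>i\<in>K. (z - lam i) * (4 * (D (g i) \<bullet> D (g i) - (\<Sum>j\<in>K. (t i j)\<^sup>2)))) =
      4 * (\<Sum>i\<in>K. (z - lam i) * (D (g i) \<bullet> D (g i))) - ?B"
  proof -
    have "?B = (\<Sum>i\<in>K. (z - lam i) * (4 * (\<Sum>j\<in>K. (t i j)\<^sup>2)))"
    proof (rule sum.cong[OF refl])
      fix i assume "i \<in> K"
      then have "(lam i - lam j)\<^sup>2 * (a i j)\<^sup>2 = 4 * (t i j)\<^sup>2" if "j \<in> K" for j
        using comm[OF _ that] by (metis power_mult_distrib four_x_squared)
      then show "(\<Sum>j\<in>K. (z - lam i) * (lam i - lam j)\<^sup>2 * (a i j)\<^sup>2) = (z - lam i) * (4 * (\<Sum>j\<in>K. (t i j)\<^sup>2))"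
        by (simp add: sum_distrib_left mult.assoc)
    qed
    then show ?thesis
      by (simp add: right_diff_distrib sum_subtractf sum_distrib_left mult.left_commute)
  qed
  ultimately show ?thesis
    using AB by simp
qed

subsection \<open>Compactness and the spectral gap\<close>

lemma bessel_inequality:
  fixes u :: "'k \<Rightarrow> 'p::real_inner"
  assumes "finite F"
    and on: "\<And>i j. i \<in> F \<Longrightarrow> j \<in> F \<Longrightarrow> u i \<bullet> u j = (if i = j then 1 else 0)"
  shows "(\<Sum>i\<in>F. (u i \<bullet> e)\<^sup>2) \<le> e \<bullet> e"
proof -
  define s where "s = (\<Sum>i\<in>F. (u i \<bullet> e) *\<^sub>R u i)"
  have "s \<bullet> s = (\<Sum>i\<in>F. (u i \<bullet> e) * (s \<bullet> u i))"
    by (subst (2) s_def) (simp add: inner_sum_right)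
  also have "\<dots> = (\<Sum>i\<in>F. (u i \<bullet> e)\<^sup>2)"
    unfolding s_def by (rule sum.cong[OF refl], subst sum_orthonormal[OF assms(1)])
      (auto simp: on power2_eq_square)
  finally have "s \<bullet> s = (\<Sum>i\<in>F. (u i \<bullet> e)\<^sup>2)" .
  moreover have "s \<bullet> e = (\<Sum>i\<in>F. (u i \<bullet> e)\<^sup>2)"
    unfolding s_def by (simp add: inner_sum_left power2_eq_square)
  moreover have "0 \<le> (e - s) \<bullet> (e - s)" by simp
  ultimately show ?thesis
    by (simp add: inner_diff_left inner_diff_right inner_commute)
qed

text \<open>Summing \<open>compact\<close> over \<open>F\<close> and exchanging the sums, Bessel's
  inequality bounds the contribution of each functional independently of \<open>F\<close>. When
  \<open>\<epsilon> * z < 1\<close>, this limits the number of orthonormal vectors with energy at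
  most \<open>z\<close>.\<close>

lemma eigenvalue_count_bound:
  fixes u :: "'k \<Rightarrow> 'p::real_inner" and g :: "'k \<Rightarrow> 'q::real_inner"
  assumes fin: "finite F" and eps: "0 \<le> \<epsilon>"
    and on: "\<And>i j. i \<in> F \<Longrightarrow> j \<in> F \<Longrightarrow> u i \<bullet> u j = (if i = j then 1 else 0)"
    and energy: "\<And>i. i \<in> F \<Longrightarrow> g i \<bullet> g i \<le> z"
    and compact: "\<And>i. i \<in> F \<Longrightarrow> u i \<bullet> u i \<le> \<epsilon> * (g i \<bullet> g i) + (\<Sum>e\<in>E. (u i \<bullet> b e)\<^sup>2)"
  shows "real (card F) * (1 - \<epsilon> * z) \<le> (\<Sum>e\<in>E. b e \<bullet> b e)"
proof -
  have "real (card F) * (1 - \<epsilon> * z) = (\<Sum>i\<in>F. 1 - \<epsilon> * z)" by simp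
  also have "\<dots> \<le> (\<Sum>i\<in>F. \<Sum>e\<in>E. (u i \<bullet> b e)\<^sup>2)"
  proof (rule sum_mono)
    fix i assume i: "i \<in> F"
    have "\<epsilon> * (g i \<bullet> g i) \<le> \<epsilon> * z" by (rule mult_left_mono[OF energy[OF i] eps])
    with compact[OF i] on[OF i i] show "1 - \<epsilon> * z \<le> (\<Sum>e\<in>E. (u i \<bullet> b e)\<^sup>2)" by simp
  qed
  also have "\<dots> = (\<Sum>e\<in>E. \<Sum>i\<in>F. (u i \<bullet> b e)\<^sup>2)" by (rule sum.swap)
  also have "\<dots> \<le> (\<Sum>e\<in>E. b e \<bullet> b e)"
    by (intro sum_mono bessel_inequality fin on)
  finally show ?thesis .
qed

text \<open>The parallelogram identity controls squared distances by one term per index, which is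
  the shape of the estimates for minimizing sequences.\<close>

lemma Cauchy_if_dist_power2_le:
  fixes x :: "nat \<Rightarrow> 'p::metric_space"
  assumes le: "\<And>n m. (dist (x n) (x m))\<^sup>2 \<le> \<beta> n + \<beta> m" and lim: "\<beta> \<longlonglongrightarrow> 0"
  shows "Cauchy x"
proof (rule metric_CauchyI)
  fix e :: real assume e: "0 < e"
  have "\<forall>\<^sub>F n in sequentially. \<beta> n < e\<^sup>2 / 2"
    using order_tendstoD(2)[OF lim, of "e\<^sup>2 / 2"] e by simp
  then obtain N where N: "\<And>n. n \<ge> N \<Longrightarrow> \<beta> n < e\<^sup>2 / 2"
    unfolding eventually_sequentially by blast
  have "dist (x m) (x n) < e" if "m \<ge> N" "n \<ge> N" for m n
  proof -
    have "(dist (x m) (x n))\<^sup>2 < e\<^sup>2"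
      using le[of m n] N[OF that(1)] N[OF that(2)] by linarith
    then show ?thesis using e by (simp add: power2_less_imp_less)
  qed
  then show "\<exists>M. \<forall>m\<ge>M. \<forall>n\<ge>M. dist (x m) (x n) < e" by blast
qed

lemma convergent_coordinates_subseq:
  fixes v :: "nat \<Rightarrow> 'p::real_inner"
  assumes "finite E" and bound: "\<And>n. norm (v n) \<le> B"
  obtains r l where "strict_mono (r :: nat \<Rightarrow> nat)" "\<And>e. e \<in> E \<Longrightarrow> (\<lambda>n. v (r n) \<bullet> e) \<longlonglongrightarrow> l e"
proof -
  define f where "f n e = v n \<bullet> e" for n and e :: 'p
  have bd: "bounded ((\<lambda>x. x e) ` range f)" if "e \<in> E" for e
  proof (rule boundedI)
    fix y assume "y \<in> (\<lambda>x. x e) ` range f"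
    then obtain n where y: "y = v n \<bullet> e" by (auto simp: f_def)
    have "norm y \<le> norm (v n) * norm e" unfolding y by (simp add: Cauchy_Schwarz_ineq2)
    also have "\<dots> \<le> B * norm e" by (intro mult_right_mono bound) auto
    finally show "norm y \<le> B * norm e" .
  qed
  have "\<exists>l r. strict_mono (r :: nat \<Rightarrow> nat) \<and>
      (\<forall>\<epsilon>>0. \<forall>\<^sub>F n in sequentially. \<forall>e\<in>E. dist (f (r n) e) (l e) < \<epsilon>)"
    by (rule compact_lemma_general[OF assms(1), of "\<lambda>x. x" f "\<lambda>x. x", rule_format, OF bd _ _ order_refl]) simp_all
  then obtain l r where r: "strict_mono (r :: nat \<Rightarrow> nat)"
    and l: "\<And>\<epsilon>. \<epsilon> > 0 \<Longrightarrow> \<forall>\<^sub>F n in sequentially. \<forall>e\<in>E. dist (f (r n) e) (l e) < \<epsilon>" by blast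
  have "(\<lambda>n. v (r n) \<bullet> e) \<longlonglongrightarrow> l e" if "e \<in> E" for e
    unfolding tendsto_iff using that by (auto simp: f_def dest!: l elim!: eventually_mono)
  with r that show ?thesis by blast
qed

text \<open>For small \<open>t\<close> of the sign opposite to \<open>b\<close> the linear term
  would win. This turns minimality into the weak eigenvalue equation.\<close>

lemma linear_term_zero:
  fixes b c :: real
  assumes "\<And>t. 0 \<le> 2 * t * b + t\<^sup>2 * c"
  shows "b = 0"
proof (rule ccontr)
  assume b: "b \<noteq> 0"
  \<comment> \<open>\<open>s\<close> is positive and exceeds \<open>c\<close> whatever the sign of
    \<open>c\<close>, so \<open>c - 2 * s\<close> is negative.\<close>
  define s where "s = \<bar>c\<bar> + 1"
  have s: "s > 0" "c < s" by (auto simp: s_def)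
  have "0 \<le> 2 * (- b / s) * b + (- b / s)\<^sup>2 * c" by (rule assms)
  also have "\<dots> = (b\<^sup>2 / s\<^sup>2) * (c - 2 * s)" using s by (simp add: field_simps power2_eq_square)
  also have "\<dots> < 0" using s b by (intro mult_pos_neg) auto
  finally show False by simp
qed

text \<open>The hypothesis \<open>compact\<close> replaces Rellich's theorem. One \<open>\<epsilon>\<close> suffices: modulo finitely many
  functionals the form \<open>\<parallel>h\<parallel>\<^sup>2 - \<mu> \<parallel>v\<parallel>\<^sup>2\<close> is coercive, so by the parallelogram identity a minimizing
  sequence has a Cauchy subsequence.\<close>

lemma spectral_gap:
  fixes H :: "('p::{real_inner,complete_space} \<times> 'q::{real_inner,complete_space}) set"
    and u :: "'k \<Rightarrow> 'p" and g :: "'k \<Rightarrow> 'q" and lam :: "'k \<Rightarrow> real"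
  assumes H: "subspace H" and H_closed: "closed H"
    and fin_E: "finite E" and eps: "0 \<le> \<epsilon>" "\<epsilon> * z < 1"
    and compact: "\<And>v h. (v, h) \<in> H \<Longrightarrow> v \<bullet> v \<le> \<epsilon> * (h \<bullet> h) + (\<Sum>e\<in>E. (v \<bullet> b e)\<^sup>2)"
    and fin: "finite K"
    and on: "\<And>i j. i \<in> K \<Longrightarrow> j \<in> K \<Longrightarrow> u i \<bullet> u j = (if i = j then 1 else 0)"
    and uH: "\<And>i. i \<in> K \<Longrightarrow> (u i, g i) \<in> H"
    and eig: "\<And>i v h. i \<in> K \<Longrightarrow> (v, h) \<in> H \<Longrightarrow> g i \<bullet> h = lam i * (u i \<bullet> v)"
    and all_eig: "\<And>v h \<mu>. (v, h) \<in> H \<Longrightarrow> (\<And>w k. (w, k) \<in> H \<Longrightarrow> h \<bullet> k = \<mu> * (v \<bullet> w)) \<Longrightarrow>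
       \<mu> < z \<Longrightarrow> (\<forall>i\<in>K. v \<bullet> u i = 0) \<Longrightarrow> v = 0"
    and vh: "(v, h) \<in> H" "\<forall>i\<in>K. v \<bullet> u i = 0"
  shows "z * (v \<bullet> v) \<le> h \<bullet> h"
proof (rule ccontr)
  assume neg: "\<not> z * (v \<bullet> v) \<le> h \<bullet> h"
  define V where "V = {p \<in> H. \<forall>i\<in>K. fst p \<bullet> u i = 0}"
  have V: "subspace V"
    unfolding subspace_def V_def
    using subspace_0[OF H] subspace_add[OF H] subspace_scale[OF H] by (auto simp: inner_add_left)
  have "V = H \<inter> (\<Inter>i\<in>K. {p. fst p \<bullet> u i = 0})" unfolding V_def by auto
  moreover have "closed {p :: 'p \<times> 'q. fst p \<bullet> u i = 0}" for i
    by (intro closed_Collect_eq continuous_intros)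
  ultimately have V_closed: "closed V" using H_closed by auto
  have v0: "v \<noteq> 0"
  proof
    assume "v = 0"
    with neg show False by simp
  qed
  \<comment> \<open>The Rayleigh quotients on the orthogonal complement of the listed eigenvectors.
    If the claim fails, their infimum \<open>\<mu>\<close> lies below \<open>z\<close>; it will be
    attained, and at an eigenvector that the list misses.\<close>
  define S where "S = {snd p \<bullet> snd p | p. p \<in> V \<and> norm (fst p) = 1}"
  have S_mem: "(k \<bullet> k) / (w \<bullet> w) \<in> S" if "(w, k) \<in> V" "w \<noteq> 0" for w k
  proof -
    have "(1 / norm w) *\<^sub>R (w, k) \<in> V" by (rule subspace_scale[OF V that(1)])
    moreover have "(k \<bullet> k) / (w \<bullet> w) = snd ((1 / norm w) *\<^sub>R (w, k)) \<bullet> snd ((1 / norm w) *\<^sub>R (w, k))"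
      by (simp add: power2_norm_eq_inner[symmetric] power2_eq_square)
    moreover have "norm (fst ((1 / norm w) *\<^sub>R (w, k))) = 1" using that by simp
    ultimately show ?thesis unfolding S_def by blast
  qed
  have bdd: "bdd_below S" unfolding S_def bdd_below_def by (rule exI[of _ 0]) auto
  define \<mu> where "\<mu> = Inf S"
  have vV: "(v, h) \<in> V" using vh by (simp add: V_def)
  have "\<mu> \<le> (h \<bullet> h) / (v \<bullet> v)" unfolding \<mu>_def by (rule cInf_lower[OF S_mem[OF vV v0] bdd])
  also have "\<dots> < z" using neg v0 by (simp add: divide_less_eq mult.commute)
  finally have \<mu>_less: "\<mu> < z" .
  have S_ne: "S \<noteq> {}" using S_mem[OF vV v0] by auto
  have \<mu>_nonneg: "0 \<le> \<mu>" unfolding \<mu>_def by (rule cInf_greatest[OF S_ne]) (auto simp: S_def)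
  define q where "q p = snd p \<bullet> snd p - \<mu> * (fst p \<bullet> fst p)" for p :: "'p \<times> 'q"
  have q_nonneg: "0 \<le> q p" if "p \<in> V" for p
  proof (cases "fst p = 0")
    case False
    then have "\<mu> \<le> (snd p \<bullet> snd p) / (fst p \<bullet> fst p)"
      unfolding \<mu>_def using that by (intro cInf_lower[OF S_mem bdd]) auto
    then show ?thesis using False unfolding q_def by (simp add: le_divide_eq)
  qed (simp add: q_def)
  have "\<exists>p\<in>V. norm (fst p) = 1 \<and> q p < 1 / real (Suc n)" for n
  proof -
    have "Inf S < \<mu> + 1 / real (Suc n)" unfolding \<mu>_def by simp
    then obtain s where s: "s \<in> S" "s < \<mu> + 1 / real (Suc n)"
      using cInf_lessD[OF S_ne] by blast
    then obtain p where "p \<in> V" "norm (fst p) = 1" "s = snd p \<bullet> snd p" unfolding S_def by blast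
    with s(2) show ?thesis
      by (intro bexI[of _ p]) (auto simp: q_def power2_norm_eq_inner[symmetric])
  qed
  then obtain p where pV: "\<And>n. p n \<in> V" and p_norm: "\<And>n. norm (fst (p n)) = 1"
    and qp: "\<And>n. q (p n) < 1 / real (Suc n)" by metis
  obtain r l' where r: "strict_mono (r :: nat \<Rightarrow> nat)"
    and l': "\<And>e. e \<in> b ` E \<Longrightarrow> (\<lambda>n. fst (p (r n)) \<bullet> e) \<longlonglongrightarrow> l' e"
    using convergent_coordinates_subseq[of "b ` E" "\<lambda>n. fst (p n)" 1] fin_E p_norm by auto
  define l where "l e = l' (b e)" for e
  have l: "(\<lambda>n. fst (p (r n)) \<bullet> b e) \<longlonglongrightarrow> l e" if "e \<in> E" for e
    unfolding l_def using l' that by blast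
  have "(\<lambda>n. q (p n)) \<longlonglongrightarrow> 0"
    by (rule tendsto_sandwich[OF _ _ tendsto_const LIMSEQ_inverse_real_of_nat])
      (use q_nonneg pV qp in \<open>auto simp: inverse_eq_divide less_imp_le intro!: always_eventually\<close>)
  then have q_lim: "(\<lambda>n. q (p (r n))) \<longlonglongrightarrow> 0"
    using LIMSEQ_subseq_LIMSEQ[OF _ r, of "\<lambda>n. q (p n)"] by (simp add: comp_def)
  have \<epsilon>\<mu>: "\<epsilon> * \<mu> < 1" using mult_left_mono[of \<mu> z \<epsilon>] \<mu>_less eps by linarith
  \<comment> \<open>\<open>\<beta>\<close> and \<open>\<gamma>\<close> control the squared distances
    of the two components. In \<open>fst_diff\<close>, \<open>compact\<close> bounds the squared
    distance by \<open>\<epsilon> * \<mu>\<close> times itself plus terms tending to 0; absorbing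
    the former on the left produces the divisor \<open>1 - \<epsilon> * \<mu>\<close>.\<close>
  define \<beta> where "\<beta> n = (\<epsilon> * (2 * q (p (r n))) + (\<Sum>e\<in>E. 2 * (fst (p (r n)) \<bullet> b e - l e)\<^sup>2)) / (1 - \<epsilon> * \<mu>)" for n
  define \<gamma> where "\<gamma> n = 2 * q (p (r n)) + \<mu> * \<beta> n" for n
  have "(\<lambda>n. fst (p (r n)) \<bullet> b e - l e) \<longlonglongrightarrow> 0" if "e \<in> E" for e
    using tendsto_diff[OF l[OF that] tendsto_const[of "l e"]] by simp
  then have "(\<lambda>n. \<Sum>e\<in>E. 2 * (fst (p (r n)) \<bullet> b e - l e)\<^sup>2) \<longlonglongrightarrow> (\<Sum>e\<in>E. 2 * 0\<^sup>2)"
    by (intro tendsto_sum tendsto_mult tendsto_const tendsto_power) auto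
  then have "\<beta> \<longlonglongrightarrow> (\<epsilon> * (2 * 0) + (\<Sum>e\<in>E. 2 * 0\<^sup>2)) / (1 - \<epsilon> * \<mu>)"
    unfolding \<beta>_def using \<epsilon>\<mu> by (intro tendsto_divide tendsto_add tendsto_mult tendsto_const q_lim) auto
  then have \<beta>_lim: "\<beta> \<longlonglongrightarrow> 0" by simp
  then have \<gamma>_lim: "\<gamma> \<longlonglongrightarrow> 0"
    unfolding \<gamma>_def using tendsto_add[OF tendsto_mult[OF tendsto_const[of 2] q_lim]
      tendsto_mult[OF tendsto_const[of \<mu>] \<beta>_lim]] by simp
  have para: "q (x - y) \<le> 2 * q x + 2 * q y" if "x \<in> V" "y \<in> V" for x y
  proof -
    have "q (x - y) + q (x + y) = 2 * q x + 2 * q y"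
      unfolding q_def by (simp add: inner_diff_left inner_diff_right inner_add_left inner_add_right
          inner_commute algebra_simps)
    with q_nonneg[OF subspace_add[OF V that]] show ?thesis by linarith
  qed
  have fst_diff: "(dist (fst (p (r n))) (fst (p (r m))))\<^sup>2 \<le> \<beta> n + \<beta> m" for n m
  proof -
    let ?x = "p (r n)" and ?y = "p (r m)"
    let ?D = "(fst ?x - fst ?y) \<bullet> (fst ?x - fst ?y)"
    have "?x - ?y \<in> H" using subspace_diff[OF V pV pV] unfolding V_def by auto
    then have "(fst ?x - fst ?y, snd ?x - snd ?y) \<in> H" by (simp add: minus_prod_def)
    from compact[OF this] have "?D \<le> \<epsilon> * (q (?x - ?y) + \<mu> * ?D)
        + (\<Sum>e\<in>E. ((fst ?x - fst ?y) \<bullet> b e)\<^sup>2)"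
      by (simp add: q_def)
    also have "\<dots> \<le> \<epsilon> * (2 * q ?x + 2 * q ?y + \<mu> * ?D)
        + (\<Sum>e\<in>E. 2 * (fst ?x \<bullet> b e - l e)\<^sup>2 + 2 * (fst ?y \<bullet> b e - l e)\<^sup>2)"
    proof (intro add_mono mult_left_mono sum_mono eps \<mu>_nonneg para pV order_refl)
      fix e
      have "0 \<le> ((fst ?x \<bullet> b e - l e) + (fst ?y \<bullet> b e - l e))\<^sup>2" by simp
      then show "((fst ?x - fst ?y) \<bullet> b e)\<^sup>2 \<le> 2 * (fst ?x \<bullet> b e - l e)\<^sup>2 + 2 * (fst ?y \<bullet> b e - l e)\<^sup>2"
        by (simp add: inner_diff_left power2_eq_square algebra_simps)
    qed
    finally have "(1 - \<epsilon> * \<mu>) * ?D \<le> (\<epsilon> * (2 * q ?x) + (\<Sum>e\<in>E. 2 * (fst ?x \<bullet> b e - l e)\<^sup>2))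
        + (\<epsilon> * (2 * q ?y) + (\<Sum>e\<in>E. 2 * (fst ?y \<bullet> b e - l e)\<^sup>2))"
      by (simp add: sum.distrib algebra_simps)
    then have "?D \<le> \<beta> n + \<beta> m"
      unfolding \<beta>_def add_divide_distrib[symmetric] using \<epsilon>\<mu> by (simp add: le_divide_eq mult.commute)
    then show ?thesis by (simp add: dist_norm power2_norm_eq_inner)
  qed
  have snd_diff: "(dist (snd (p (r n))) (snd (p (r m))))\<^sup>2 \<le> \<gamma> n + \<gamma> m" for n m
  proof -
    let ?x = "p (r n)" and ?y = "p (r m)"
    have "(dist (snd ?x) (snd ?y))\<^sup>2 = q (?x - ?y) + \<mu> * (dist (fst ?x) (fst ?y))\<^sup>2"
      by (simp add: q_def dist_norm power2_norm_eq_inner)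
    also have "\<dots> \<le> (2 * q ?x + 2 * q ?y) + \<mu> * (\<beta> n + \<beta> m)"
      by (intro add_mono mult_left_mono para pV fst_diff \<mu>_nonneg)
    finally show ?thesis by (simp add: \<gamma>_def algebra_simps)
  qed
  obtain w where w: "(\<lambda>n. fst (p (r n))) \<longlonglongrightarrow> w"
    using Cauchy_convergent[OF Cauchy_if_dist_power2_le[OF fst_diff \<beta>_lim]] unfolding convergent_def by blast
  obtain k where k: "(\<lambda>n. snd (p (r n))) \<longlonglongrightarrow> k"
    using Cauchy_convergent[OF Cauchy_if_dist_power2_le[OF snd_diff \<gamma>_lim]] unfolding convergent_def by blast
  have p_lim: "(\<lambda>n. p (r n)) \<longlonglongrightarrow> (w, k)" using tendsto_Pair[OF w k] by simp
  from closed_sequentially[OF V_closed _ this] have wkV: "(w, k) \<in> V"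
    using pV by simp
  have w_norm: "norm w = 1"
    using tendsto_norm[OF w] unfolding p_norm LIMSEQ_const_iff by simp
  have "(\<lambda>n. q (p (r n))) \<longlonglongrightarrow> q (w, k)"
    unfolding q_def by (intro tendsto_intros p_lim)
  then have q0: "q (w, k) = 0" by (rule LIMSEQ_unique[OF _ q_lim])
  have varV: "k \<bullet> k' = \<mu> * (w \<bullet> w')" if "(w', k') \<in> V" for w' k'
  proof -
    have "0 \<le> 2 * t * (k \<bullet> k' - \<mu> * (w \<bullet> w')) + t\<^sup>2 * q (w', k')" for t
    proof -
      have "0 \<le> q ((w, k) + t *\<^sub>R (w', k'))"
        by (intro q_nonneg subspace_add[OF V] subspace_scale[OF V] wkV that)
      also have "\<dots> = q (w, k) + 2 * t * (k \<bullet> k' - \<mu> * (w \<bullet> w')) + t\<^sup>2 * q (w', k')"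
        unfolding q_def by (simp add: inner_add_left inner_add_right inner_commute power2_eq_square algebra_simps)
      finally show ?thesis using q0 by simp
    qed
    from linear_term_zero[OF this] show ?thesis by simp
  qed
  have w_orth: "w \<bullet> u i = 0" if "i \<in> K" for i using wkV that unfolding V_def by auto
  have wkH: "(w, k) \<in> H" using wkV by (simp add: V_def)
  \<comment> \<open>So far the eigenvalue equation is tested only on \<open>V\<close>. Removing from
    a test pair its components along the \<open>u i\<close> brings it into \<open>V\<close>, and the
    removed part contributes nothing because
    \<open>k \<bullet> g i = lam i * (u i \<bullet> w) = 0\<close>.\<close>
  have "w = 0"
  proof (rule all_eig[OF wkH _ \<mu>_less])
    fix w' k' assume w'H: "(w', k') \<in> H"
    define w'' where "w'' = w' - (\<Sum>i\<in>K. (w' \<bullet> u i) *\<^sub>R u i)"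
    define k'' where "k'' = k' - (\<Sum>i\<in>K. (w' \<bullet> u i) *\<^sub>R g i)"
    have "(w', k') - (\<Sum>i\<in>K. (w' \<bullet> u i) *\<^sub>R (u i, g i)) \<in> H"
      by (intro subspace_diff[OF H] subspace_sum[OF H] subspace_scale[OF H] uH w'H)
    moreover have "(w', k') - (\<Sum>i\<in>K. (w' \<bullet> u i) *\<^sub>R (u i, g i)) = (w'', k'')"
      unfolding w''_def k''_def by (simp add: prod_eq_iff fst_sum snd_sum)
    moreover have "w'' \<bullet> u i = 0" if "i \<in> K" for i
      unfolding w''_def inner_diff_left
      by (subst sum_orthonormal[OF fin that]) (simp_all add: on)
    ultimately have "(w'', k'') \<in> V" unfolding V_def by auto
    from varV[OF this] have "k \<bullet> k'' = \<mu> * (w \<bullet> w'')" .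
    moreover have "k \<bullet> g i = 0" if "i \<in> K" for i
      using eig[OF that wkH] w_orth[OF that] by (simp add: inner_commute)
    ultimately show "k \<bullet> k' = \<mu> * (w \<bullet> w')"
      unfolding w''_def k''_def by (simp add: inner_diff_right inner_sum_right w_orth)
  qed (use w_orth in auto)
  then show False using w_norm by simp
qed

subsection \<open>The Hilbert space of square integrable functions\<close>

definition square_integrable :: "('a::euclidean_space \<Rightarrow> 'b::euclidean_space) \<Rightarrow> bool" where
  "square_integrable f \<longleftrightarrow> f \<in> borel_measurable lebesgue \<and> integrable lebesgue (\<lambda>x. (norm (f x))\<^sup>2)"

lemma square_integrable_measurable: "square_integrable f \<Longrightarrow> f \<in> borel_measurable lebesgue"
  by (simp add: square_integrable_def)

lemma square_integrable_bound:
  assumes f: "square_integrable f" and g: "g \<in> borel_measurable lebesgue"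
    and le: "\<And>x. norm (g x) \<le> C * norm (f x)"
  shows "square_integrable g"
proof -
  have "integrable lebesgue (\<lambda>x. (norm (g x))\<^sup>2)"
  proof (rule Bochner_Integration.integrable_bound)
    show "integrable lebesgue (\<lambda>x. C\<^sup>2 * (norm (f x))\<^sup>2)"
      using f by (simp add: square_integrable_def)
    show "AE x in lebesgue. norm ((norm (g x))\<^sup>2) \<le> norm (C\<^sup>2 * (norm (f x))\<^sup>2)"
      using power_mono[OF le, of _ 2] by (auto simp: power_mult_distrib)
  qed (use g in measurable)
  with g show ?thesis by (simp add: square_integrable_def)
qed

lemma square_integrable_0: "square_integrable (\<lambda>x. 0)"
  by (simp add: square_integrable_def)

lemma square_integrable_scaleR: "square_integrable f \<Longrightarrow> square_integrable (\<lambda>x. c *\<^sub>R f x)"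
  by (rule square_integrable_bound[where C = "\<bar>c\<bar>"]) (auto simp: square_integrable_def)

lemma square_integrable_add:
  assumes "square_integrable f" "square_integrable g"
  shows "square_integrable (\<lambda>x. f x + g x)"
proof -
  have [measurable]: "f \<in> borel_measurable lebesgue" "g \<in> borel_measurable lebesgue"
    using assms by (auto simp: square_integrable_def)
  have "integrable lebesgue (\<lambda>x. (norm (f x + g x))\<^sup>2)"
  proof (rule Bochner_Integration.integrable_bound)
    show "integrable lebesgue (\<lambda>x. 2 * (norm (f x))\<^sup>2 + 2 * (norm (g x))\<^sup>2)"
      using assms by (simp add: square_integrable_def)
    have "(norm (f x + g x))\<^sup>2 \<le> 2 * (norm (f x))\<^sup>2 + 2 * (norm (g x))\<^sup>2" for x
    proof -
      have "(norm (f x + g x))\<^sup>2 \<le> (norm (f x) + norm (g x))\<^sup>2"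
        by (intro power_mono norm_triangle_ineq) auto
      moreover have "0 \<le> (norm (f x) - norm (g x))\<^sup>2" by simp
      ultimately show ?thesis by (simp add: power2_eq_square algebra_simps)
    qed
    then show "AE x in lebesgue. norm ((norm (f x + g x))\<^sup>2) \<le> norm (2 * (norm (f x))\<^sup>2 + 2 * (norm (g x))\<^sup>2)"
      by auto
  qed measurable
  then show ?thesis by (simp add: square_integrable_def)
qed

lemma square_integrable_minus: "square_integrable f \<Longrightarrow> square_integrable (\<lambda>x. - f x)"
  using square_integrable_scaleR[of f "-1"] by simp

lemma square_integrable_diff:
  "square_integrable f \<Longrightarrow> square_integrable g \<Longrightarrow> square_integrable (\<lambda>x. f x - g x)"
  using square_integrable_add[OF _ square_integrable_minus, of f g] by simp

lemma integrable_inner_square_integrable: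
  assumes "square_integrable f" "square_integrable g"
  shows "integrable lebesgue (\<lambda>x. f x \<bullet> g x)"
proof (rule Bochner_Integration.integrable_bound)
  have [measurable]: "f \<in> borel_measurable lebesgue" "g \<in> borel_measurable lebesgue"
    using assms by (auto simp: square_integrable_def)
  show "integrable lebesgue (\<lambda>x. (norm (f x))\<^sup>2 + (norm (g x))\<^sup>2)"
    using assms by (simp add: square_integrable_def)
  have "\<bar>f x \<bullet> g x\<bar> \<le> (norm (f x))\<^sup>2 + (norm (g x))\<^sup>2" for x
  proof -
    have "\<bar>f x \<bullet> g x\<bar> \<le> norm (f x) * norm (g x)" by (rule Cauchy_Schwarz_ineq2)
    moreover have "0 \<le> (norm (f x) - norm (g x))\<^sup>2" by simp
    ultimately show ?thesis
      using zero_le_power2[of "norm (f x)"] zero_le_power2[of "norm (g x)"]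
      unfolding power2_diff by linarith
  qed
  then show "AE x in lebesgue. norm (f x \<bullet> g x) \<le> norm ((norm (f x))\<^sup>2 + (norm (g x))\<^sup>2)"
    by auto
  show "(\<lambda>x. f x \<bullet> g x) \<in> borel_measurable lebesgue" by measurable
qed

text \<open>A partial equivalence: it is reflexive exactly at the square integrable functions, so
  the quotient contains the classes of these and nothing else.\<close>

definition ae_equal :: "('a::euclidean_space \<Rightarrow> 'b::euclidean_space) \<Rightarrow> ('a \<Rightarrow> 'b) \<Rightarrow> bool" where
  "ae_equal f g \<longleftrightarrow> square_integrable f \<and> square_integrable g \<and> (AE x in lebesgue. f x = g x)"

lemma part_equivp_ae_equal: "part_equivp ae_equal"
proof (rule part_equivpI)
  show "\<exists>f. ae_equal f f" unfolding ae_equal_def using square_integrable_0 by auto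
  show "symp ae_equal" unfolding ae_equal_def by (auto intro!: sympI)
  show "transp ae_equal" unfolding ae_equal_def by (auto intro!: transpI)
qed

quotient_type (overloaded) ('a, 'b) l2fun = "'a::euclidean_space \<Rightarrow> 'b::euclidean_space" / partial: ae_equal
  by (rule part_equivp_ae_equal)

lemma rep_l2fun: "square_integrable (rep_l2fun F)" "abs_l2fun (rep_l2fun F) = F"
  using Quotient3_rep_reflp[OF Quotient3_l2fun, of F] Quotient3_abs_rep[OF Quotient3_l2fun, of F]
  by (auto simp: ae_equal_def)

lemma abs_l2fun_eq_iff:
  assumes "square_integrable f" "square_integrable g"
  shows "abs_l2fun f = abs_l2fun g \<longleftrightarrow> (AE x in lebesgue. f x = g x)"
proof -
  have "ae_equal f g \<longleftrightarrow> ae_equal f f \<and> ae_equal g g \<and> abs_l2fun f = abs_l2fun g"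
    using Quotient3_rel[OF Quotient3_l2fun, of f g] by blast
  with assms show ?thesis by (auto simp: ae_equal_def)
qed

lemma rep_abs_l2fun:
  assumes "square_integrable f"
  shows "AE x in lebesgue. rep_l2fun (abs_l2fun f) x = f x"
  using abs_l2fun_eq_iff[OF rep_l2fun(1) assms] rep_l2fun(2) by blast

instantiation l2fun :: (euclidean_space, euclidean_space) real_vector
begin

lift_definition zero_l2fun :: "('a, 'b) l2fun" is "\<lambda>x. 0"
  by (simp add: ae_equal_def square_integrable_0)

lift_definition plus_l2fun :: "('a, 'b) l2fun \<Rightarrow> ('a, 'b) l2fun \<Rightarrow> ('a, 'b) l2fun" is "\<lambda>f g x. f x + g x"
  by (auto simp: ae_equal_def square_integrable_add)

lift_definition uminus_l2fun :: "('a, 'b) l2fun \<Rightarrow> ('a, 'b) l2fun" is "\<lambda>f x. - f x"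
  by (auto simp: ae_equal_def square_integrable_minus)

lift_definition minus_l2fun :: "('a, 'b) l2fun \<Rightarrow> ('a, 'b) l2fun \<Rightarrow> ('a, 'b) l2fun" is "\<lambda>f g x. f x - g x"
  by (auto simp: ae_equal_def square_integrable_diff)

lift_definition scaleR_l2fun :: "real \<Rightarrow> ('a, 'b) l2fun \<Rightarrow> ('a, 'b) l2fun" is "\<lambda>c f x. c *\<^sub>R f x"
  by (auto simp: ae_equal_def square_integrable_scaleR)

instance
  by standard
    (transfer, force simp: ae_equal_def algebra_simps
      intro: square_integrable_add square_integrable_minus square_integrable_diff square_integrable_scaleR square_integrable_0)+

end

instantiation l2fun :: (euclidean_space, euclidean_space) real_inner
begin

lift_definition inner_l2fun :: "('a, 'b) l2fun \<Rightarrow> ('a, 'b) l2fun \<Rightarrow> real"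
  is "\<lambda>f g. LINT x|lebesgue. f x \<bullet> g x"
proof -
  fix f f' g g' :: "'a \<Rightarrow> 'b"
  assume "ae_equal f f'" "ae_equal g g'"
  then have [measurable]: "f \<in> borel_measurable lebesgue" "g \<in> borel_measurable lebesgue"
      "f' \<in> borel_measurable lebesgue" "g' \<in> borel_measurable lebesgue"
    and "AE x in lebesgue. f x \<bullet> g x = f' x \<bullet> g' x"
    by (auto simp: ae_equal_def square_integrable_def)
  then show "(LINT x|lebesgue. f x \<bullet> g x) = (LINT x|lebesgue. f' x \<bullet> g' x)"
    by (intro integral_cong_AE) auto
qed

definition norm_l2fun :: "('a, 'b) l2fun \<Rightarrow> real" where "norm_l2fun F = sqrt (F \<bullet> F)"
definition sgn_l2fun :: "('a, 'b) l2fun \<Rightarrow> ('a, 'b) l2fun" where "sgn_l2fun F = F /\<^sub>R norm F"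
definition dist_l2fun :: "('a, 'b) l2fun \<Rightarrow> ('a, 'b) l2fun \<Rightarrow> real" where "dist_l2fun F G = norm (F - G)"
definition uniformity_l2fun :: "(('a, 'b) l2fun \<times> ('a, 'b) l2fun) filter" where
  "uniformity_l2fun = (INF e\<in>{0<..}. principal {(x, y). dist x y < e})"
definition open_l2fun :: "('a, 'b) l2fun set \<Rightarrow> bool" where
  "open_l2fun U \<longleftrightarrow> (\<forall>x\<in>U. \<forall>\<^sub>F (x', y) in uniformity. x' = x \<longrightarrow> y \<in> U)"

instance
proof
  fix x y z :: "('a, 'b) l2fun" and r :: real and U :: "('a, 'b) l2fun set"
  show "dist x y = norm (x - y)" by (rule dist_l2fun_def)
  show "sgn x = x /\<^sub>R norm x" by (rule sgn_l2fun_def)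
  show "uniformity = (INF e\<in>{0<..}. principal {(x, y). dist x (y :: ('a, 'b) l2fun) < e})"
    by (rule uniformity_l2fun_def)
  show "open U \<longleftrightarrow> (\<forall>x\<in>U. \<forall>\<^sub>F (x', y) in uniformity. x' = x \<longrightarrow> y \<in> U)"
    by (rule open_l2fun_def)
  show "norm x = sqrt (x \<bullet> x)" by (rule norm_l2fun_def)
  show "x \<bullet> y = y \<bullet> x" by transfer (simp add: inner_commute)
  show "(x + y) \<bullet> z = x \<bullet> z + y \<bullet> z"
    by transfer (simp add: ae_equal_def inner_add_left integrable_inner_square_integrable)
  show "(r *\<^sub>R x) \<bullet> y = r * (x \<bullet> y)"
    by transfer simp
  show "0 \<le> x \<bullet> x" by transfer (simp add: integral_nonneg_AE)
  show "x \<bullet> x = 0 \<longleftrightarrow> x = 0"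
  proof transfer
    fix f :: "'a \<Rightarrow> 'b" assume "ae_equal f f"
    then have f: "square_integrable f" by (simp add: ae_equal_def)
    have "(LINT x|lebesgue. f x \<bullet> f x) = 0 \<longleftrightarrow> (AE x in lebesgue. f x \<bullet> f x = 0)"
      by (rule integral_nonneg_eq_0_iff_AE) (auto simp: integrable_inner_square_integrable[OF f f])
    then show "(LINT x|lebesgue. f x \<bullet> f x) = 0 \<longleftrightarrow> ae_equal f (\<lambda>x. 0)"
      by (simp add: ae_equal_def f square_integrable_0)
  qed
qed

end

lemma inner_abs_l2fun:
  assumes "square_integrable f" "square_integrable g"
  shows "abs_l2fun f \<bullet> abs_l2fun g = (LINT x|lebesgue. f x \<bullet> g x)"
  using inner_l2fun.abs_eq[of f g] assms by (simp add: ae_equal_def)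

lemma plus_abs_l2fun:
  "square_integrable f \<Longrightarrow> square_integrable g \<Longrightarrow> abs_l2fun f + abs_l2fun g = abs_l2fun (\<lambda>x. f x + g x)"
  using plus_l2fun.abs_eq[of f g] by (simp add: ae_equal_def)

lemma minus_abs_l2fun:
  "square_integrable f \<Longrightarrow> square_integrable g \<Longrightarrow> abs_l2fun f - abs_l2fun g = abs_l2fun (\<lambda>x. f x - g x)"
  using minus_l2fun.abs_eq[of f g] by (simp add: ae_equal_def)

lemma scaleR_abs_l2fun:
  "square_integrable f \<Longrightarrow> c *\<^sub>R abs_l2fun f = abs_l2fun (\<lambda>x. c *\<^sub>R f x)"
  using scaleR_l2fun.abs_eq[of f c] by (simp add: ae_equal_def)

lemma norm_abs_l2fun:
  assumes "square_integrable f"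
  shows "(norm (abs_l2fun f))\<^sup>2 = (LINT x|lebesgue. (norm (f x))\<^sup>2)"
  using inner_abs_l2fun[OF assms assms] by (simp add: power2_norm_eq_inner)

lemma nn_integral_square_norm:
  assumes "square_integrable f"
  shows "(\<integral>\<^sup>+x. ennreal ((norm (f x))\<^sup>2) \<partial>lebesgue) = ennreal ((norm (abs_l2fun f))\<^sup>2)"
  unfolding norm_abs_l2fun[OF assms]
  by (rule nn_integral_eq_integral) (use assms in \<open>auto simp: square_integrable_def\<close>)

lemma square_integrable_if_nn_integral:
  assumes "f \<in> borel_measurable lebesgue" "(\<integral>\<^sup>+x. ennreal ((norm (f x))\<^sup>2) \<partial>lebesgue) < \<infinity>"
  shows "square_integrable f"
  unfolding square_integrable_def using assms by (auto intro!: integrableI_bounded)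

section \<open>Completeness (Riesz-Fischer)\<close>

lemma Cauchy_fast_subseq:
  fixes X :: "nat \<Rightarrow> 'm::metric_space"
  assumes "Cauchy X" and e: "\<And>n. 0 < e n"
  obtains r where "strict_mono (r :: nat \<Rightarrow> nat)" "\<And>n. dist (X (r (Suc n))) (X (r n)) < e n"
proof -
  have "\<exists>N. \<forall>m\<ge>N. \<forall>k\<ge>N. dist (X m) (X k) < e n" for n
    using metric_CauchyD[OF assms(1) e] by blast
  then obtain N where N: "\<And>n m k. m \<ge> N n \<Longrightarrow> k \<ge> N n \<Longrightarrow> dist (X m) (X k) < e n" by metis
  define r where "r = rec_nat (N 0) (\<lambda>n m. max (Suc m) (N (Suc n)))"
  have rS: "r (Suc n) = max (Suc (r n)) (N (Suc n))" for n by (simp add: r_def)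
  have rN: "N n \<le> r n" for n by (cases n) (auto simp: r_def)
  have "strict_mono r" by (rule strict_monoI_Suc) (simp add: rS)
  moreover have "dist (X (r (Suc n))) (X (r n)) < e n" for n
    by (rule N) (use rN[of n] rS[of n] in auto)
  ultimately show ?thesis by (rule that)
qed

text \<open>Weighting the squares of the increments by \<open>4\<^sup>n\<close> replaces the triangle inequality for infinite
  sums of the usual proof: it makes the increments decay geometrically at almost every point.\<close>

instance l2fun :: (euclidean_space, euclidean_space) complete_space
proof
  fix X :: "nat \<Rightarrow> ('a, 'b) l2fun" assume X: "Cauchy X"
  obtain r where r: "strict_mono (r :: nat \<Rightarrow> nat)"
    and fast: "\<And>n. dist (X (r (Suc n))) (X (r n)) < (1/4) ^ n"
    using Cauchy_fast_subseq[OF X, of "\<lambda>n. (1/4) ^ n"] by auto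
  define f where "f n = rep_l2fun (X (r n))" for n
  have f: "square_integrable (f n)" and absf: "abs_l2fun (f n) = X (r n)" for n
    unfolding f_def by (rule rep_l2fun)+
  have [measurable]: "f n \<in> borel_measurable lebesgue" for n
    using f by (rule square_integrable_measurable)
  have diff: "(\<integral>\<^sup>+x. ennreal ((norm (f m x - f n x))\<^sup>2) \<partial>lebesgue) = ennreal ((dist (X (r m)) (X (r n)))\<^sup>2)" for m n
    using nn_integral_square_norm[OF square_integrable_diff[OF f f], of m n]
    by (simp add: dist_norm minus_abs_l2fun[OF f f, symmetric] absf)
  let ?S = "\<lambda>x. \<Sum>n. ennreal (4 ^ n) * ennreal ((norm (f (Suc n) x - f n x))\<^sup>2)"
  have "(\<integral>\<^sup>+x. ?S x \<partial>lebesgue) = (\<Sum>n. ennreal (4 ^ n) * ennreal ((dist (X (r (Suc n))) (X (r n)))\<^sup>2))"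
    by (simp add: nn_integral_suminf nn_integral_cmult diff)
  also have "\<dots> \<le> (\<Sum>n. ennreal ((1/4) ^ n))"
  proof (rule suminf_le)
    fix n
    have "(dist (X (r (Suc n))) (X (r n)))\<^sup>2 \<le> ((1/4) ^ n)\<^sup>2"
      using fast[of n] by (intro power_mono) auto
    then have "4 ^ n * (dist (X (r (Suc n))) (X (r n)))\<^sup>2 \<le> 4 ^ n * ((1/4) ^ n)\<^sup>2"
      by (intro mult_left_mono) auto
    also have "\<dots> = (1/4) ^ n"
      by (simp add: power2_eq_square power_one_over field_simps)
    finally show "ennreal (4 ^ n) * ennreal ((dist (X (r (Suc n))) (X (r n)))\<^sup>2) \<le> ennreal ((1/4) ^ n)"
      by (simp add: ennreal_mult[symmetric] ennreal_leI)
  qed auto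
  also have "\<dots> < \<infinity>"
    by (subst suminf_ennreal2) (auto simp: summable_geometric)
  finally have "AE x in lebesgue. ?S x \<noteq> \<infinity>"
    by (intro nn_integral_PInf_AE) auto
  moreover have "convergent (\<lambda>n. f n x)" if fin: "?S x \<noteq> \<infinity>" for x
  proof -
    obtain C where C: "?S x = ennreal C" "0 \<le> C" using fin by (cases "?S x") auto
    have "norm (f (Suc n) x - f n x) \<le> sqrt C * (1/2) ^ n" for n
    proof -
      have "(\<Sum>k\<in>{n}. ennreal (4 ^ k) * ennreal ((norm (f (Suc k) x - f k x))\<^sup>2)) \<le> ?S x"
        by (rule sum_le_suminf) auto
      then have "4 ^ n * (norm (f (Suc n) x - f n x))\<^sup>2 \<le> C"
        using C by (simp add: ennreal_mult[symmetric])
      moreover have "((2::real) ^ n)\<^sup>2 = 4 ^ n"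
        by (simp add: power2_eq_square flip: power_mult_distrib)
      ultimately have "(2 ^ n * norm (f (Suc n) x - f n x))\<^sup>2 \<le> C"
        by (simp add: power_mult_distrib)
      then have "2 ^ n * norm (f (Suc n) x - f n x) \<le> sqrt C" by (rule real_le_rsqrt)
      then show ?thesis by (simp add: power_one_over field_simps)
    qed
    note bound = this
    have "summable (\<lambda>n. sqrt C * (1/2) ^ n)"
      by (intro summable_mult summable_geometric) simp
    then have "summable (\<lambda>n. f (Suc n) x - f n x)"
      by (rule summable_comparison_test'[where N = 0]) (rule bound)
    then have "convergent (\<lambda>n. f n x - f 0 x)"
      unfolding summable_iff_convergent using sum_lessThan_telescope[of "\<lambda>n. f n x"] by simp
    from convergent_add[OF this convergent_const[of "f 0 x"]] show ?thesis by simp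
  qed
  ultimately have conv: "AE x in lebesgue. convergent (\<lambda>n. f n x)" by (auto elim: eventually_mono)
  define h where "h x = lim (\<lambda>n. f n x)" for x
  have [measurable]: "h \<in> borel_measurable lebesgue"
    unfolding h_def by (rule borel_measurable_lim_metric) measurable
  \<comment> \<open>Fatou's lemma: the distance of \<open>f n\<close> from the pointwise limit is at
    most the lower limit of its distances from later members of the subsequence.\<close>
  have close: "\<exists>N. \<forall>n\<ge>N. (\<integral>\<^sup>+x. ennreal ((norm (h x - f n x))\<^sup>2) \<partial>lebesgue) \<le> ennreal (e\<^sup>2)" if e: "0 < e" for e
  proof -
    obtain N where N: "\<And>m n. m \<ge> N \<Longrightarrow> n \<ge> N \<Longrightarrow> dist (X m) (X n) < e"
      using metric_CauchyD[OF X e] by blast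
    have "(\<integral>\<^sup>+x. ennreal ((norm (h x - f n x))\<^sup>2) \<partial>lebesgue) \<le> ennreal (e\<^sup>2)" if n: "n \<ge> N" for n
    proof -
      have "(\<integral>\<^sup>+x. ennreal ((norm (h x - f n x))\<^sup>2) \<partial>lebesgue) =
          (\<integral>\<^sup>+x. liminf (\<lambda>m. ennreal ((norm (f m x - f n x))\<^sup>2)) \<partial>lebesgue)"
      proof (rule nn_integral_cong_AE)
        show "AE x in lebesgue. ennreal ((norm (h x - f n x))\<^sup>2) = liminf (\<lambda>m. ennreal ((norm (f m x - f n x))\<^sup>2))"
          using conv
        proof eventually_elim
          case (elim x)
          then have "(\<lambda>m. f m x) \<longlonglongrightarrow> h x" unfolding h_def by (simp add: convergent_LIMSEQ_iff)
          then have "(\<lambda>m. ennreal ((norm (f m x - f n x))\<^sup>2)) \<longlonglongrightarrow> ennreal ((norm (h x - f n x))\<^sup>2)"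
            by (intro tendsto_intros)
          from lim_imp_Liminf[OF sequentially_bot this] show ?case by (rule sym)
        qed
      qed
      also have "\<dots> \<le> liminf (\<lambda>m. \<integral>\<^sup>+x. ennreal ((norm (f m x - f n x))\<^sup>2) \<partial>lebesgue)"
        by (rule nn_integral_liminf) measurable
      also have "\<dots> \<le> liminf (\<lambda>m. ennreal (e\<^sup>2))"
      proof (rule Liminf_mono)
        have "ennreal ((dist (X (r m)) (X (r n)))\<^sup>2) \<le> ennreal (e\<^sup>2)" if "m \<ge> N" for m
        proof -
          have "r m \<ge> N" "r n \<ge> N"
            using seq_suble[OF r, of m] seq_suble[OF r, of n] n that by linarith+
          then show ?thesis by (intro ennreal_leI power_mono less_imp_le[OF N]) auto
        qed
        then show "\<forall>\<^sub>F m in sequentially. (\<integral>\<^sup>+x. ennreal ((norm (f m x - f n x))\<^sup>2) \<partial>lebesgue) \<le> ennreal (e\<^sup>2)"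
          unfolding diff eventually_sequentially by blast
      qed
      also have "\<dots> = ennreal (e\<^sup>2)" by (simp add: Liminf_const)
      finally show ?thesis .
    qed
    then show ?thesis by blast
  qed
  obtain N where "(\<integral>\<^sup>+x. ennreal ((norm (h x - f N x))\<^sup>2) \<partial>lebesgue) \<le> ennreal (1\<^sup>2)"
    using close[of 1] by auto
  then have "square_integrable (\<lambda>x. h x - f N x)"
    by (intro square_integrable_if_nn_integral) (auto intro: le_less_trans)
  from square_integrable_add[OF this f[of N]] have h: "square_integrable h" by simp
  have "(\<lambda>n. X (r n)) \<longlonglongrightarrow> abs_l2fun h"
  proof (rule metric_LIMSEQ_I)
    fix e :: real assume e: "0 < e"
    then obtain N where N: "\<And>n. n \<ge> N \<Longrightarrow> (\<integral>\<^sup>+x. ennreal ((norm (h x - f n x))\<^sup>2) \<partial>lebesgue) \<le> ennreal ((e/2)\<^sup>2)"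
      using close[of "e/2"] by auto
    have "dist (X (r n)) (abs_l2fun h) < e" if "n \<ge> N" for n
    proof -
      have "ennreal ((dist (abs_l2fun h) (X (r n)))\<^sup>2) \<le> ennreal ((e/2)\<^sup>2)"
        using N[OF that] nn_integral_square_norm[OF square_integrable_diff[OF h f], of n]
        by (simp add: dist_norm minus_abs_l2fun[OF h f, symmetric] absf)
      then have "(dist (abs_l2fun h) (X (r n)))\<^sup>2 \<le> (e/2)\<^sup>2"
        using ennreal_le_iff[OF zero_le_power2] by blast
      then have "dist (abs_l2fun h) (X (r n)) \<le> e/2"
        by (rule power2_le_imp_le) (use e in simp)
      then show ?thesis using e by (simp add: dist_commute)
    qed
    then show "\<exists>no. \<forall>n\<ge>no. dist (X (r n)) (abs_l2fun h) < e" by blast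
  qed
  then show "convergent X"
    using Cauchy_converges_subseq[OF X r] by (auto simp: comp_def intro: convergentI)
qed

subsection \<open>Pointwise multipliers\<close>

text \<open>Extension by zero embeds the square integrable functions on \<Omega> isometrically into
  those on the whole space, so that one Hilbert space serves every \<Omega>.\<close>

definition l2_of :: "'a::euclidean_space set \<Rightarrow> ('a \<Rightarrow> 'b::euclidean_space) \<Rightarrow> ('a, 'b) l2fun" where
  "l2_of \<Omega> f = abs_l2fun (\<lambda>x. indicator \<Omega> x *\<^sub>R f x)"

lemma L2_iff_square_integrable:
  fixes f :: "'a::euclidean_space \<Rightarrow> 'b::euclidean_space"
  assumes "\<Omega> \<in> sets lebesgue"
  shows "f \<in> L2 \<Omega> \<longleftrightarrow> square_integrable (\<lambda>x. indicator \<Omega> x *\<^sub>R f x)"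
proof -
  have "(norm (indicator \<Omega> x *\<^sub>R f x))\<^sup>2 = indicator \<Omega> x *\<^sub>R (norm (f x))\<^sup>2" for x
    by (simp add: indicator_def)
  then show ?thesis
    unfolding L2_def square_integrable_def
    using assms by (simp add: borel_measurable_restrict_space_iff integrable_restrict_space)
qed

lemma integral_lebesgue_on:
  fixes f :: "'a::euclidean_space \<Rightarrow> real"
  assumes "\<Omega> \<in> sets lebesgue"
  shows "(LINT x|lebesgue_on \<Omega>. f x) = (LINT x|lebesgue. indicator \<Omega> x * f x)"
  using integral_restrict_space[of \<Omega> lebesgue f] assms by simp

lemma inner_l2_of:
  assumes "\<Omega> \<in> sets lebesgue" "f \<in> L2 \<Omega>" "g \<in> L2 \<Omega>"
  shows "l2_of \<Omega> f \<bullet> l2_of \<Omega> g = (LINT x|lebesgue_on \<Omega>. f x \<bullet> g x)"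
  using assms unfolding l2_of_def integral_lebesgue_on[OF assms(1)]
  by (subst inner_abs_l2fun)
    (auto simp: L2_iff_square_integrable indicator_def intro!: Bochner_Integration.integral_cong)

lemma norm_l2_of:
  assumes "\<Omega> \<in> sets lebesgue" "f \<in> L2 \<Omega>"
  shows "(norm (l2_of \<Omega> f))\<^sup>2 = (LINT x|lebesgue_on \<Omega>. (norm (f x))\<^sup>2)"
  using inner_l2_of[OF assms assms(2)] by (simp add: power2_norm_eq_inner)

lemma l2_of_eq_iff:
  assumes "\<Omega> \<in> sets lebesgue" "f \<in> L2 \<Omega>" "g \<in> L2 \<Omega>"
  shows "l2_of \<Omega> f = l2_of \<Omega> g \<longleftrightarrow> (AE x in lebesgue_on \<Omega>. f x = g x)"
proof -
  have "l2_of \<Omega> f = l2_of \<Omega> g \<longleftrightarrow> (AE x in lebesgue. indicator \<Omega> x *\<^sub>R f x = indicator \<Omega> x *\<^sub>R g x)"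
    unfolding l2_of_def using assms by (intro abs_l2fun_eq_iff) (auto simp: L2_iff_square_integrable)
  also have "\<dots> \<longleftrightarrow> (AE x in lebesgue_on \<Omega>. f x = g x)"
    using assms(1) by (subst AE_restrict_space_iff) (auto simp: indicator_def elim!: eventually_mono)
  finally show ?thesis .
qed

lemma
  assumes "\<Omega> \<in> sets lebesgue" "f \<in> L2 \<Omega>" "g \<in> L2 \<Omega>"
  shows L2_add: "(\<lambda>x. f x + g x) \<in> L2 \<Omega>"
    and l2_of_add: "l2_of \<Omega> (\<lambda>x. f x + g x) = l2_of \<Omega> f + l2_of \<Omega> g"
    and L2_diff: "(\<lambda>x. f x - g x) \<in> L2 \<Omega>"
    and l2_of_diff: "l2_of \<Omega> (\<lambda>x. f x - g x) = l2_of \<Omega> f - l2_of \<Omega> g"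
  using assms unfolding l2_of_def
  by (simp_all add: L2_iff_square_integrable scaleR_add_right scaleR_diff_right square_integrable_add
      square_integrable_diff plus_abs_l2fun minus_abs_l2fun)

lemma
  assumes "\<Omega> \<in> sets lebesgue" "f \<in> L2 \<Omega>"
  shows L2_scaleR: "(\<lambda>x. c *\<^sub>R f x) \<in> L2 \<Omega>"
    and l2_of_scaleR: "l2_of \<Omega> (\<lambda>x. c *\<^sub>R f x) = c *\<^sub>R l2_of \<Omega> f"
  using assms square_integrable_scaleR[of "\<lambda>x. indicator \<Omega> x *\<^sub>R f x" c] unfolding l2_of_def
  by (simp_all add: L2_iff_square_integrable scaleR_abs_l2fun mult.commute)

lemma L2_0: "\<Omega> \<in> sets lebesgue \<Longrightarrow> (\<lambda>x. 0) \<in> L2 \<Omega>"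
  by (simp add: L2_iff_square_integrable square_integrable_0)

lemma l2_of_0: "l2_of \<Omega> (\<lambda>x. 0) = 0"
  by (simp add: l2_of_def zero_l2fun_def)

lemma
  assumes "\<Omega> \<in> sets lebesgue" "finite I" "\<And>i. i \<in> I \<Longrightarrow> f i \<in> L2 \<Omega>"
  shows L2_sum: "(\<lambda>x. \<Sum>i\<in>I. c i *\<^sub>R f i x) \<in> L2 \<Omega>"
    and l2_of_sum: "l2_of \<Omega> (\<lambda>x. \<Sum>i\<in>I. c i *\<^sub>R f i x) = (\<Sum>i\<in>I. c i *\<^sub>R l2_of \<Omega> (f i))"
proof -
  have "(\<lambda>x. \<Sum>i\<in>I. c i *\<^sub>R f i x) \<in> L2 \<Omega> \<and>
      l2_of \<Omega> (\<lambda>x. \<Sum>i\<in>I. c i *\<^sub>R f i x) = (\<Sum>i\<in>I. c i *\<^sub>R l2_of \<Omega> (f i))"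
    using assms(2,3)
  proof (induction I rule: finite_induct)
    case empty
    then show ?case using assms(1) by (simp add: L2_0 l2_of_0)
  next
    case (insert i I)
    then show ?case using assms(1) by (simp add: L2_add l2_of_add L2_scaleR l2_of_scaleR)
  qed
  then show "(\<lambda>x. \<Sum>i\<in>I. c i *\<^sub>R f i x) \<in> L2 \<Omega>"
    and "l2_of \<Omega> (\<lambda>x. \<Sum>i\<in>I. c i *\<^sub>R f i x) = (\<Sum>i\<in>I. c i *\<^sub>R l2_of \<Omega> (f i))"
    by blast+
qed

section \<open>Bounded multiplication operators\<close>

definition pointwise_op ::
    "('a \<Rightarrow> 'b \<Rightarrow> 'c) \<Rightarrow> ('a::euclidean_space, 'b::euclidean_space) l2fun \<Rightarrow> ('a, 'c::euclidean_space) l2fun" where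
  "pointwise_op T F = abs_l2fun (\<lambda>x. T x (rep_l2fun F x))"

text \<open>Linear maps of the values, one for each point, with a common bound. The coordinate
  multiplication, \<open>J\<close>, \<open>D\<close> and the restriction to \<Omega> are all of this
  kind and share the proofs of boundedness; adjoints can be read off pointwise.\<close>

definition bounded_multiplier :: "('a::euclidean_space \<Rightarrow> 'b::euclidean_space \<Rightarrow> 'c::euclidean_space) \<Rightarrow> bool" where
  "bounded_multiplier T \<longleftrightarrow> (\<forall>x. linear (T x)) \<and> (\<exists>C. \<forall>x v. norm (T x v) \<le> C * norm v) \<and>
     (\<forall>f\<in>borel_measurable lebesgue. (\<lambda>x. T x (f x)) \<in> borel_measurable lebesgue)"

lemma square_integrable_multiplier:
  assumes "bounded_multiplier T" "square_integrable f"
  shows "square_integrable (\<lambda>x. T x (f x))"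
proof -
  obtain C where "\<And>x v. norm (T x v) \<le> C * norm v" using assms(1) unfolding bounded_multiplier_def by blast
  then show ?thesis
    using assms by (intro square_integrable_bound[OF assms(2), of _ C])
      (auto simp: bounded_multiplier_def square_integrable_def)
qed

lemma pointwise_op_abs:
  assumes "bounded_multiplier T" "square_integrable f"
  shows "pointwise_op T (abs_l2fun f) = abs_l2fun (\<lambda>x. T x (f x))"
  unfolding pointwise_op_def
  by (subst abs_l2fun_eq_iff)
    (use rep_abs_l2fun[OF assms(2)] in \<open>auto intro: square_integrable_multiplier assms rep_l2fun\<close>)

lemma l2fun_cases:
  obtains f where "F = abs_l2fun f" "square_integrable f"
  using rep_l2fun by metis

lemma bounded_linear_pointwise_op:
  assumes "bounded_multiplier T"
  shows "bounded_linear (pointwise_op T)"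
proof -
  obtain C where C: "\<And>x v. norm (T x v) \<le> C * norm v"
    using assms unfolding bounded_multiplier_def by blast
  have lin: "linear (T x)" for x using assms by (simp add: bounded_multiplier_def)
  note sq = square_integrable_multiplier[OF assms]
  show ?thesis
  proof (rule bounded_linear_intro)
    fix F G :: "('a, 'b) l2fun" and r
    obtain f where f: "F = abs_l2fun f" "square_integrable f" by (rule l2fun_cases)
    obtain g where g: "G = abs_l2fun g" "square_integrable g" by (rule l2fun_cases)
    show "pointwise_op T (F + G) = pointwise_op T F + pointwise_op T G"
      by (simp add: f g plus_abs_l2fun pointwise_op_abs[OF assms] square_integrable_add sq linear_add[OF lin])
    show "pointwise_op T (r *\<^sub>R F) = r *\<^sub>R pointwise_op T F"
      by (simp add: f scaleR_abs_l2fun pointwise_op_abs[OF assms] square_integrable_scaleR sq linear_scale[OF lin])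
    have "(norm (pointwise_op T F))\<^sup>2 = (LINT x|lebesgue. (norm (T x (f x)))\<^sup>2)"
      by (simp add: f pointwise_op_abs[OF assms] norm_abs_l2fun sq)
    also have "\<dots> \<le> (LINT x|lebesgue. C\<^sup>2 * (norm (f x))\<^sup>2)"
    proof (rule integral_mono)
      show "integrable lebesgue (\<lambda>x. (norm (T x (f x)))\<^sup>2)"
        using sq[OF f(2)] by (simp add: square_integrable_def)
      show "integrable lebesgue (\<lambda>x. C\<^sup>2 * (norm (f x))\<^sup>2)"
        using f(2) by (simp add: square_integrable_def)
      show "(norm (T x (f x)))\<^sup>2 \<le> C\<^sup>2 * (norm (f x))\<^sup>2" for x
        using power_mono[OF C norm_ge_zero, where n = 2] by (simp add: power_mult_distrib)
    qed
    also have "\<dots> = (norm F * \<bar>C\<bar>)\<^sup>2"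
      using f by (simp add: norm_abs_l2fun power_mult_distrib)
    finally show "norm (pointwise_op T F) \<le> norm F * \<bar>C\<bar>"
      by (rule power2_le_imp_le) simp
  qed
qed

lemma inner_pointwise_op:
  assumes T: "bounded_multiplier T" and S: "bounded_multiplier S"
    and adj: "\<And>x v w. T x v \<bullet> w = v \<bullet> S x w"
  shows "pointwise_op T F \<bullet> G = F \<bullet> pointwise_op S G"
proof -
  obtain f where f: "F = abs_l2fun f" "square_integrable f" by (rule l2fun_cases)
  obtain g where g: "G = abs_l2fun g" "square_integrable g" by (rule l2fun_cases)
  show ?thesis
    by (simp add: f g pointwise_op_abs[OF T] pointwise_op_abs[OF S] square_integrable_multiplier[OF T]
        square_integrable_multiplier[OF S] inner_abs_l2fun adj)
qed

lemma pointwise_op_l2_of: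
  assumes T: "bounded_multiplier T" and \<Omega>: "\<Omega> \<in> sets lebesgue" and f: "f \<in> L2 \<Omega>"
  shows "pointwise_op T (l2_of \<Omega> f) = l2_of \<Omega> (\<lambda>x. T x (f x))"
proof -
  have "T x (indicator \<Omega> x *\<^sub>R f x) = indicator \<Omega> x *\<^sub>R T x (f x)" for x
    using T by (simp add: bounded_multiplier_def linear_scale)
  then show ?thesis
    unfolding l2_of_def using pointwise_op_abs[OF T, of "\<lambda>x. indicator \<Omega> x *\<^sub>R f x"] f \<Omega>
    by (simp add: L2_iff_square_integrable)
qed

text \<open>A coordinate is unbounded on the whole space. Cut off to a bounded \<Omega> it gives a
  bounded operator, which acts as the coordinate itself on functions extended by zero.\<close>

definition coord_multiplier :: "'a::euclidean_space set \<Rightarrow> 'a \<Rightarrow> 'a \<Rightarrow> 'b::euclidean_space \<Rightarrow> 'b" where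
  "coord_multiplier \<Omega> i x v = (indicator \<Omega> x * (x \<bullet> i)) *\<^sub>R v"

lemma bounded_multiplier_coord:
  fixes \<Omega> :: "'a::euclidean_space set"
  assumes "bounded \<Omega>" "\<Omega> \<in> sets lebesgue"
  shows "bounded_multiplier (coord_multiplier \<Omega> i :: 'a \<Rightarrow> 'b::euclidean_space \<Rightarrow> 'b)"
proof -
  obtain B where B: "\<And>x. x \<in> \<Omega> \<Longrightarrow> norm x \<le> B" using assms(1) bounded_iff by blast
  have "\<bar>indicator \<Omega> x * (x \<bullet> i)\<bar> \<le> \<bar>B\<bar> * norm i" for x
  proof (cases "x \<in> \<Omega>")
    case True
    have "\<bar>x \<bullet> i\<bar> \<le> norm x * norm i" by (rule Cauchy_Schwarz_ineq2)
    also have "\<dots> \<le> \<bar>B\<bar> * norm i" by (rule mult_right_mono) (use B[OF True] in auto)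
    finally show ?thesis using True by simp
  qed simp
  then have "norm (coord_multiplier \<Omega> i x v) \<le> (\<bar>B\<bar> * norm i) * norm v" for x and v :: 'b
    unfolding coord_multiplier_def norm_scaleR by (intro mult_right_mono) auto
  moreover have "linear (coord_multiplier \<Omega> i x :: 'b \<Rightarrow> 'b)" for x
    unfolding coord_multiplier_def by (intro linearI) (auto simp: scaleR_add_right)
  moreover have "(\<lambda>x. coord_multiplier \<Omega> i x (f x)) \<in> borel_measurable lebesgue"
    if f: "f \<in> borel_measurable lebesgue" for f :: "'a \<Rightarrow> 'b"
  proof -
    have [measurable]: "\<Omega> \<in> sets lebesgue" "f \<in> borel_measurable lebesgue" by fact+
    have "(\<lambda>x::'a. x \<bullet> i) \<in> borel_measurable lebesgue" by (intro measurable_completion) measurable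
    then show ?thesis unfolding coord_multiplier_def by measurable
  qed
  ultimately show ?thesis unfolding bounded_multiplier_def by blast
qed

lemma bounded_multiplier_scaleR_vector: "bounded_multiplier (\<lambda>x c. c *\<^sub>R (i :: 'b::euclidean_space))"
  unfolding bounded_multiplier_def
  by (auto intro!: linearI exI[of _ "norm i"] simp: scaleR_add_left mult.commute)

lemma bounded_multiplier_inner_vector: "bounded_multiplier (\<lambda>x v. v \<bullet> (i :: 'b::euclidean_space))"
  unfolding bounded_multiplier_def
  by (auto intro!: linearI exI[of _ "norm i"] simp: inner_add_left Cauchy_Schwarz_ineq2 mult.commute
      intro: order_trans[OF Cauchy_Schwarz_ineq2])

subsection \<open>Test functions\<close>

lemma GDERIV_unique:
  assumes "GDERIV f x :> D" "GDERIV f x :> D'"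
  shows "D = D'"
proof (rule vector_eq_rdot[THEN iffD1], rule allI)
  have "(\<lambda>h. h \<bullet> D) = (\<lambda>h. h \<bullet> D')"
    using assms unfolding gderiv_def by (rule has_derivative_unique)
  then show "D \<bullet> h = D' \<bullet> h" for h by (metis inner_commute)
qed

lemma gradient_eqI: "GDERIV f x :> D \<Longrightarrow> gradient f x = D"
  unfolding gradient_def using GDERIV_unique by blast

lemma GDERIV_gradient:
  fixes f :: "'a::euclidean_space \<Rightarrow> real"
  assumes "f differentiable at x"
  shows "GDERIV f x :> gradient f x"
proof -
  obtain f' where f': "(f has_derivative f') (at x)" using assms unfolding differentiable_def by blast
  interpret f': linear f' using f' by (rule has_derivative_linear)
  have "f' h = h \<bullet> (\<Sum>i\<in>Basis. f' i *\<^sub>R i)" for h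
  proof -
    have "f' h = f' (\<Sum>i\<in>Basis. (h \<bullet> i) *\<^sub>R i)" by (simp add: euclidean_representation)
    also have "\<dots> = h \<bullet> (\<Sum>i\<in>Basis. f' i *\<^sub>R i)"
      by (simp add: f'.sum f'.scale inner_sum_right mult.commute)
    finally show ?thesis .
  qed
  then have "f' = (\<lambda>h. h \<bullet> (\<Sum>i\<in>Basis. f' i *\<^sub>R i))" by (rule ext)
  with f' have "GDERIV f x :> (\<Sum>i\<in>Basis. f' i *\<^sub>R i)" unfolding gderiv_def by metis
  with gradient_eqI[OF this] show ?thesis by simp
qed

lemma GDERIV_differentiable: "GDERIV f x :> D \<Longrightarrow> f differentiable at x"
  unfolding gderiv_def differentiable_def by blast

text \<open>Integration by parts and the translation estimates rest on one continuous derivative,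
  and test functions enter them in this weaker form. The compact set is a parameter because products
  keep it and the cell estimate counts the cells that meet it.\<close>

definition compactly_supported_C1 :: "'a::euclidean_space set \<Rightarrow> ('a \<Rightarrow> real) \<Rightarrow> bool" where
  "compactly_supported_C1 K f \<longleftrightarrow> compact K \<and> (\<forall>x. f differentiable at x) \<and>
     continuous_on UNIV (gradient f) \<and> (\<forall>x. x \<notin> K \<longrightarrow> f x = 0)"

lemma compactly_supported_C1D:
  assumes "compactly_supported_C1 K f"
  shows "compact K" "\<And>x. x \<notin> K \<Longrightarrow> f x = 0" "continuous_on UNIV (gradient f)"
  using assms unfolding compactly_supported_C1_def by blast+

lemma compactly_supported_C1_GDERIV:
  "compactly_supported_C1 K f \<Longrightarrow> GDERIV f x :> gradient f x"
  by (simp add: compactly_supported_C1_def GDERIV_gradient)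

lemma compactly_supported_C1_continuous:
  "compactly_supported_C1 K f \<Longrightarrow> continuous_on UNIV f"
  unfolding compactly_supported_C1_def
  by (intro continuous_at_imp_continuous_on) (auto intro: differentiable_imp_continuous_within)

lemma compactly_supported_C1_gradient_0:
  fixes f :: "'a::euclidean_space \<Rightarrow> real"
  assumes f: "compactly_supported_C1 K f" and "x \<notin> K"
  shows "gradient f x = 0"
proof (rule gradient_eqI)
  have "open (- K)" using f by (simp add: compactly_supported_C1_def compact_imp_closed open_Compl)
  moreover have "((\<lambda>x. 0) has_derivative (\<lambda>h. h \<bullet> 0)) (at x)" by simp
  ultimately show "GDERIV f x :> 0"
    unfolding gderiv_def
    by (intro has_derivative_transform_within_open[of "\<lambda>x. 0" _ x UNIV "- K" f])
      (use f assms(2) in \<open>auto simp: compactly_supported_C1_def\<close>)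
qed

lemma compactly_supported_C1_mult:
  assumes f: "compactly_supported_C1 K f" and g: "compactly_supported_C1 L g"
  shows "compactly_supported_C1 K (\<lambda>x. f x * g x)"
    and "gradient (\<lambda>x. f x * g x) x = f x *\<^sub>R gradient g x + g x *\<^sub>R gradient f x"
proof -
  note D = GDERIV_mult[OF compactly_supported_C1_GDERIV[OF f] compactly_supported_C1_GDERIV[OF g]]
  show "gradient (\<lambda>x. f x * g x) x = f x *\<^sub>R gradient g x + g x *\<^sub>R gradient f x"
    by (rule gradient_eqI[OF D])
  have "gradient (\<lambda>x. f x * g x) = (\<lambda>x. f x *\<^sub>R gradient g x + g x *\<^sub>R gradient f x)"
    by (rule ext, rule gradient_eqI[OF D])
  moreover have "continuous_on UNIV (\<lambda>x. f x *\<^sub>R gradient g x + g x *\<^sub>R gradient f x)"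
    using f g by (intro continuous_intros compactly_supported_C1_continuous[OF f]
        compactly_supported_C1_continuous[OF g]) (auto simp: compactly_supported_C1_def)
  ultimately show "compactly_supported_C1 K (\<lambda>x. f x * g x)"
    using f GDERIV_differentiable[OF D] by (auto simp: compactly_supported_C1_def)
qed

section \<open>Smoothness and test functions under sums, multiples and coordinates\<close>

lemma C_class_Suc_imp: "C_class (Suc m) f \<Longrightarrow> C_class m f"
proof (induction m arbitrary: f)
  case 0
  then show ?case by (auto intro!: continuous_at_imp_continuous_on differentiable_imp_continuous_within)
next
  case (Suc m)
  then show ?case by simp
qed

lemma C_class_const: "C_class m (\<lambda>x::'a::euclidean_space. c)"
proof (induction m arbitrary: c)
  case (Suc m)
  have "gradient (\<lambda>x::'a. c) = (\<lambda>x. 0)" by (rule ext, rule gradient_eqI, rule GDERIV_const)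
  with Suc show ?case by simp
qed simp

lemma C_class_add: "C_class m f \<Longrightarrow> C_class m g \<Longrightarrow> C_class m (\<lambda>x. f x + g x)"
proof (induction m arbitrary: f g)
  case (Suc m)
  then have "gradient (\<lambda>x. f x + g x) = (\<lambda>x. gradient f x + gradient g x)"
    by (intro ext gradient_eqI GDERIV_add GDERIV_gradient) auto
  with Suc show ?case by (simp add: inner_add_left)
qed (auto intro: continuous_intros)

lemma GDERIV_coordinate: "GDERIV (\<lambda>x. x \<bullet> i) x :> i"
  unfolding gderiv_def by (auto intro!: derivative_eq_intros)

lemma C_class_mult_const: "C_class m f \<Longrightarrow> C_class m (\<lambda>x. c * f x)"
proof (induction m arbitrary: f)
  case (Suc m)
  have "gradient (\<lambda>x. c * f x) = (\<lambda>x. c *\<^sub>R gradient f x)"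
  proof (rule ext, rule gradient_eqI)
    show "GDERIV (\<lambda>x. c * f x) x :> c *\<^sub>R gradient f x" for x
      using GDERIV_mult[OF GDERIV_const GDERIV_gradient, of f x c] Suc.prems by simp
  qed
  with Suc show ?case by (simp add: differentiable_mult)
qed (auto intro: continuous_intros)

text \<open>The induction closes because a coordinate has constant derivative: the product rule
  returns a term of the same shape plus a multiple of \<open>f\<close>, and \<open>f\<close> has one
  derivative more than is required there.\<close>

lemma C_class_mult_coordinate:
  assumes i: "i \<in> Basis"
  shows "C_class m f \<Longrightarrow> C_class m (\<lambda>x. (x \<bullet> i) * f x)"
proof (induction m arbitrary: f)
  case (Suc m)
  have D: "GDERIV (\<lambda>x. (x \<bullet> i) * f x) x :> (x \<bullet> i) *\<^sub>R gradient f x + f x *\<^sub>R i" for x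
    using GDERIV_mult[OF GDERIV_coordinate GDERIV_gradient, of f x i] Suc.prems by simp
  have "gradient (\<lambda>x. (x \<bullet> i) * f x) = (\<lambda>x. (x \<bullet> i) *\<^sub>R gradient f x + f x *\<^sub>R i)"
    by (rule ext, rule gradient_eqI[OF D])
  moreover have "C_class m (\<lambda>x. ((x \<bullet> i) *\<^sub>R gradient f x + f x *\<^sub>R i) \<bullet> j)" if "j \<in> Basis" for j
  proof -
    have "C_class m (\<lambda>x. (x \<bullet> i) * (gradient f x \<bullet> j) + (i \<bullet> j) * f x)"
      by (intro C_class_add C_class_mult_const Suc.IH) (use Suc.prems that C_class_Suc_imp in auto)
    then show ?thesis by (simp add: inner_add_left mult.commute)
  qed
  ultimately show ?case unfolding C_class.simps by (metis GDERIV_differentiable[OF D])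
next
  case 0
  then have "continuous_on UNIV f" by simp
  then have "continuous_on UNIV (\<lambda>x. (x \<bullet> i) * f x)" by (intro continuous_intros)
  then show ?case by simp
qed

lemma test_function_C1:
  assumes "test_function \<Omega> \<phi>"
  shows "compactly_supported_C1 (closure {x. \<phi> x \<noteq> 0}) \<phi>"
proof -
  have C: "C_class (Suc (Suc 0)) \<phi>" using assms by (simp only: test_function_def)
  then have "continuous_on UNIV (\<lambda>x. gradient \<phi> x \<bullet> i)" if "i \<in> Basis" for i
    using that by (auto intro!: continuous_at_imp_continuous_on differentiable_imp_continuous_within)
  then have "continuous_on UNIV (gradient \<phi>)" by (simp add: continuous_on_componentwise[of UNIV "gradient \<phi>"])
  moreover have "\<phi> x = 0" if "x \<notin> closure {x. \<phi> x \<noteq> 0}" for x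
    using that closure_subset[of "{x. \<phi> x \<noteq> 0}"] by blast
  moreover have "\<phi> differentiable at x" for x using C by simp
  moreover have "compact (closure {x. \<phi> x \<noteq> 0})" using assms unfolding test_function_def by blast
  ultimately show ?thesis unfolding compactly_supported_C1_def by blast
qed

lemma test_function_gradient:
  "test_function \<Omega> \<phi> \<Longrightarrow> GDERIV \<phi> x :> gradient \<phi> x"
  by (rule compactly_supported_C1_GDERIV[OF test_function_C1])

lemma test_functionI:
  assumes "\<And>m. C_class m \<psi>" "{x. \<psi> x \<noteq> 0} \<subseteq> K" "compact K" "K \<subseteq> \<Omega>"
  shows "test_function \<Omega> \<psi>"
proof -
  have "closure {x. \<psi> x \<noteq> 0} \<subseteq> K"
    using assms by (intro closure_minimal) (auto intro: compact_imp_closed)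
  moreover from this have "compact (closure {x. \<psi> x \<noteq> 0})"
    by (metis assms(3) closed_closure compact_Int_closed inf.absorb_iff2)
  ultimately show ?thesis using assms by (auto simp: test_function_def)
qed

lemma test_function_zero: "test_function \<Omega> (\<lambda>x. 0)"
  by (rule test_functionI[of _ "{}"]) (auto simp: C_class_const)

lemma test_function_support:
  assumes "test_function \<Omega> \<phi>"
  shows "{x. \<phi> x \<noteq> 0} \<subseteq> closure {x. \<phi> x \<noteq> 0}" "compact (closure {x. \<phi> x \<noteq> 0})"
    "closure {x. \<phi> x \<noteq> 0} \<subseteq> \<Omega>" "C_class m \<phi>"
  using assms by (simp_all only: test_function_def closure_subset)

lemma test_function_add:
  assumes "test_function \<Omega> \<phi>" "test_function \<Omega> \<psi>"
  shows "test_function \<Omega> (\<lambda>x. \<phi> x + \<psi> x)"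
    and "gradient (\<lambda>x. \<phi> x + \<psi> x) = (\<lambda>x. gradient \<phi> x + gradient \<psi> x)"
proof -
  note \<phi> = test_function_support[OF assms(1)] and \<psi> = test_function_support[OF assms(2)]
  show "test_function \<Omega> (\<lambda>x. \<phi> x + \<psi> x)"
  proof (rule test_functionI)
    have "{x. \<phi> x + \<psi> x \<noteq> 0} \<subseteq> {x. \<phi> x \<noteq> 0} \<union> {x. \<psi> x \<noteq> 0}" by auto
    then show "{x. \<phi> x + \<psi> x \<noteq> 0} \<subseteq> closure {x. \<phi> x \<noteq> 0} \<union> closure {x. \<psi> x \<noteq> 0}"
      using \<phi>(1) \<psi>(1) by blast
    show "compact (closure {x. \<phi> x \<noteq> 0} \<union> closure {x. \<psi> x \<noteq> 0})"
      by (intro compact_Un \<phi> \<psi>)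
    show "closure {x. \<phi> x \<noteq> 0} \<union> closure {x. \<psi> x \<noteq> 0} \<subseteq> \<Omega>" using \<phi>(3) \<psi>(3) by blast
    show "C_class m (\<lambda>x. \<phi> x + \<psi> x)" for m by (intro C_class_add \<phi> \<psi>)
  qed
  show "gradient (\<lambda>x. \<phi> x + \<psi> x) = (\<lambda>x. gradient \<phi> x + gradient \<psi> x)"
    by (intro ext gradient_eqI GDERIV_add test_function_gradient[OF assms(1)] test_function_gradient[OF assms(2)])
qed

lemma test_function_scale:
  assumes "test_function \<Omega> \<phi>"
  shows "test_function \<Omega> (\<lambda>x. c * \<phi> x)"
    and "gradient (\<lambda>x. c * \<phi> x) = (\<lambda>x. c *\<^sub>R gradient \<phi> x)"
proof -
  note \<phi> = test_function_support[OF assms]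
  show "test_function \<Omega> (\<lambda>x. c * \<phi> x)"
  proof (rule test_functionI[OF _ _ \<phi>(2,3)])
    have "{x. c * \<phi> x \<noteq> 0} \<subseteq> {x. \<phi> x \<noteq> 0}" by auto
    then show "{x. c * \<phi> x \<noteq> 0} \<subseteq> closure {x. \<phi> x \<noteq> 0}"
      using \<phi>(1) by blast
    show "C_class m (\<lambda>x. c * \<phi> x)" for m by (intro C_class_mult_const \<phi>)
  qed
  show "gradient (\<lambda>x. c * \<phi> x) = (\<lambda>x. c *\<^sub>R gradient \<phi> x)"
    using GDERIV_mult[OF GDERIV_const test_function_gradient[OF assms], of c]
    by (intro ext gradient_eqI) simp
qed

lemma test_function_mult_coordinate:
  assumes "test_function \<Omega> \<phi>" "i \<in> Basis"
  shows "test_function \<Omega> (\<lambda>x. (x \<bullet> i) * \<phi> x)"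
    and "gradient (\<lambda>x. (x \<bullet> i) * \<phi> x) = (\<lambda>x. \<phi> x *\<^sub>R i + (x \<bullet> i) *\<^sub>R gradient \<phi> x)"
proof -
  note \<phi> = test_function_support[OF assms(1)]
  show "test_function \<Omega> (\<lambda>x. (x \<bullet> i) * \<phi> x)"
  proof (rule test_functionI[OF _ _ \<phi>(2,3)])
    have "{x. (x \<bullet> i) * \<phi> x \<noteq> 0} \<subseteq> {x. \<phi> x \<noteq> 0}" by (rule Collect_mono) simp
    then show "{x. (x \<bullet> i) * \<phi> x \<noteq> 0} \<subseteq> closure {x. \<phi> x \<noteq> 0}"
      using \<phi>(1) by blast
    show "C_class m (\<lambda>x. (x \<bullet> i) * \<phi> x)" for m by (intro C_class_mult_coordinate \<phi> assms(2))
  qed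
  show "gradient (\<lambda>x. (x \<bullet> i) * \<phi> x) = (\<lambda>x. \<phi> x *\<^sub>R i + (x \<bullet> i) *\<^sub>R gradient \<phi> x)"
    using GDERIV_mult[OF GDERIV_coordinate test_function_gradient[OF assms(1)], of i]
    by (intro ext gradient_eqI) (simp add: add.commute)
qed

section \<open>Integrability under compact support, translation invariance\<close>

lemma borel_imp_lebesgue_measurable:
  fixes f :: "'a::euclidean_space \<Rightarrow> 'b::topological_space"
  shows "f \<in> borel_measurable borel \<Longrightarrow> f \<in> borel_measurable lebesgue"
  by (rule measurable_completion) simp

lemma bounded_on_compact_support:
  fixes f :: "'a::euclidean_space \<Rightarrow> 'b::real_normed_vector"
  assumes "continuous_on UNIV f" "compact K" "\<And>x. x \<notin> K \<Longrightarrow> f x = 0"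
  shows "\<exists>B\<ge>0. \<forall>x. norm (f x) \<le> B * indicator K x"
proof -
  have "bounded (f ` K)"
    by (intro compact_imp_bounded compact_continuous_image continuous_on_subset[OF assms(1)] assms(2)) simp
  then obtain B where B: "\<And>x. x \<in> K \<Longrightarrow> norm (f x) \<le> B" unfolding bounded_iff by auto
  have "norm (f x) \<le> \<bar>B\<bar> * indicator K x" for x
  proof (cases "x \<in> K")
    case True
    with B[OF this] show ?thesis by simp
  qed (simp add: assms(3))
  then show ?thesis using abs_ge_zero by blast
qed

lemma integrable_compact_support:
  fixes f :: "'a::euclidean_space \<Rightarrow> 'b::euclidean_space"
  assumes f: "continuous_on UNIV f" and K: "compact K" and supp: "\<And>x. x \<notin> K \<Longrightarrow> f x = 0"
  shows "integrable lborel f"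
proof -
  obtain B where B: "\<And>x. norm (f x) \<le> B * indicator K x"
    using bounded_on_compact_support[OF assms] by blast
  have "emeasure lborel K < \<infinity>" using K by (intro emeasure_bounded_finite compact_imp_bounded)
  then have "integrable lborel (\<lambda>x. B * indicator K x :: real)"
    using K by (intro integrable_mult_right integrable_real_indicator) (auto intro: borel_compact)
  then show ?thesis
  proof (rule Bochner_Integration.integrable_bound)
    show "f \<in> borel_measurable lborel" using f by (simp add: borel_measurable_continuous_onI)
    have "norm (f x) \<le> norm (B * indicator K x :: real)" for x
      using B[of x] by (metis abs_ge_self order_trans real_norm_def)
    then show "AE x in lborel. norm (f x) \<le> norm (B * indicator K x :: real)" by simp
  qed
qed

lemma square_integrable_compact_support:
  fixes f :: "'a::euclidean_space \<Rightarrow> 'b::euclidean_space"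
  assumes f: "continuous_on UNIV f" and K: "compact K" and supp: "\<And>x. x \<notin> K \<Longrightarrow> f x = 0"
  shows "square_integrable f"
proof -
  have "integrable lborel (\<lambda>x. (norm (f x))\<^sup>2)"
    using f K supp by (intro integrable_compact_support[where K = K] continuous_intros) auto
  then have "integrable lebesgue (\<lambda>x. (norm (f x))\<^sup>2)"
    by (simp add: integrable_completion borel_measurable_integrable)
  then show ?thesis
    unfolding square_integrable_def
    using f by (simp add: borel_imp_lebesgue_measurable borel_measurable_continuous_onI)
qed

lemma compactly_supported_C1_Lipschitz:
  fixes f :: "'a::euclidean_space \<Rightarrow> real"
  assumes f: "compactly_supported_C1 K f" and B: "\<And>x. norm (gradient f x) \<le> B"
  shows "\<bar>f (x + w) - f x\<bar> \<le> B * norm w"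
proof -
  have "norm (f (x + w) - f x) \<le> B * norm (x + w - x)"
  proof (rule differentiable_bound[where S = UNIV and f' = "\<lambda>x h. h \<bullet> gradient f x"])
    show "(f has_derivative (\<lambda>h. h \<bullet> gradient f y)) (at y within UNIV)" for y
      using compactly_supported_C1_GDERIV[OF f, of y] by (simp add: gderiv_def)
    show "onorm (\<lambda>h. h \<bullet> gradient f y) \<le> B" for y
    proof (rule onorm_le)
      show "norm (h \<bullet> gradient f y) \<le> B * norm h" for h
        using Cauchy_Schwarz_ineq2[of h "gradient f y"] mult_left_mono[OF B[of y], of "norm h"]
        by (simp add: mult.commute)
    qed
  qed auto
  then show ?thesis by simp
qed

lemma integral_translation:
  fixes f :: "'a::euclidean_space \<Rightarrow> real"
  assumes "f \<in> borel_measurable borel"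
  shows "(LINT x|lborel. f (x + w)) = (LINT x|lborel. f x)"
proof -
  have "(LINT x|lborel. f x) = (LINT x|distr lborel borel ((+) w). f x)"
    by (simp only: lborel_distr_plus)
  also have "\<dots> = (LINT x|lborel. f (w + x))"
    using assms by (subst integral_distr) auto
  finally show ?thesis by (simp add: add.commute)
qed

subsection \<open>Integration by parts and translations\<close>

lemma compactly_supported_C1_line_derivative:
  assumes f: "compactly_supported_C1 K f"
  shows "((\<lambda>t. f (x + t *\<^sub>R w)) has_real_derivative gradient f (x + t *\<^sub>R w) \<bullet> w) (at t within S)"
proof -
  have 1: "((\<lambda>t. x + t *\<^sub>R w) has_derivative (\<lambda>s. s *\<^sub>R w)) (at t within S)"
    by (auto intro!: derivative_eq_intros)
  have "(f has_derivative (\<lambda>h. h \<bullet> gradient f (x + t *\<^sub>R w))) (at (x + t *\<^sub>R w))"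
    using compactly_supported_C1_GDERIV[OF f] by (simp add: gderiv_def)
  from has_derivative_compose[OF 1 this] show ?thesis
    unfolding has_field_derivative_def by (rule has_derivative_eq_rhs) (auto simp: inner_commute mult.commute)
qed

lemma compactly_supported_C1_difference_quotient:
  assumes f: "compactly_supported_C1 K f"
  shows "(\<lambda>n. (f (x + inverse (real (Suc n)) *\<^sub>R w) - f x) / inverse (real (Suc n))) \<longlonglongrightarrow> gradient f x \<bullet> w"
proof -
  have "((\<lambda>t. f (x + t *\<^sub>R w)) has_real_derivative gradient f x \<bullet> w) (at 0)"
    using compactly_supported_C1_line_derivative[OF f, of x w 0 UNIV] by simp
  from DERIV_D[OF this] have "((\<lambda>h. (f (x + h *\<^sub>R w) - f x) / h) \<longlongrightarrow> gradient f x \<bullet> w) (at 0)"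
    by simp
  moreover have "filterlim (\<lambda>n. inverse (real (Suc n))) (at 0) sequentially"
    by (intro filterlim_atI LIMSEQ_inverse_real_of_nat) auto
  ultimately show ?thesis by (rule filterlim_compose)
qed

text \<open>Difference quotients integrate to 0 because the integral is translation invariant.
  Dominated convergence carries this over to the derivative, with the Lipschitz bound on a large
  ball as majorant.\<close>

lemma integral_gradient_eq_0:
  fixes f :: "'a::euclidean_space \<Rightarrow> real"
  assumes f: "compactly_supported_C1 K f"
  shows "(LINT x|lborel. gradient f x \<bullet> w) = 0"
proof -
  note K = compactly_supported_C1D(1)[OF f] and f0 = compactly_supported_C1D(2)[OF f]
    and gcont = compactly_supported_C1D(3)[OF f]
  have fcont: "continuous_on UNIV f" by (rule compactly_supported_C1_continuous[OF f])
  obtain B where B0: "0 \<le> B" and B: "\<And>x. norm (gradient f x) \<le> B * indicator K x"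
    using bounded_on_compact_support[OF gcont K compactly_supported_C1_gradient_0[OF f]] by metis
  have B': "norm (gradient f x) \<le> B" for x
    using B[of x] B0 by (cases "x \<in> K") auto
  obtain R where R: "\<And>x. x \<in> K \<Longrightarrow> norm x \<le> R" using compact_imp_bounded[OF K] unfolding bounded_iff by auto
  \<comment> \<open>The translations used have length at most \<open>norm w\<close>, so outside this
    ball both terms of every difference quotient vanish.\<close>
  define C where "C = cball (0::'a) (R + norm w)"
  define q where "q n x = (f (x + inverse (real (Suc n)) *\<^sub>R w) - f x) / inverse (real (Suc n))" for n x
  have int_f: "integrable lborel f" by (rule integrable_compact_support[OF fcont K f0])
  have fm [measurable]: "f \<in> borel_measurable borel" using int_f borel_measurable_integrable by auto
  have int_tf: "integrable lborel (\<lambda>x. f (x + v))" for v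
  proof -
    have "integrable (distr lborel borel ((+) v)) f" using int_f by (simp only: lborel_distr_plus)
    then show ?thesis by (subst (asm) integrable_distr_eq) (auto simp: add.commute)
  qed
  have "(\<lambda>n. LINT x|lborel. q n x) \<longlonglongrightarrow> (LINT x|lborel. gradient f x \<bullet> w)"
  proof (rule integral_dominated_convergence)
    show "(\<lambda>x. gradient f x \<bullet> w) \<in> borel_measurable lborel"
      using gcont by (auto intro!: borel_measurable_continuous_onI continuous_intros)
    show "q n \<in> borel_measurable lborel" for n unfolding q_def by measurable
    have "emeasure lborel C < \<infinity>" unfolding C_def by (intro emeasure_bounded_finite) simp
    then show "integrable lborel (\<lambda>x. (B * norm w) * indicator C x :: real)"
      by (intro integrable_mult_right integrable_real_indicator) (auto simp: C_def)
    show "AE x in lborel. (\<lambda>n. q n x) \<longlonglongrightarrow> gradient f x \<bullet> w"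
      unfolding q_def by (intro AE_I2 compactly_supported_C1_difference_quotient[OF f])
    have "norm (q n x) \<le> (B * norm w) * indicator C x" for n x
    proof (cases "x \<in> C")
      case True
      let ?e = "inverse (real (Suc n))"
      have "\<bar>f (x + ?e *\<^sub>R w) - f x\<bar> \<le> B * norm (?e *\<^sub>R w)"
        by (rule compactly_supported_C1_Lipschitz[OF f B'])
      then have "\<bar>f (x + ?e *\<^sub>R w) - f x\<bar> / ?e \<le> B * norm w"
        by (simp add: divide_le_eq field_simps)
      then show ?thesis using True by (simp add: q_def abs_divide)
    next
      case False
      then have x: "norm x > R + norm w" by (simp add: C_def)
      have "norm (inverse (real (Suc n)) *\<^sub>R w) \<le> norm w"
        by (simp add: field_simps)
      then have "norm (x + inverse (real (Suc n)) *\<^sub>R w) > R"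
        using x norm_triangle_ineq4[of "x + inverse (real (Suc n)) *\<^sub>R w" "inverse (real (Suc n)) *\<^sub>R w"] by simp
      then have "f (x + inverse (real (Suc n)) *\<^sub>R w) = 0" using f0 R by (meson not_le)
      moreover have "f x = 0" using f0 R x norm_ge_zero[of w] by (meson add_increasing2 not_le order_trans le_less_trans less_le_not_le)
      ultimately show ?thesis using False by (simp add: q_def)
    qed
    then show "AE x in lborel. norm (q n x) \<le> (B * norm w) * indicator C x" for n by simp
  qed
  moreover have "(LINT x|lborel. q n x) = 0" for n
  proof -
    have "(LINT x|lborel. q n x) =
        ((LINT x|lborel. f (x + inverse (real (Suc n)) *\<^sub>R w)) - (LINT x|lborel. f x)) / inverse (real (Suc n))"
      unfolding q_def by (simp add: int_tf int_f del: of_nat_Suc inverse_inverse_eq)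
    then show ?thesis by (simp only: integral_translation[OF fm]) simp
  qed
  ultimately show ?thesis by (simp add: LIMSEQ_const_iff)
qed

text \<open>The product \<open>f * g\<close> is again compactly supported, and the integral of its
  derivative is 0.\<close>

lemma integral_by_parts_C1:
  fixes f g :: "'a::euclidean_space \<Rightarrow> real"
  assumes f: "compactly_supported_C1 K f" and g: "compactly_supported_C1 L g"
  shows "(LINT x|lborel. f x * (gradient g x \<bullet> w)) = - (LINT x|lborel. (gradient f x \<bullet> w) * g x)"
proof -
  note K = compactly_supported_C1D(1)[OF f] and f0 = compactly_supported_C1D(2)[OF f]
    and fg = compactly_supported_C1D(3)[OF f] and gg = compactly_supported_C1D(3)[OF g]
  note cont = compactly_supported_C1_continuous[OF f] compactly_supported_C1_continuous[OF g] fg gg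
  have 1: "integrable lborel (\<lambda>x. f x * (gradient g x \<bullet> w))"
    by (rule integrable_compact_support[OF _ K]) (auto intro!: continuous_intros cont simp: f0)
  have 2: "integrable lborel (\<lambda>x. (gradient f x \<bullet> w) * g x)"
    by (rule integrable_compact_support[OF _ K])
      (auto intro!: continuous_intros cont simp: compactly_supported_C1_gradient_0[OF f])
  have "0 = (LINT x|lborel. gradient (\<lambda>x. f x * g x) x \<bullet> w)"
    using integral_gradient_eq_0[OF compactly_supported_C1_mult(1)[OF f g]] by simp
  also have "\<dots> = (LINT x|lborel. f x * (gradient g x \<bullet> w) + (gradient f x \<bullet> w) * g x)"
    by (simp add: compactly_supported_C1_mult(2)[OF f g] inner_add_left mult.commute)
  also have "\<dots> = (LINT x|lborel. f x * (gradient g x \<bullet> w)) + (LINT x|lborel. (gradient f x \<bullet> w) * g x)"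
    by (rule Bochner_Integration.integral_add[OF 1 2])
  finally show ?thesis by simp
qed

text \<open>\<open>c\<close> is the mean of \<open>F'\<close> over the unit interval, and the
  integral of \<open>(F' - c)^2\<close> is nonnegative. This is Cauchy-Schwarz against the constant
  1.\<close>

lemma power2_increment_le:
  assumes F: "\<And>t. (F has_real_derivative F' t) (at t within {0..1})" and cont: "continuous_on {0..1} F'"
  shows "ennreal ((F 1 - F 0)\<^sup>2) \<le> (\<integral>\<^sup>+t. ennreal (indicator {0..1} t * (F' t)\<^sup>2) \<partial>lborel)"
proof -
  define c where "c = F 1 - F 0"
  have i1: "integrable lborel (\<lambda>t. indicator {0..1} t * F' t)"
    using borel_integrable_atLeastAtMost'[OF cont] by (simp add: set_integrable_def)
  have i2: "integrable lborel (\<lambda>t. indicator {0..1} t * (F' t)\<^sup>2)"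
    using borel_integrable_atLeastAtMost'[OF continuous_on_power[OF cont, of 2]] by (simp add: set_integrable_def)
  have i3: "integrable lborel (\<lambda>t. indicator {0..1::real} t * c\<^sup>2)"
    by (intro integrable_mult_left integrable_real_indicator) auto
  have c: "(LINT t|lborel. indicator {0..1} t * F' t) = c"
    unfolding c_def using integral_FTC_atLeastAtMost[of 0 1 F F'] F cont
    by (simp add: has_real_derivative_iff_has_vector_derivative)
  have "0 \<le> (LINT t|lborel. indicator {0..1} t * (F' t - c)\<^sup>2)"
    by (rule integral_nonneg_AE) simp
  also have "(\<lambda>t. indicator {0..1} t * (F' t - c)\<^sup>2) =
      (\<lambda>t. indicator {0..1} t * (F' t)\<^sup>2 + (indicator {0..1} t * c\<^sup>2 - (2 * c) * (indicator {0..1} t * F' t)))"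
    by (rule ext) (simp add: power2_diff algebra_simps)
  also have "(LINT t|lborel. \<dots> t) = (LINT t|lborel. indicator {0..1} t * (F' t)\<^sup>2) + (c\<^sup>2 - 2 * c * c)"
    by (subst Bochner_Integration.integral_add[OF i2], intro Bochner_Integration.integrable_diff i3 integrable_mult_right i1,
        subst Bochner_Integration.integral_diff[OF i3], intro integrable_mult_right i1) (simp add: c)
  finally have "c\<^sup>2 \<le> (LINT t|lborel. indicator {0..1} t * (F' t)\<^sup>2)"
    by (simp add: power2_eq_square)
  moreover have "(\<integral>\<^sup>+t. ennreal (indicator {0..1} t * (F' t)\<^sup>2) \<partial>lborel) =
      ennreal (LINT t|lborel. indicator {0..1} t * (F' t)\<^sup>2)"
    by (rule nn_integral_eq_integral[OF i2]) simp
  ultimately show ?thesis by (simp add: c_def ennreal_leI)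
qed

lemma nn_integral_translation:
  fixes f :: "'a::euclidean_space \<Rightarrow> ennreal"
  assumes "f \<in> borel_measurable borel"
  shows "(\<integral>\<^sup>+x. f (x + w) \<partial>lborel) = (\<integral>\<^sup>+x. f x \<partial>lborel)"
proof -
  have "(\<integral>\<^sup>+x. f x \<partial>lborel) = (\<integral>\<^sup>+x. f x \<partial>distr lborel borel ((+) w))"
    by (simp only: lborel_distr_plus)
  also have "\<dots> = (\<integral>\<^sup>+x. f (w + x) \<partial>lborel)"
    using assms by (subst nn_integral_distr) auto
  finally show ?thesis by (simp add: add.commute)
qed

text \<open>The increment over \<open>w\<close> is controlled by the derivative along the segment
  from \<open>x\<close> to \<open>x + w\<close>. After Fubini, each point of the segment contributes
  the same integral by translation invariance.\<close>

lemma translation_estimate: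
  fixes f :: "'a::euclidean_space \<Rightarrow> real"
  assumes f: "compactly_supported_C1 K f"
  shows "(\<integral>\<^sup>+x. ennreal ((f (x + w) - f x)\<^sup>2) \<partial>lborel) \<le>
    ennreal ((norm w)\<^sup>2) * (\<integral>\<^sup>+x. ennreal ((norm (gradient f x))\<^sup>2) \<partial>lborel)"
proof -
  note gcont = compactly_supported_C1D(3)[OF f]
  have [measurable]: "gradient f \<in> borel_measurable borel" by (rule borel_measurable_continuous_onI[OF gcont])
  let ?G = "\<integral>\<^sup>+x. ennreal ((norm (gradient f x))\<^sup>2) \<partial>lborel"
  have "(\<integral>\<^sup>+x. ennreal ((f (x + w) - f x)\<^sup>2) \<partial>lborel) \<le>
      (\<integral>\<^sup>+x. \<integral>\<^sup>+t. ennreal (indicator {0..1} t * (gradient f (x + t *\<^sub>R w) \<bullet> w)\<^sup>2) \<partial>lborel \<partial>lborel)"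
  proof (rule nn_integral_mono)
    fix x
    have "continuous_on {0..1} (\<lambda>t. gradient f (x + t *\<^sub>R w) \<bullet> w)"
      by (intro continuous_intros continuous_on_compose2[OF gcont]) auto
    from power2_increment_le[OF compactly_supported_C1_line_derivative[OF f] this]
    show "ennreal ((f (x + w) - f x)\<^sup>2) \<le>
        (\<integral>\<^sup>+t. ennreal (indicator {0..1} t * (gradient f (x + t *\<^sub>R w) \<bullet> w)\<^sup>2) \<partial>lborel)"
      by simp
  qed
  also have "\<dots> \<le> (\<integral>\<^sup>+x. \<integral>\<^sup>+t. ennreal ((norm w)\<^sup>2) * (indicator {0..1::real} t *
      ennreal ((norm (gradient f (x + t *\<^sub>R w)))\<^sup>2)) \<partial>lborel \<partial>lborel)"
  proof (intro nn_integral_mono)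
    fix x t
    have "(gradient f (x + t *\<^sub>R w) \<bullet> w)\<^sup>2 \<le> (norm (gradient f (x + t *\<^sub>R w)) * norm w)\<^sup>2"
      using Cauchy_Schwarz_ineq2 by (metis abs_le_square_iff abs_norm_cancel abs_mult)
    then show "ennreal (indicator {0..1} t * (gradient f (x + t *\<^sub>R w) \<bullet> w)\<^sup>2) \<le>
        ennreal ((norm w)\<^sup>2) * (indicator {0..1} t * ennreal ((norm (gradient f (x + t *\<^sub>R w)))\<^sup>2))"
      by (auto simp: indicator_def ennreal_mult[symmetric] power_mult_distrib mult.commute intro!: ennreal_leI)
  qed
  also have "\<dots> = (\<integral>\<^sup>+t. \<integral>\<^sup>+x. ennreal ((norm w)\<^sup>2) * (indicator {0..1::real} t *
      ennreal ((norm (gradient f (x + t *\<^sub>R w)))\<^sup>2)) \<partial>lborel \<partial>lborel)"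
    by (rule lborel_pair.Fubini'[symmetric]) measurable
  also have "\<dots> = (\<integral>\<^sup>+t. ennreal ((norm w)\<^sup>2) * (indicator {0..1::real} t * ?G) \<partial>lborel)"
  proof (rule nn_integral_cong)
    fix t :: real
    have "(\<integral>\<^sup>+x. ennreal ((norm (gradient f (x + t *\<^sub>R w)))\<^sup>2) \<partial>lborel) = ?G"
      by (rule nn_integral_translation[of "\<lambda>x. ennreal ((norm (gradient f x))\<^sup>2)"]) measurable
    then show "(\<integral>\<^sup>+x. ennreal ((norm w)\<^sup>2) * (indicator {0..1::real} t *
      ennreal ((norm (gradient f (x + t *\<^sub>R w)))\<^sup>2)) \<partial>lborel) = ennreal ((norm w)\<^sup>2) * (indicator {0..1::real} t * ?G)"
      by (simp add: nn_integral_cmult)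
  qed
  also have "\<dots> = ennreal ((norm w)\<^sup>2) * ?G"
    by (simp add: nn_integral_cmult nn_integral_multc)
  finally show ?thesis .
qed

subsection \<open>A Poincare inequality on small cells\<close>

text \<open>Rounds every coordinate down to a multiple of \<open>h\<close>. The fibres are the
  half-open cubes of the grid, so they partition the space and the corner serves as the name of its
  cube.\<close>

definition cell_corner :: "real \<Rightarrow> 'a::euclidean_space \<Rightarrow> 'a" where
  "cell_corner h x = (\<Sum>i\<in>Basis. (h * \<lfloor>(x \<bullet> i) / h\<rfloor>) *\<^sub>R i)"

definition cell :: "real \<Rightarrow> 'a::euclidean_space \<Rightarrow> 'a set" where
  "cell h p = {x. cell_corner h x = p}"

lemma cell_corner_inner: "i \<in> Basis \<Longrightarrow> cell_corner h x \<bullet> i = h * \<lfloor>(x \<bullet> i) / h\<rfloor>"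
  by (simp add: cell_corner_def)

lemma cell_borel: "cell h p \<in> sets borel"
proof -
  have "cell h p = (\<Inter>i\<in>Basis. {x. h * real_of_int \<lfloor>(x \<bullet> i) / h\<rfloor> = p \<bullet> i})"
    unfolding cell_def by (auto simp: euclidean_eq_iff[of _ p] cell_corner_inner)
  moreover have "{x::'a. h * real_of_int \<lfloor>(x \<bullet> i) / h\<rfloor> = p \<bullet> i} \<in> sets borel" for i
    by measurable
  ultimately show ?thesis by auto
qed

lemma cell_corner_bounds:
  assumes "0 < h" "i \<in> Basis"
  shows "cell_corner h x \<bullet> i \<le> x \<bullet> i" "x \<bullet> i < cell_corner h x \<bullet> i + h"
proof -
  have "h * real_of_int \<lfloor>(x \<bullet> i) / h\<rfloor> \<le> h * ((x \<bullet> i) / h)"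
    using assms(1) by (intro mult_left_mono) auto
  then show "cell_corner h x \<bullet> i \<le> x \<bullet> i"
    using assms by (simp add: cell_corner_inner)
  have "h * ((x \<bullet> i) / h) < h * (real_of_int \<lfloor>(x \<bullet> i) / h\<rfloor> + 1)"
    using assms(1) by (intro mult_strict_left_mono) linarith+
  then show "x \<bullet> i < cell_corner h x \<bullet> i + h"
    using assms by (simp add: cell_corner_inner distrib_left)
qed

text \<open>The half-open cube lies between the open and the closed cube, which have the same
  volume.\<close>

lemma emeasure_cell:
  fixes y :: "'a::euclidean_space"
  assumes h: "0 < h"
  shows "emeasure lborel (cell h (cell_corner h y)) = ennreal (h ^ DIM('a))"
proof (rule antisym)
  let ?p = "cell_corner h y"
  have "cell h ?p \<subseteq> cbox ?p (?p + h *\<^sub>R One)"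
  proof
    fix x assume "x \<in> cell h ?p"
    then have x: "cell_corner h x = ?p" by (simp add: cell_def)
    then show "x \<in> cbox ?p (?p + h *\<^sub>R One)"
      using cell_corner_bounds[OF h, of _ x] unfolding mem_box by (auto simp: inner_add_left x intro: less_imp_le)
  qed
  then have "emeasure lborel (cell h ?p) \<le> emeasure lborel (cbox ?p (?p + h *\<^sub>R One))"
    by (intro emeasure_mono) auto
  also have "\<dots> = ennreal (h ^ DIM('a))"
    using h by (subst emeasure_lborel_cbox) (auto simp: inner_add_left)
  finally show "emeasure lborel (cell h ?p) \<le> ennreal (h ^ DIM('a))" .
  have "box ?p (?p + h *\<^sub>R One) \<subseteq> cell h ?p"
  proof
    fix x assume x: "x \<in> box ?p (?p + h *\<^sub>R One)"
    have "\<lfloor>(x \<bullet> i) / h\<rfloor> = \<lfloor>(y \<bullet> i) / h\<rfloor>" if i: "i \<in> Basis" for i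
    proof (rule floor_unique)
      have "?p \<bullet> i < x \<bullet> i" "x \<bullet> i < ?p \<bullet> i + h"
        using x i by (auto simp: mem_box inner_add_left)
      then show "real_of_int \<lfloor>(y \<bullet> i) / h\<rfloor> \<le> (x \<bullet> i) / h" "(x \<bullet> i) / h < real_of_int \<lfloor>(y \<bullet> i) / h\<rfloor> + 1"
        using h i by (simp_all add: cell_corner_inner field_simps)
    qed
    then show "x \<in> cell h ?p" unfolding cell_def cell_corner_def by simp
  qed
  then have "emeasure lborel (box ?p (?p + h *\<^sub>R One)) \<le> emeasure lborel (cell h ?p)"
    by (intro emeasure_mono) (auto simp: cell_borel)
  moreover have "emeasure lborel (box ?p (?p + h *\<^sub>R One)) = ennreal (h ^ DIM('a))"
    using h by (subst emeasure_lborel_box) (auto simp: inner_add_left)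
  ultimately show "ennreal (h ^ DIM('a)) \<le> emeasure lborel (cell h ?p)" by simp
qed

lemma finite_cell_corners:
  fixes \<Omega> :: "'a::euclidean_space set"
  assumes "bounded \<Omega>" "0 < h"
  shows "finite (cell_corner h ` \<Omega>)"
proof -
  obtain B where B: "\<And>x. x \<in> \<Omega> \<Longrightarrow> norm x \<le> B" using assms(1) unfolding bounded_iff by auto
  define Z where "Z = {- \<lceil>B / h\<rceil> - 1 .. \<lceil>B / h\<rceil> + 1}"
  define F :: "('a \<Rightarrow> int) \<Rightarrow> 'a" where "F k = (\<Sum>i\<in>Basis. (h * k i) *\<^sub>R i)" for k
  have "cell_corner h ` \<Omega> \<subseteq> F ` (PiE Basis (\<lambda>_. Z))"
  proof
    fix p assume "p \<in> cell_corner h ` \<Omega>"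
    then obtain x where x: "x \<in> \<Omega>" "p = cell_corner h x" by blast
    let ?k = "\<lambda>i\<in>Basis. \<lfloor>(x \<bullet> i) / h\<rfloor>"
    have "\<lfloor>(x \<bullet> i) / h\<rfloor> \<in> Z" if i: "i \<in> Basis" for i
    proof -
      have "\<bar>x \<bullet> i\<bar> \<le> B" using Basis_le_norm[OF i, of x] B[OF x(1)] by linarith
      then have "(x \<bullet> i) / h \<le> B / h" "- (B / h) \<le> (x \<bullet> i) / h"
        using assms(2) by (auto simp: field_simps)
      then show ?thesis unfolding Z_def by (simp add: floor_le_iff le_floor_iff) linarith
    qed
    then have "?k \<in> PiE Basis (\<lambda>_. Z)" by auto
    moreover have "p = F ?k" unfolding F_def x(2) cell_corner_def by simp
    ultimately show "p \<in> F ` (PiE Basis (\<lambda>_. Z))" by blast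
  qed
  moreover have "finite (PiE (Basis :: 'a set) (\<lambda>_. Z))" by (intro finite_PiE) (auto simp: Z_def)
  ultimately show ?thesis by (meson finite_imageI finite_subset)
qed

text \<open>Expand the square and integrate term by term. The double integral expresses the variance
  on \<open>Q\<close> through differences \<open>f y - f x\<close> only, which is what the
  translation estimate can bound.\<close>

lemma cell_variance:
  fixes f :: "'a::euclidean_space \<Rightarrow> real"
  assumes Q: "Q \<in> sets borel" "emeasure lborel Q = ennreal v" "0 \<le> v"
    and f: "integrable lborel f" "integrable lborel (\<lambda>x. (f x)\<^sup>2)"
  defines "s \<equiv> LINT x|lborel. indicator Q x * f x"
    and "A \<equiv> LINT x|lborel. indicator Q x * (f x)\<^sup>2"
  shows "(\<integral>\<^sup>+x. \<integral>\<^sup>+y. ennreal (indicator Q x * indicator Q y * (f y - f x)\<^sup>2) \<partial>lborel \<partial>lborel)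
      = ennreal (2 * v * A - 2 * s\<^sup>2)" "0 \<le> 2 * v * A - 2 * s\<^sup>2"
proof -
  have i0: "integrable lborel (indicator Q :: 'a \<Rightarrow> real)"
    using Q by (intro integrable_real_indicator) auto
  have i1: "integrable lborel (\<lambda>x. indicator Q x * f x)"
    using integrable_mult_indicator[OF _ f(1), of Q] Q by simp
  have i2: "integrable lborel (\<lambda>x. indicator Q x * (f x)\<^sup>2)"
    using integrable_mult_indicator[OF _ f(2), of Q] Q by simp
  have hv: "has_bochner_integral lborel (indicator Q) v"
    using has_bochner_integral_integrable[OF i0] Q by (simp add: measure_def)
  have hs: "has_bochner_integral lborel (\<lambda>x. indicator Q x * f x) s"
    unfolding s_def by (rule has_bochner_integral_integrable[OF i1])
  have hA: "has_bochner_integral lborel (\<lambda>x. indicator Q x * (f x)\<^sup>2) A"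
    unfolding A_def by (rule has_bochner_integral_integrable[OF i2])
  have inner: "has_bochner_integral lborel (\<lambda>y. indicator Q x * indicator Q y * (f y - f x)\<^sup>2)
      (indicator Q x * (A - 2 * f x * s + (f x)\<^sup>2 * v))" for x
  proof -
    have "has_bochner_integral lborel
        (\<lambda>y. indicator Q x * (indicator Q y * (f y)\<^sup>2 - 2 * f x * (indicator Q y * f y) + (f x)\<^sup>2 * indicator Q y))
        (indicator Q x * (A - 2 * f x * s + (f x)\<^sup>2 * v))"
      by (intro has_bochner_integral_mult_right has_bochner_integral_add has_bochner_integral_diff hv hs hA)
    then show ?thesis by (simp add: power2_diff algebra_simps)
  qed
  have outer: "has_bochner_integral lborel (\<lambda>x. indicator Q x * (A - 2 * f x * s + (f x)\<^sup>2 * v)) (2 * v * A - 2 * s\<^sup>2)"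
  proof -
    have "has_bochner_integral lborel
        (\<lambda>x. A * indicator Q x - (2 * s) * (indicator Q x * f x) + v * (indicator Q x * (f x)\<^sup>2))
        (A * v - (2 * s) * s + v * A)"
      by (intro has_bochner_integral_mult_right has_bochner_integral_add has_bochner_integral_diff hv hs hA)
    then show ?thesis by (simp add: power2_eq_square algebra_simps)
  qed
  have nonneg: "0 \<le> indicator Q x * (A - 2 * f x * s + (f x)\<^sup>2 * v)" for x
    unfolding has_bochner_integral_integral_eq[OF inner[of x], symmetric]
    by (rule Bochner_Integration.integral_nonneg) simp
  have "(\<integral>\<^sup>+y. ennreal (indicator Q x * indicator Q y * (f y - f x)\<^sup>2) \<partial>lborel) =
      ennreal (indicator Q x * (A - 2 * f x * s + (f x)\<^sup>2 * v))" for x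
    using inner[of x] by (subst nn_integral_eq_integral) (auto simp: has_bochner_integral_iff)
  then show "(\<integral>\<^sup>+x. \<integral>\<^sup>+y. ennreal (indicator Q x * indicator Q y * (f y - f x)\<^sup>2) \<partial>lborel \<partial>lborel)
      = ennreal (2 * v * A - 2 * s\<^sup>2)"
    using outer nonneg by (simp add: nn_integral_eq_integral has_bochner_integral_iff)
  show "0 \<le> 2 * v * A - 2 * s\<^sup>2"
    unfolding has_bochner_integral_integral_eq[OF outer, symmetric]
    by (rule Bochner_Integration.integral_nonneg) (rule nonneg)
qed

text \<open>Substituting \<open>y = x + w\<close> and exchanging the integrals leaves one
  translation estimate for each \<open>w\<close> in a cube of side \<open>2 * h\<close>, where
  \<open>(norm w)^2\<close> is at most \<open>DIM('a) * h^2\<close>.\<close>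

lemma short_increments_estimate:
  fixes f :: "'a::euclidean_space \<Rightarrow> real" and h :: real
  assumes f: "compactly_supported_C1 K f" and h: "0 < h"
  defines "C \<equiv> cbox (- (h *\<^sub>R One)) (h *\<^sub>R One) :: 'a set"
  shows "(\<integral>\<^sup>+x. \<integral>\<^sup>+y. ennreal (indicator C (y - x) * (f y - f x)\<^sup>2) \<partial>lborel \<partial>lborel) \<le>
    ennreal ((2 * h) ^ DIM('a) * (DIM('a) * h\<^sup>2)) * (\<integral>\<^sup>+x. ennreal ((norm (gradient f x))\<^sup>2) \<partial>lborel)"
proof -
  let ?G = "\<integral>\<^sup>+x. ennreal ((norm (gradient f x))\<^sup>2) \<partial>lborel"
  have [measurable]: "f \<in> borel_measurable borel"
    by (rule borel_measurable_continuous_onI[OF compactly_supported_C1_continuous[OF f]])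
  have [measurable]: "C \<in> sets borel" by (simp add: C_def)
  have norm_C: "(norm w)\<^sup>2 \<le> DIM('a) * h\<^sup>2" if "w \<in> C" for w
  proof -
    have "(norm w)\<^sup>2 = (\<Sum>i\<in>Basis. (w \<bullet> i)\<^sup>2)"
      unfolding power2_norm_eq_inner by (subst euclidean_inner) (simp add: power2_eq_square)
    also have "\<dots> \<le> (\<Sum>i\<in>(Basis::'a set). h\<^sup>2)"
    proof (rule sum_mono)
      fix i :: 'a assume "i \<in> Basis"
      with that have "\<bar>w \<bullet> i\<bar> \<le> h" by (auto simp: C_def mem_box abs_le_iff)
      then have "\<bar>w \<bullet> i\<bar>\<^sup>2 \<le> h\<^sup>2" by (intro power_mono) auto
      then show "(w \<bullet> i)\<^sup>2 \<le> h\<^sup>2" by simp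
    qed
    finally show ?thesis by simp
  qed
  have "(\<integral>\<^sup>+y. ennreal (indicator C (y - x) * (f y - f x)\<^sup>2) \<partial>lborel) =
      (\<integral>\<^sup>+w. ennreal (indicator C w * (f (x + w) - f x)\<^sup>2) \<partial>lborel)" for x
    using nn_integral_translation[of "\<lambda>y. ennreal (indicator C (y - x) * (f y - f x)\<^sup>2)" x]
    by (simp add: add.commute)
  then have "(\<integral>\<^sup>+x. \<integral>\<^sup>+y. ennreal (indicator C (y - x) * (f y - f x)\<^sup>2) \<partial>lborel \<partial>lborel) =
      (\<integral>\<^sup>+x. \<integral>\<^sup>+w. ennreal (indicator C w * (f (x + w) - f x)\<^sup>2) \<partial>lborel \<partial>lborel)"
    by simp
  also have "\<dots> = (\<integral>\<^sup>+w. \<integral>\<^sup>+x. ennreal (indicator C w * (f (x + w) - f x)\<^sup>2) \<partial>lborel \<partial>lborel)"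
    by (rule lborel_pair.Fubini'[symmetric]) measurable
  also have "\<dots> \<le> (\<integral>\<^sup>+w. (ennreal (DIM('a) * h\<^sup>2) * ?G) * indicator C w \<partial>lborel)"
  proof (rule nn_integral_mono)
    fix w
    show "(\<integral>\<^sup>+x. ennreal (indicator C w * (f (x + w) - f x)\<^sup>2) \<partial>lborel) \<le> (ennreal (DIM('a) * h\<^sup>2) * ?G) * indicator C w"
    proof (cases "w \<in> C")
      case True
      have "(\<integral>\<^sup>+x. ennreal ((f (x + w) - f x)\<^sup>2) \<partial>lborel) \<le> ennreal ((norm w)\<^sup>2) * ?G"
        by (rule translation_estimate[OF f])
      also have "\<dots> \<le> ennreal (DIM('a) * h\<^sup>2) * ?G"
        by (intro mult_right_mono ennreal_leI norm_C True) simp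
      finally show ?thesis using True by simp
    qed simp
  qed
  also have "\<dots> = (ennreal (DIM('a) * h\<^sup>2) * ?G) * emeasure lborel C"
    by (simp add: nn_integral_cmult_indicator)
  also have "emeasure lborel C = ennreal ((2 * h) ^ DIM('a))"
  proof -
    have "(\<Prod>b\<in>Basis. (h *\<^sub>R One - - (h *\<^sub>R (One :: 'a))) \<bullet> b) = (\<Prod>b\<in>(Basis :: 'a set). 2 * h)"
      by (rule prod.cong) (auto simp: inner_add_left)
    then show ?thesis
      unfolding C_def using h by (subst emeasure_lborel_cbox) (simp_all only: inner_minus_left prod_constant, auto)
  qed
  also have "(ennreal (DIM('a) * h\<^sup>2) * ?G) * ennreal ((2 * h) ^ DIM('a)) =
      ennreal ((2 * h) ^ DIM('a) * (DIM('a) * h\<^sup>2)) * ?G"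
    using h by (simp add: ennreal_mult mult_ac)
  finally show ?thesis .
qed

text \<open>On each cell the integral of \<open>f^2\<close> is its variance part plus the square of
  the cell integral divided by the volume. The variances of all cells together involve only short
  increments and are bounded by the gradient; the cell integrals are the finitely many functionals
  that remain.\<close>

lemma cells_poincare:
  fixes f :: "'a::euclidean_space \<Rightarrow> real" and h :: real
  assumes f: "compactly_supported_C1 K f" and h: "0 < h" and N: "finite N" "cell_corner h ` K \<subseteq> N"
    and N_corner: "N \<subseteq> range (cell_corner h)"
  shows "(LINT x|lborel. (f x)\<^sup>2) \<le> (2 ^ DIM('a) * DIM('a) * h\<^sup>2 / 2) * (LINT x|lborel. (norm (gradient f x))\<^sup>2)
    + (\<Sum>p\<in>N. (LINT x|lborel. indicator (cell h p) x * f x)\<^sup>2 / h ^ DIM('a))"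
proof -
  note K = compactly_supported_C1D(1)[OF f] and f0 = compactly_supported_C1D(2)[OF f]
    and gcont = compactly_supported_C1D(3)[OF f]
  note fcont = compactly_supported_C1_continuous[OF f]
  have [measurable]: "f \<in> borel_measurable borel"
    by (rule borel_measurable_continuous_onI[OF fcont])
  note [measurable] = cell_borel
  define C where "C = (cbox (- (h *\<^sub>R One)) (h *\<^sub>R One) :: 'a set)"
  have [measurable]: "C \<in> sets borel" by (simp add: C_def)
  define v where "v = h ^ DIM('a)"
  have v: "0 < v" using h by (simp add: v_def)
  define s where "s p = (LINT x|lborel. indicator (cell h p) x * f x)" for p
  define A where "A p = (LINT x|lborel. indicator (cell h p) x * (f x)\<^sup>2)" for p
  define G where "G = (LINT x|lborel. (norm (gradient f x))\<^sup>2)"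
  have int_f: "integrable lborel f" by (rule integrable_compact_support[OF fcont K f0])
  have int_f2: "integrable lborel (\<lambda>x. (f x)\<^sup>2)"
    by (rule integrable_compact_support[OF _ K]) (auto intro!: continuous_intros fcont simp: f0)
  have int_g: "integrable lborel (\<lambda>x. (norm (gradient f x))\<^sup>2)"
    by (rule integrable_compact_support[OF _ K])
      (auto intro!: continuous_intros gcont simp: compactly_supported_C1_gradient_0[OF f])
  have G: "(\<integral>\<^sup>+x. ennreal ((norm (gradient f x))\<^sup>2) \<partial>lborel) = ennreal G"
    unfolding G_def by (rule nn_integral_eq_integral[OF int_g]) simp
  have G_nonneg: "0 \<le> G" unfolding G_def by simp
  have em: "emeasure lborel (cell h p) = ennreal v" if "p \<in> N" for p
  proof -
    have "p \<in> range (cell_corner h)" using that N_corner by blast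
    then show ?thesis using emeasure_cell[OF h] by (auto simp: v_def)
  qed
  note var = cell_variance[OF cell_borel em less_imp_le[OF v] int_f int_f2, folded s_def A_def]
  have "ennreal (\<Sum>p\<in>N. 2 * v * A p - 2 * (s p)\<^sup>2) = (\<Sum>p\<in>N. ennreal (2 * v * A p - 2 * (s p)\<^sup>2))"
    by (rule sum_ennreal[symmetric]) (rule var(2))
  also have "\<dots> = (\<Sum>p\<in>N. \<integral>\<^sup>+x. \<integral>\<^sup>+y. ennreal (indicator (cell h p) x * indicator (cell h p) y * (f y - f x)\<^sup>2) \<partial>lborel \<partial>lborel)"
    by (rule sum.cong[OF refl]) (rule var(1)[symmetric])
  also have "\<dots> = (\<integral>\<^sup>+x. (\<Sum>p\<in>N. \<integral>\<^sup>+y. ennreal (indicator (cell h p) x * indicator (cell h p) y * (f y - f x)\<^sup>2) \<partial>lborel) \<partial>lborel)"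
    by (rule nn_integral_sum[symmetric]) measurable
  also have "\<dots> = (\<integral>\<^sup>+x. \<integral>\<^sup>+y. (\<Sum>p\<in>N. ennreal (indicator (cell h p) x * indicator (cell h p) y * (f y - f x)\<^sup>2)) \<partial>lborel \<partial>lborel)"
    by (intro nn_integral_cong nn_integral_sum[symmetric]) measurable
  \<comment> \<open>Two points of one cell differ by a vector in \<open>C\<close>, and each point
    lies in a single cell, so at most one summand is nonzero.\<close>
  also have "\<dots> \<le> (\<integral>\<^sup>+x. \<integral>\<^sup>+y. ennreal (indicator C (y - x) * (f y - f x)\<^sup>2) \<partial>lborel \<partial>lborel)"
  proof (intro nn_integral_mono)
    fix x y
    let ?t = "\<lambda>p. ennreal (indicator (cell h p) x * indicator (cell h p) y * (f y - f x)\<^sup>2)"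
    have "(\<Sum>p\<in>N. ?t p) = (\<Sum>p\<in>N. if p = cell_corner h x then ?t p else 0)"
      by (rule sum.cong) (auto simp: cell_def)
    also have "\<dots> \<le> ?t (cell_corner h x)" using N(1) by simp
    also have "\<dots> \<le> ennreal (indicator C (y - x) * (f y - f x)\<^sup>2)"
    proof (cases "cell_corner h y = cell_corner h x")
      case True
      have "y - x \<in> C"
        unfolding C_def mem_box
      proof
        fix i :: 'a assume i: "i \<in> Basis"
        then show "(- (h *\<^sub>R One)) \<bullet> i \<le> (y - x) \<bullet> i \<and> (y - x) \<bullet> i \<le> (h *\<^sub>R One) \<bullet> i"
          using cell_corner_bounds[OF h i, of x] cell_corner_bounds[OF h i, of y] True
          by (simp add: inner_diff_left)
      qed
      then show ?thesis by (simp add: cell_def True)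
    qed (simp add: cell_def)
    finally show "(\<Sum>p\<in>N. ?t p) \<le> ennreal (indicator C (y - x) * (f y - f x)\<^sup>2)" .
  qed
  also have "\<dots> \<le> ennreal ((2 * h) ^ DIM('a) * (DIM('a) * h\<^sup>2)) * ennreal G"
    using short_increments_estimate[OF f h] unfolding C_def G .
  also have "\<dots> = ennreal ((2 * h) ^ DIM('a) * (DIM('a) * h\<^sup>2) * G)"
    using h G_nonneg by (simp add: ennreal_mult)
  finally have "(\<Sum>p\<in>N. 2 * v * A p - 2 * (s p)\<^sup>2) \<le> (2 * h) ^ DIM('a) * (DIM('a) * h\<^sup>2) * G"
    using h G_nonneg by (subst (asm) ennreal_le_iff) auto
  moreover have "(\<Sum>p\<in>N. 2 * v * A p - 2 * (s p)\<^sup>2) = (2 * v) * ((\<Sum>p\<in>N. A p) - (\<Sum>p\<in>N. (s p)\<^sup>2 / v))"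
    using v by (simp add: sum_subtractf sum_distrib_left right_diff_distrib)
  \<comment> \<open>Both sides carry the factor \<open>2 * v\<close>, twice the volume of a cell.
    Dividing by it leaves a constant of order \<open>h^2\<close>, which can be made arbitrarily
    small.\<close>
  moreover have "(2 * h) ^ DIM('a) * (DIM('a) * h\<^sup>2) * G = (2 * v) * ((2 ^ DIM('a) * DIM('a) * h\<^sup>2 / 2) * G)"
    by (simp add: v_def power_mult_distrib)
  ultimately have "(2 * v) * ((\<Sum>p\<in>N. A p) - (\<Sum>p\<in>N. (s p)\<^sup>2 / v)) \<le> (2 * v) * ((2 ^ DIM('a) * DIM('a) * h\<^sup>2 / 2) * G)"
    by (simp only:)
  then have "(\<Sum>p\<in>N. A p) \<le> (2 ^ DIM('a) * DIM('a) * h\<^sup>2 / 2) * G + (\<Sum>p\<in>N. (s p)\<^sup>2 / v)"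
    using v by (subst (asm) mult_le_cancel_left_pos) auto
  moreover have "(\<Sum>p\<in>N. A p) = (LINT x|lborel. (f x)\<^sup>2)"
  proof -
    have "(\<Sum>p\<in>N. A p) = (LINT x|lborel. (\<Sum>p\<in>N. indicator (cell h p) x * (f x)\<^sup>2))"
      unfolding A_def
      by (rule Bochner_Integration.integral_sum[symmetric])
        (use integrable_mult_indicator[OF _ int_f2] cell_borel in simp)
    also have "\<dots> = (LINT x|lborel. (f x)\<^sup>2)"
    proof (rule Bochner_Integration.integral_cong[OF refl])
      fix x
      have "(\<Sum>p\<in>N. indicator (cell h p) x * (f x)\<^sup>2) = (\<Sum>p\<in>N. if p = cell_corner h x then (f x)\<^sup>2 else 0)"
        by (rule sum.cong) (auto simp: cell_def)
      also have "\<dots> = (f x)\<^sup>2"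
      proof (cases "f x = 0")
        case False
        then have "cell_corner h x \<in> N" using f0 N(2) by blast
        then show ?thesis using N(1) by simp
      qed (auto intro!: sum.neutral)
      finally show "(\<Sum>p\<in>N. indicator (cell h p) x * (f x)\<^sup>2) = (f x)\<^sup>2" .
    qed
    finally show ?thesis .
  qed
  ultimately show ?thesis by (simp add: G_def s_def v_def)
qed

subsection \<open>The form domain of the Dirichlet Laplacian\<close>

lemma subspace_closure:
  fixes S :: "'v::real_normed_vector set"
  assumes "subspace S"
  shows "subspace (closure S)"
proof (rule subspaceI)
  show "0 \<in> closure S" using subspace_0[OF assms] closure_subset by blast
next
  fix x y assume "x \<in> closure S" "y \<in> closure S"
  then obtain f g where f: "\<And>n. f n \<in> S" "f \<longlonglongrightarrow> x" and g: "\<And>n. g n \<in> S" "g \<longlonglongrightarrow> y"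
    unfolding closure_sequential by metis
  have "f n + g n \<in> S" for n using f g by (intro subspace_add[OF assms])
  with tendsto_add[OF f(2) g(2)] show "x + y \<in> closure S"
    unfolding closure_sequential by (intro exI[of _ "\<lambda>n. f n + g n"]) simp
next
  fix c x assume "x \<in> closure S"
  then obtain f where f: "\<And>n. f n \<in> S" "f \<longlonglongrightarrow> x" unfolding closure_sequential by metis
  have "c *\<^sub>R f n \<in> S" for n using f by (intro subspace_scale[OF assms])
  with tendsto_scaleR[OF tendsto_const f(2), of c] show "c *\<^sub>R x \<in> closure S"
    unfolding closure_sequential by (intro exI[of _ "\<lambda>n. c *\<^sub>R f n"]) simp
qed

definition test_graph :: "'a::euclidean_space set \<Rightarrow> (('a, real) l2fun \<times> ('a, 'a) l2fun) set" where
  "test_graph \<Omega> = {(l2_of \<Omega> \<phi>, l2_of \<Omega> (gradient \<phi>)) | \<phi>. test_function \<Omega> \<phi>}"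

text \<open>The form domain \<open>H\<^sup>1\<^sub>0(\<Omega>)\<close>, represented by the graph of the weak gradient.\<close>

definition form_domain :: "'a::euclidean_space set \<Rightarrow> (('a, real) l2fun \<times> ('a, 'a) l2fun) set" where
  "form_domain \<Omega> = closure (test_graph \<Omega>)"

lemma test_function_in_form_domain:
  assumes "test_function \<Omega> \<phi>"
  shows "(l2_of \<Omega> \<phi>, l2_of \<Omega> (gradient \<phi>)) \<in> form_domain \<Omega>"
  unfolding form_domain_def
  by (rule closure_subset[THEN subsetD]) (use assms in \<open>auto simp: test_graph_def\<close>)

lemma form_domain_closed: "closed (form_domain \<Omega>)"
  by (simp add: form_domain_def)

text \<open>Density in the shape of an induction rule. Through it the product rule for coordinates,
  integration by parts, the weak eigenvalue equation and the cell estimate pass from test functions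
  to the form domain.\<close>

lemma form_domain_induct:
  assumes "p \<in> form_domain \<Omega>" and "closed {p. P p}"
    and "\<And>\<phi>. test_function \<Omega> \<phi> \<Longrightarrow> P (l2_of \<Omega> \<phi>, l2_of \<Omega> (gradient \<phi>))"
  shows "P p"
proof -
  have "form_domain \<Omega> \<subseteq> {p. P p}"
    unfolding form_domain_def
    by (rule closure_minimal) (use assms in \<open>auto simp: test_graph_def\<close>)
  then show ?thesis using assms(1) by blast
qed

abbreviation "Xop \<Omega> i \<equiv> pointwise_op (coord_multiplier \<Omega> i)"
abbreviation "Jop i \<equiv> pointwise_op (\<lambda>x c. c *\<^sub>R i)"
abbreviation "Dop i \<equiv> pointwise_op (\<lambda>x v. v \<bullet> i)"

lemmas Jop_bounded_linear = bounded_linear_pointwise_op[OF bounded_multiplier_scaleR_vector]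
lemmas Dop_bounded_linear = bounded_linear_pointwise_op[OF bounded_multiplier_inner_vector]

lemma Jop_adjoint: "Jop i v \<bullet> h = v \<bullet> Dop i h"
  by (rule inner_pointwise_op[OF bounded_multiplier_scaleR_vector bounded_multiplier_inner_vector])
    (simp add: inner_commute)

lemma integral_lebesgue_eq_lborel:
  fixes f :: "'a::euclidean_space \<Rightarrow> real"
  shows "f \<in> borel_measurable borel \<Longrightarrow> (LINT x|lebesgue. f x) = (LINT x|lborel. f x)"
  by (rule integral_completion) simp

text \<open>Tested against the whole form domain, so that other eigenvectors and coordinate
  multiples of eigenvectors are admissible in the equation. The gradient \<open>h\<close> is carried
  along explicitly.\<close>

definition eigenpair ::
    "'a::euclidean_space set \<Rightarrow> real \<Rightarrow> ('a, real) l2fun \<Rightarrow> ('a, 'a) l2fun \<Rightarrow> bool" where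
  "eigenpair \<Omega> \<mu> v h \<longleftrightarrow> (v, h) \<in> form_domain \<Omega> \<and>
     (\<forall>w k. (w, k) \<in> form_domain \<Omega> \<longrightarrow> h \<bullet> k = \<mu> * (v \<bullet> w))"

section \<open>The form domain as \<open>H10\<close>, eigenfunctions as eigenpairs\<close>

context
  fixes \<Omega> :: "'a::euclidean_space set"
  assumes opn: "open \<Omega>"
begin

lemma domain_lebesgue: "\<Omega> \<in> sets lebesgue"
  using opn by (simp add: borel_open sets_completionI_sets)

lemma test_function_C1_obtain:
  assumes "test_function \<Omega> \<phi>"
  obtains K where "compactly_supported_C1 K \<phi>" "K \<subseteq> \<Omega>"
  using test_function_C1[OF assms] test_function_support(3)[OF assms] by blast

lemma test_function_square_integrable:
  assumes "test_function \<Omega> \<phi>"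
  shows "square_integrable \<phi>" "square_integrable (gradient \<phi>)"
    "l2_of \<Omega> \<phi> = abs_l2fun \<phi>" "l2_of \<Omega> (gradient \<phi>) = abs_l2fun (gradient \<phi>)"
    "\<phi> \<in> L2 \<Omega>" "gradient \<phi> \<in> L2 \<Omega>"
proof -
  obtain K where \<phi>: "compactly_supported_C1 K \<phi>" and K: "K \<subseteq> \<Omega>" by (rule test_function_C1_obtain[OF assms])
  note D = compactly_supported_C1D[OF \<phi>]
  show 1: "square_integrable \<phi>"
    by (rule square_integrable_compact_support[OF compactly_supported_C1_continuous[OF \<phi>] D(1,2)])
  show 2: "square_integrable (gradient \<phi>)"
    by (rule square_integrable_compact_support[OF D(3,1) compactly_supported_C1_gradient_0[OF \<phi>]])
  have 3: "(\<lambda>x. indicator \<Omega> x *\<^sub>R \<phi> x) = \<phi>"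
  proof
    show "indicator \<Omega> x *\<^sub>R \<phi> x = \<phi> x" for x
      using D(2)[of x] K by (cases "x \<in> K") (auto simp: indicator_def)
  qed
  have 4: "(\<lambda>x. indicator \<Omega> x *\<^sub>R gradient \<phi> x) = gradient \<phi>"
  proof
    show "indicator \<Omega> x *\<^sub>R gradient \<phi> x = gradient \<phi> x" for x
      using compactly_supported_C1_gradient_0[OF \<phi>, of x] K by (cases "x \<in> K") (auto simp: indicator_def)
  qed
  show "l2_of \<Omega> \<phi> = abs_l2fun \<phi>" unfolding l2_of_def 3 ..
  show "l2_of \<Omega> (gradient \<phi>) = abs_l2fun (gradient \<phi>)" unfolding l2_of_def 4 ..
  show "\<phi> \<in> L2 \<Omega>" using 1 unfolding L2_iff_square_integrable[OF domain_lebesgue] 3 .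
  show "gradient \<phi> \<in> L2 \<Omega>" using 2 unfolding L2_iff_square_integrable[OF domain_lebesgue] 4 .
qed

lemma form_domain_subspace: "subspace (form_domain \<Omega>)"
  unfolding form_domain_def
proof (rule subspace_closure, rule subspaceI)
  note l2 = l2_of_add[OF domain_lebesgue] l2_of_scaleR[OF domain_lebesgue]
  show "0 \<in> test_graph \<Omega>"
  proof -
    have "gradient (\<lambda>x::'a. 0) = (\<lambda>x. 0)" by (rule ext, rule gradient_eqI, rule GDERIV_const)
    then show ?thesis
      unfolding test_graph_def using test_function_zero[of \<Omega>]
      by (auto simp: l2_of_0 zero_prod_def intro!: exI[of _ "\<lambda>x. 0"])
  qed
  fix p q :: "('a, real) l2fun \<times> ('a, 'a) l2fun" and c :: real
  assume "p \<in> test_graph \<Omega>"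
  then obtain \<phi> where \<phi>: "test_function \<Omega> \<phi>" and p: "p = (l2_of \<Omega> \<phi>, l2_of \<Omega> (gradient \<phi>))"
    unfolding test_graph_def by blast
  note s = test_function_square_integrable[OF \<phi>]
  have "c *\<^sub>R p = (l2_of \<Omega> (\<lambda>x. c * \<phi> x), l2_of \<Omega> (gradient (\<lambda>x. c * \<phi> x)))"
    using l2(2)[OF s(5), of c] l2(2)[OF s(6), of c] by (simp add: p test_function_scale(2)[OF \<phi>])
  then show "c *\<^sub>R p \<in> test_graph \<Omega>"
    unfolding test_graph_def using test_function_scale(1)[OF \<phi>, of c] by blast
  assume "q \<in> test_graph \<Omega>"
  then obtain \<psi> where \<psi>: "test_function \<Omega> \<psi>" and q: "q = (l2_of \<Omega> \<psi>, l2_of \<Omega> (gradient \<psi>))"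
    unfolding test_graph_def by blast
  note t = test_function_square_integrable[OF \<psi>]
  have "p + q = (l2_of \<Omega> (\<lambda>x. \<phi> x + \<psi> x), l2_of \<Omega> (gradient (\<lambda>x. \<phi> x + \<psi> x)))"
    by (simp add: p q test_function_add(2)[OF \<phi> \<psi>] l2(1)[OF s(5) t(5)] l2(1)[OF s(6) t(6)])
  then show "p + q \<in> test_graph \<Omega>"
    unfolding test_graph_def using test_function_add(1)[OF \<phi> \<psi>] by blast
qed

lemma test_function_by_parts:
  assumes "test_function \<Omega> \<phi>" "test_function \<Omega> \<psi>"
  shows "l2_of \<Omega> \<phi> \<bullet> Dop i (l2_of \<Omega> (gradient \<psi>)) = - (Dop i (l2_of \<Omega> (gradient \<phi>)) \<bullet> l2_of \<Omega> \<psi>)"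
proof -
  note s = test_function_square_integrable[OF assms(1)] and t = test_function_square_integrable[OF assms(2)]
  obtain K where \<phi>: "compactly_supported_C1 K \<phi>" by (rule test_function_C1_obtain[OF assms(1)])
  obtain L where \<psi>: "compactly_supported_C1 L \<psi>" by (rule test_function_C1_obtain[OF assms(2)])
  have m: "\<phi> \<in> borel_measurable borel" "\<psi> \<in> borel_measurable borel"
    "gradient \<phi> \<in> borel_measurable borel" "gradient \<psi> \<in> borel_measurable borel"
    by (intro borel_measurable_continuous_onI compactly_supported_C1_continuous[OF \<phi>]
        compactly_supported_C1_continuous[OF \<psi>] compactly_supported_C1D(3)[OF \<phi>] compactly_supported_C1D(3)[OF \<psi>])+
  note sq = square_integrable_multiplier[OF bounded_multiplier_inner_vector]
  have "l2_of \<Omega> \<phi> \<bullet> Dop i (l2_of \<Omega> (gradient \<psi>)) = (LINT x|lborel. \<phi> x * (gradient \<psi> x \<bullet> i))"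
    unfolding s(3) t(4) pointwise_op_abs[OF bounded_multiplier_inner_vector t(2)]
      inner_abs_l2fun[OF s(1) sq[OF t(2)]]
    by (subst integral_lebesgue_eq_lborel) (use m in auto)
  moreover have "Dop i (l2_of \<Omega> (gradient \<phi>)) \<bullet> l2_of \<Omega> \<psi> = (LINT x|lborel. (gradient \<phi> x \<bullet> i) * \<psi> x)"
    unfolding s(4) t(3) pointwise_op_abs[OF bounded_multiplier_inner_vector s(2)]
      inner_abs_l2fun[OF sq[OF s(2)] t(1)]
    by (subst integral_lebesgue_eq_lborel) (use m in auto)
  ultimately show ?thesis using integral_by_parts_C1[OF \<phi> \<psi>, of i] by simp
qed

lemma form_domain_by_parts:
  assumes "(v, h) \<in> form_domain \<Omega>" "(w, k) \<in> form_domain \<Omega>"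
  shows "v \<bullet> Dop i k = - (Dop i h \<bullet> w)"
proof -
  \<comment> \<open>The closure is taken in one argument at a time: here the first is still a test
    function while the second is already general.\<close>
  have *: "l2_of \<Omega> \<phi> \<bullet> Dop i (snd p) = - (Dop i (l2_of \<Omega> (gradient \<phi>)) \<bullet> fst p)"
    if "test_function \<Omega> \<phi>" "p \<in> form_domain \<Omega>" for \<phi> p
    using that(2)
  proof (rule form_domain_induct)
    show "closed {p. l2_of \<Omega> \<phi> \<bullet> Dop i (snd p) = - (Dop i (l2_of \<Omega> (gradient \<phi>)) \<bullet> fst p)}"
      by (intro closed_Collect_eq continuous_intros bounded_linear.continuous_on[OF Dop_bounded_linear])
  qed (simp add: test_function_by_parts[OF that(1)])
  have "fst p \<bullet> Dop i k = - (Dop i (snd p) \<bullet> w)" if "p \<in> form_domain \<Omega>" for p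
    using that
  proof (rule form_domain_induct)
    show "closed {p. fst p \<bullet> Dop i k = - (Dop i (snd p) \<bullet> w)}"
      by (intro closed_Collect_eq continuous_intros bounded_linear.continuous_on[OF Dop_bounded_linear])
  qed (use *[OF _ assms(2)] in simp)
  from this[OF assms(1)] show ?thesis by simp
qed

lemma bounded_multiplier_indicator:
  "bounded_multiplier (\<lambda>x v. indicator \<Omega> x *\<^sub>R (v :: 'b::euclidean_space))"
  unfolding bounded_multiplier_def using domain_lebesgue
  by (auto intro!: linearI exI[of _ 1] simp: scaleR_add_right indicator_def)

lemma pointwise_op_indicator:
  fixes f :: "'a \<Rightarrow> 'b::euclidean_space"
  assumes "f \<in> L2 \<Omega>"
  shows "pointwise_op (\<lambda>x v. indicator \<Omega> x *\<^sub>R v) (l2_of \<Omega> f) = l2_of \<Omega> f"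
proof -
  have "(\<lambda>x. indicator \<Omega> x *\<^sub>R (indicator \<Omega> x *\<^sub>R f x)) = (\<lambda>x. indicator \<Omega> x *\<^sub>R f x)"
    by (simp add: fun_eq_iff indicator_def)
  then show ?thesis
    using pointwise_op_l2_of[OF bounded_multiplier_indicator domain_lebesgue assms] by (simp add: l2_of_def)
qed

text \<open>Multiplication by the indicator of \<Omega> is continuous and fixes test functions and
  their gradients, hence their limits. Elements of the form domain thus lose nothing when their
  representatives are restricted to \<Omega>.\<close>

lemma form_domain_indicator:
  assumes "(v, h) \<in> form_domain \<Omega>"
  shows "l2_of \<Omega> (rep_l2fun v) = v" "l2_of \<Omega> (rep_l2fun h) = h"
proof -
  have "pointwise_op (\<lambda>x v. indicator \<Omega> x *\<^sub>R v) (fst p) = fst p \<and>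
      pointwise_op (\<lambda>x v. indicator \<Omega> x *\<^sub>R v) (snd p) = snd p" if "p \<in> form_domain \<Omega>" for p
    using that
  proof (rule form_domain_induct)
    show "closed {p :: ('a, real) l2fun \<times> ('a, 'a) l2fun. pointwise_op (\<lambda>x v. indicator \<Omega> x *\<^sub>R v) (fst p) = fst p \<and>
      pointwise_op (\<lambda>x v. indicator \<Omega> x *\<^sub>R v) (snd p) = snd p}"
      by (intro closed_Collect_conj closed_Collect_eq continuous_intros
          bounded_linear.continuous_on[OF bounded_linear_pointwise_op[OF bounded_multiplier_indicator]])
  qed (simp only: fst_conv snd_conv pointwise_op_indicator test_function_square_integrable(5,6) simp_thms)
  from this[OF assms] show "l2_of \<Omega> (rep_l2fun v) = v" "l2_of \<Omega> (rep_l2fun h) = h"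
    by (simp_all add: pointwise_op_def l2_of_def)
qed

lemma L2_rep: "rep_l2fun F \<in> L2 \<Omega>"
proof -
  have "square_integrable (\<lambda>x. indicator \<Omega> x *\<^sub>R rep_l2fun F x)"
    by (rule square_integrable_bound[OF rep_l2fun(1)[of F], of _ 1])
      (use domain_lebesgue square_integrable_measurable[OF rep_l2fun(1)[of F]] in \<open>auto simp: indicator_def\<close>)
  then show ?thesis using L2_iff_square_integrable[OF domain_lebesgue] by blast
qed

lemma weak_gradient_iff:
  assumes "u \<in> L2 \<Omega>" "g \<in> L2 \<Omega>" "test_function \<Omega> \<phi>"
  shows "(LINT x|lebesgue_on \<Omega>. u x * (gradient \<phi> x \<bullet> i)) = l2_of \<Omega> u \<bullet> Dop i (l2_of \<Omega> (gradient \<phi>))"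
    and "(LINT x|lebesgue_on \<Omega>. (g x \<bullet> i) * \<phi> x) = Dop i (l2_of \<Omega> g) \<bullet> l2_of \<Omega> \<phi>"
proof -
  have L2D: "(\<lambda>x. f x \<bullet> i) \<in> L2 \<Omega>" if "f \<in> L2 \<Omega>" for f
    using that square_integrable_multiplier[OF bounded_multiplier_inner_vector[of i]]
    unfolding L2_iff_square_integrable[OF domain_lebesgue] by fastforce
  note P = pointwise_op_l2_of[OF bounded_multiplier_inner_vector domain_lebesgue]
  note s = test_function_square_integrable[OF assms(3)]
  show "(LINT x|lebesgue_on \<Omega>. u x * (gradient \<phi> x \<bullet> i)) = l2_of \<Omega> u \<bullet> Dop i (l2_of \<Omega> (gradient \<phi>))"
    by (simp add: P[OF s(6)] inner_l2_of[OF domain_lebesgue assms(1) L2D[OF s(6)]])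
  show "(LINT x|lebesgue_on \<Omega>. (g x \<bullet> i) * \<phi> x) = Dop i (l2_of \<Omega> g) \<bullet> l2_of \<Omega> \<phi>"
    by (simp add: P[OF assms(2)] inner_l2_of[OF domain_lebesgue L2D[OF assms(2)] s(5)])
qed

lemma H10_distance:
  assumes "u \<in> L2 \<Omega>" "g \<in> L2 \<Omega>" "test_function \<Omega> \<phi>"
  shows "(LINT x|lebesgue_on \<Omega>. (u x - \<phi> x)\<^sup>2) + (LINT x|lebesgue_on \<Omega>. (norm (g x - gradient \<phi> x))\<^sup>2)
    = (dist (l2_of \<Omega> \<phi>, l2_of \<Omega> (gradient \<phi>)) (l2_of \<Omega> u, l2_of \<Omega> g))\<^sup>2"
proof -
  note s = test_function_square_integrable[OF assms(3)]
  have "(LINT x|lebesgue_on \<Omega>. (u x - \<phi> x)\<^sup>2) = (norm (l2_of \<Omega> u - l2_of \<Omega> \<phi>))\<^sup>2"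
    using norm_l2_of[OF domain_lebesgue L2_diff[OF domain_lebesgue assms(1) s(5)]]
    by (simp add: l2_of_diff[OF domain_lebesgue assms(1) s(5)])
  moreover have "(LINT x|lebesgue_on \<Omega>. (norm (g x - gradient \<phi> x))\<^sup>2) = (norm (l2_of \<Omega> g - l2_of \<Omega> (gradient \<phi>)))\<^sup>2"
    using norm_l2_of[OF domain_lebesgue L2_diff[OF domain_lebesgue assms(2) s(6)]]
    by (simp add: l2_of_diff[OF domain_lebesgue assms(2) s(6)])
  ultimately show ?thesis
    by (subst dist_commute) (simp add: dist_norm norm_Pair)
qed

lemma H10_imp_form_domain:
  assumes "H10_with_gradient \<Omega> u g"
  shows "(l2_of \<Omega> u, l2_of \<Omega> g) \<in> form_domain \<Omega>"
proof -
  have ug: "u \<in> L2 \<Omega>" "g \<in> L2 \<Omega>"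
    using assms by (auto simp: H10_with_gradient_def has_weak_gradient_def)
  obtain \<phi> where \<phi>: "\<And>n. test_function \<Omega> (\<phi> n)"
    and lim: "(\<lambda>n::nat. (LINT x|lebesgue_on \<Omega>. (u x - \<phi> n x)\<^sup>2) +
             (LINT x|lebesgue_on \<Omega>. (norm (g x - gradient (\<phi> n) x))\<^sup>2)) \<longlonglongrightarrow> 0"
    using assms unfolding H10_with_gradient_def by blast
  define p where "p n = (l2_of \<Omega> (\<phi> n), l2_of \<Omega> (gradient (\<phi> n)))" for n
  have "(\<lambda>n. (dist (p n) (l2_of \<Omega> u, l2_of \<Omega> g))\<^sup>2) \<longlonglongrightarrow> 0"
    using lim unfolding H10_distance[OF ug \<phi>] p_def .
  from tendsto_real_sqrt[OF this] have "p \<longlonglongrightarrow> (l2_of \<Omega> u, l2_of \<Omega> g)"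
    by (subst tendsto_dist_iff) simp
  moreover have "p n \<in> test_graph \<Omega>" for n unfolding p_def test_graph_def using \<phi> by blast
  ultimately show ?thesis unfolding form_domain_def closure_sequential by blast
qed

text \<open>A limit of graph points satisfies the definition of the weak gradient by integration by
  parts in the closure, and a sequence of graph points converging to it supplies the approximating
  test functions.\<close>

lemma form_domain_imp_H10:
  assumes "(v, h) \<in> form_domain \<Omega>"
  shows "H10_with_gradient \<Omega> (rep_l2fun v) (rep_l2fun h)"
  unfolding H10_with_gradient_def has_weak_gradient_def
proof (intro conjI allI impI ballI L2_rep)
  note r = form_domain_indicator[OF assms]
  fix \<phi> and i :: 'a assume \<phi>: "test_function \<Omega> \<phi>"
  have "(l2_of \<Omega> \<phi>, l2_of \<Omega> (gradient \<phi>)) \<in> form_domain \<Omega>"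
    by (rule test_function_in_form_domain[OF \<phi>])
  from form_domain_by_parts[OF assms this, of i]
  show "(LINT x|lebesgue_on \<Omega>. rep_l2fun v x * (gradient \<phi> x \<bullet> i)) =
        - (LINT x|lebesgue_on \<Omega>. (rep_l2fun h x \<bullet> i) * \<phi> x)"
    unfolding weak_gradient_iff(1)[OF L2_rep L2_rep \<phi>] weak_gradient_iff(2)[OF L2_rep L2_rep \<phi>] r .
next
  note r = form_domain_indicator[OF assms]
  obtain p where p: "\<And>n. p n \<in> test_graph \<Omega>" and lim: "p \<longlonglongrightarrow> (v, h)"
    using assms unfolding form_domain_def closure_sequential by metis
  have "\<exists>\<phi>. test_function \<Omega> \<phi> \<and> p n = (l2_of \<Omega> \<phi>, l2_of \<Omega> (gradient \<phi>))" for n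
    using p[of n] unfolding test_graph_def by blast
  then obtain \<phi> where \<phi>: "\<And>n. test_function \<Omega> (\<phi> n)"
    and p': "\<And>n. p n = (l2_of \<Omega> (\<phi> n), l2_of \<Omega> (gradient (\<phi> n)))" by metis
  have "(\<lambda>n. (dist (p n) (v, h))\<^sup>2) \<longlonglongrightarrow> 0\<^sup>2"
    using lim by (intro tendsto_power) (simp add: tendsto_dist_iff[symmetric])
  then have "(\<lambda>n. (LINT x|lebesgue_on \<Omega>. (rep_l2fun v x - \<phi> n x)\<^sup>2) +
             (LINT x|lebesgue_on \<Omega>. (norm (rep_l2fun h x - gradient (\<phi> n) x))\<^sup>2)) \<longlonglongrightarrow> 0"
    unfolding H10_distance[OF L2_rep L2_rep \<phi>] r p' by simp
  with \<phi> show "\<exists>\<phi>. (\<forall>n::nat. test_function \<Omega> (\<phi> n)) \<and>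
        (\<lambda>n. (LINT x|lebesgue_on \<Omega>. (rep_l2fun v x - \<phi> n x)\<^sup>2) +
             (LINT x|lebesgue_on \<Omega>. (norm (rep_l2fun h x - gradient (\<phi> n) x))\<^sup>2)) \<longlonglongrightarrow> 0" by blast
qed

text \<open>Both sides of the weak equation are continuous in the test pair, so it extends from test
  functions to their closure.\<close>

lemma eigenspace_imp_eigenpair:
  assumes "u \<in> dirichlet_eigenspace \<Omega> \<mu>"
  shows "u \<in> L2 \<Omega>" "\<exists>h. eigenpair \<Omega> \<mu> (l2_of \<Omega> u) h"
proof -
  obtain g where H: "H10_with_gradient \<Omega> u g" and f: "(\<lambda>x. \<mu> * u x) \<in> L2 \<Omega>"
    and weak: "\<And>\<phi>. test_function \<Omega> \<phi> \<Longrightarrow>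
      (LINT x|lebesgue_on \<Omega>. g x \<bullet> gradient \<phi> x) = (LINT x|lebesgue_on \<Omega>. \<mu> * u x * \<phi> x)"
    using assms unfolding dirichlet_eigenspace_def dirichlet_laplacian_def by blast
  show u: "u \<in> L2 \<Omega>" using H by (auto simp: H10_with_gradient_def has_weak_gradient_def)
  have g: "g \<in> L2 \<Omega>" using H by (auto simp: H10_with_gradient_def has_weak_gradient_def)
  have "l2_of \<Omega> g \<bullet> snd p = \<mu> * (l2_of \<Omega> u \<bullet> fst p)" if "p \<in> form_domain \<Omega>" for p
    using that
  proof (rule form_domain_induct)
    show "closed {p :: ('a, real) l2fun \<times> ('a, 'a) l2fun. l2_of \<Omega> g \<bullet> snd p = \<mu> * (l2_of \<Omega> u \<bullet> fst p)}"
      by (intro closed_Collect_eq continuous_intros)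
    fix \<phi> assume \<phi>: "test_function \<Omega> \<phi>"
    note s = test_function_square_integrable[OF \<phi>]
    show "l2_of \<Omega> g \<bullet> snd (l2_of \<Omega> \<phi>, l2_of \<Omega> (gradient \<phi>)) = \<mu> * (l2_of \<Omega> u \<bullet> fst (l2_of \<Omega> \<phi>, l2_of \<Omega> (gradient \<phi>)))"
      using weak[OF \<phi>]
      by (simp add: inner_l2_of[OF domain_lebesgue g s(6)] inner_l2_of[OF domain_lebesgue u s(5)] mult.assoc)
  qed
  then show "\<exists>h. eigenpair \<Omega> \<mu> (l2_of \<Omega> u) h"
    unfolding eigenpair_def using H10_imp_form_domain[OF H] by fastforce
qed

lemma eigenpair_imp_eigenspace:
  assumes "eigenpair \<Omega> \<mu> v h"
  shows "rep_l2fun v \<in> dirichlet_eigenspace \<Omega> \<mu>" "l2_of \<Omega> (rep_l2fun v) = v"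
proof -
  have vh: "(v, h) \<in> form_domain \<Omega>" using assms by (simp add: eigenpair_def)
  note r = form_domain_indicator[OF vh]
  show "l2_of \<Omega> (rep_l2fun v) = v" by (rule r(1))
  have "(LINT x|lebesgue_on \<Omega>. rep_l2fun h x \<bullet> gradient \<phi> x) = (LINT x|lebesgue_on \<Omega>. \<mu> * rep_l2fun v x * \<phi> x)"
    if \<phi>: "test_function \<Omega> \<phi>" for \<phi>
  proof -
    note s = test_function_square_integrable[OF \<phi>]
    have "(l2_of \<Omega> \<phi>, l2_of \<Omega> (gradient \<phi>)) \<in> form_domain \<Omega>"
      by (rule test_function_in_form_domain[OF \<phi>])
    then have "h \<bullet> l2_of \<Omega> (gradient \<phi>) = \<mu> * (v \<bullet> l2_of \<Omega> \<phi>)" using assms by (simp add: eigenpair_def)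
    then show ?thesis
      using inner_l2_of[OF domain_lebesgue L2_rep s(6), of h] inner_l2_of[OF domain_lebesgue L2_rep s(5), of v]
      by (simp add: r mult.assoc)
  qed
  moreover have "(\<lambda>x. \<mu> * rep_l2fun v x) \<in> L2 \<Omega>"
    using L2_scaleR[OF domain_lebesgue L2_rep[of v], of \<mu>] by simp
  ultimately show "rep_l2fun v \<in> dirichlet_eigenspace \<Omega> \<mu>"
    unfolding dirichlet_eigenspace_def dirichlet_laplacian_def using form_domain_imp_H10[OF vh] by blast
qed

end

section \<open>Coordinates and partial derivatives on the form domain\<close>

lemma test_function_coordinate:
  fixes \<Omega> :: "'a::euclidean_space set"
  assumes \<Omega>: "open \<Omega>" "bounded \<Omega>" and i: "i \<in> Basis" and \<phi>: "test_function \<Omega> \<phi>"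
  shows "(Xop \<Omega> i (l2_of \<Omega> \<phi>), Jop i (l2_of \<Omega> \<phi>) + Xop \<Omega> i (l2_of \<Omega> (gradient \<phi>))) \<in> form_domain \<Omega>"
proof -
  note leb = domain_lebesgue[OF \<Omega>(1)]
  note s = test_function_square_integrable[OF \<Omega>(1) \<phi>]
  note t = test_function_mult_coordinate[OF \<phi> i]
  have X: "Xop \<Omega> i (l2_of \<Omega> f) = l2_of \<Omega> (\<lambda>x. (x \<bullet> i) *\<^sub>R f x)" "(\<lambda>x. (x \<bullet> i) *\<^sub>R f x) \<in> L2 \<Omega>"
    if "f \<in> L2 \<Omega>" for f :: "'a \<Rightarrow> 'b::euclidean_space"
  proof -
    have eq: "indicator \<Omega> x *\<^sub>R coord_multiplier \<Omega> i x (f x) = indicator \<Omega> x *\<^sub>R ((x \<bullet> i) *\<^sub>R f x)"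
      "coord_multiplier \<Omega> i x (indicator \<Omega> x *\<^sub>R f x) = indicator \<Omega> x *\<^sub>R ((x \<bullet> i) *\<^sub>R f x)" for x
      by (auto simp: coord_multiplier_def indicator_def)
    show "Xop \<Omega> i (l2_of \<Omega> f) = l2_of \<Omega> (\<lambda>x. (x \<bullet> i) *\<^sub>R f x)"
      unfolding pointwise_op_l2_of[OF bounded_multiplier_coord[OF \<Omega>(2) leb] leb that]
      unfolding l2_of_def eq ..
    show "(\<lambda>x. (x \<bullet> i) *\<^sub>R f x) \<in> L2 \<Omega>"
      using square_integrable_multiplier[OF bounded_multiplier_coord[OF \<Omega>(2) leb, of i], of "\<lambda>x. indicator \<Omega> x *\<^sub>R f x"] that
      unfolding L2_iff_square_integrable[OF leb] eq by blast
  qed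
  have J: "Jop i (l2_of \<Omega> \<phi>) = l2_of \<Omega> (\<lambda>x. \<phi> x *\<^sub>R i)"
    by (rule pointwise_op_l2_of[OF bounded_multiplier_scaleR_vector leb s(5)])
  have JL: "(\<lambda>x. \<phi> x *\<^sub>R i) \<in> L2 \<Omega>"
    using square_integrable_multiplier[OF bounded_multiplier_scaleR_vector[of i], of "\<lambda>x. indicator \<Omega> x *\<^sub>R \<phi> x"] s(5)
    unfolding L2_iff_square_integrable[OF leb] by simp
  have "Xop \<Omega> i (l2_of \<Omega> \<phi>) = l2_of \<Omega> (\<lambda>x. (x \<bullet> i) * \<phi> x)"
    using X(1)[OF s(5)] by simp
  moreover have "Jop i (l2_of \<Omega> \<phi>) + Xop \<Omega> i (l2_of \<Omega> (gradient \<phi>)) = l2_of \<Omega> (gradient (\<lambda>x. (x \<bullet> i) * \<phi> x))"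
    unfolding J X(1)[OF s(6)] t(2) by (rule l2_of_add[OF leb JL X(2)[OF s(6)], symmetric])
  ultimately show ?thesis using test_function_in_form_domain[OF t(1)] by simp
qed

lemma form_domain_coordinate:
  fixes \<Omega> :: "'a::euclidean_space set"
  assumes \<Omega>: "open \<Omega>" "bounded \<Omega>" and i: "i \<in> Basis" and vh: "(v, h) \<in> form_domain \<Omega>"
  shows "(Xop \<Omega> i v, Jop i v + Xop \<Omega> i h) \<in> form_domain \<Omega>"
proof -
  note bl = bounded_linear_pointwise_op[OF bounded_multiplier_coord[OF \<Omega>(2) domain_lebesgue[OF \<Omega>(1)]]]
  define T where "T p = (Xop \<Omega> i (fst p), Jop i (fst p) + Xop \<Omega> i (snd p))"
    for p :: "('a, real) l2fun \<times> ('a, 'a) l2fun"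
  have "T p \<in> form_domain \<Omega>" if "p \<in> form_domain \<Omega>" for p
    using that
  proof (rule form_domain_induct)
    have "continuous_on UNIV T"
      unfolding T_def by (intro continuous_intros bounded_linear.continuous_on[OF bl]
          bounded_linear.continuous_on[OF Jop_bounded_linear])
    from closed_vimage[OF form_domain_closed this, of \<Omega>] show "closed {p. T p \<in> form_domain \<Omega>}"
      unfolding vimage_def .
  qed (use test_function_coordinate[OF \<Omega> i] in \<open>simp add: T_def\<close>)
  from this[OF vh] show ?thesis by (simp add: T_def)
qed

lemma Dop_coordinate:
  fixes \<Omega> :: "'a::euclidean_space set" and v :: "('a, real) l2fun" and h :: "('a, 'a) l2fun"
  assumes \<Omega>: "open \<Omega>" "bounded \<Omega>" and i: "i \<in> Basis"
  shows "Dop i (Jop i v + Xop \<Omega> i h) = v + Xop \<Omega> i (Dop i h)"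
proof -
  note bm = bounded_multiplier_coord[OF \<Omega>(2) domain_lebesgue[OF \<Omega>(1)], of i]
    bounded_multiplier_scaleR_vector[of i] bounded_multiplier_inner_vector[of i]
  obtain f where f: "v = abs_l2fun f" "square_integrable f" by (rule l2fun_cases)
  obtain g where g: "h = abs_l2fun g" "square_integrable g" by (rule l2fun_cases)
  note sq = bm[THEN square_integrable_multiplier]
  have "Dop i (Jop i v + Xop \<Omega> i h) = abs_l2fun (\<lambda>x. (f x *\<^sub>R i + coord_multiplier \<Omega> i x (g x)) \<bullet> i)"
    unfolding f(1) g(1) pointwise_op_abs[OF bm(2) f(2)] pointwise_op_abs[OF bm(1) g(2)]
      plus_abs_l2fun[OF sq(2)[OF f(2)] sq(1)[OF g(2)]]
    by (rule pointwise_op_abs[OF bm(3) square_integrable_add[OF sq(2)[OF f(2)] sq(1)[OF g(2)]]])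
  also have "\<dots> = abs_l2fun (\<lambda>x. f x + coord_multiplier \<Omega> i x (g x \<bullet> i))"
    using i by (simp add: inner_add_left coord_multiplier_def inner_Basis)
  also have "\<dots> = v + Xop \<Omega> i (Dop i h)"
    unfolding f(1) g(1) pointwise_op_abs[OF bm(3) g(2)] pointwise_op_abs[OF bm(1) sq(3)[OF g(2)]]
    by (rule plus_abs_l2fun[OF f(2) sq(1)[OF sq(3)[OF g(2)]], symmetric])
  finally show ?thesis .
qed

lemma sum_Dop:
  fixes h :: "('a::euclidean_space, 'a) l2fun"
  shows "(\<Sum>i\<in>Basis. Dop i h \<bullet> Dop i h) = h \<bullet> h"
proof -
  obtain g where g: "h = abs_l2fun g" "square_integrable g" by (rule l2fun_cases)
  note sq = square_integrable_multiplier[OF bounded_multiplier_inner_vector g(2)]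
  have "(\<Sum>i\<in>Basis. Dop i h \<bullet> Dop i h) = (\<Sum>i\<in>Basis. LINT x|lebesgue. (g x \<bullet> i) * (g x \<bullet> i))"
    unfolding g(1) pointwise_op_abs[OF bounded_multiplier_inner_vector g(2)]
    by (simp add: inner_abs_l2fun[OF sq sq])
  also have "\<dots> = (LINT x|lebesgue. (\<Sum>i\<in>Basis. (g x \<bullet> i) * (g x \<bullet> i)))"
    using integrable_inner_square_integrable[OF sq sq]
    by (intro Bochner_Integration.integral_sum[symmetric]) simp
  also have "\<dots> = (LINT x|lebesgue. g x \<bullet> g x)"
    by (simp only: euclidean_inner[symmetric])
  also have "\<dots> = h \<bullet> h" unfolding g(1) by (rule inner_abs_l2fun[OF g(2) g(2), symmetric])
  finally show ?thesis .
qed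

text \<open>The cell estimate with the mesh adapted to \<epsilon>. A bounded \<Omega> meets finitely
  many cells, and their integrals are inner products with fixed vectors, so both sides are
  continuous and the estimate survives the closure.\<close>

lemma form_domain_compactness:
  fixes \<Omega> :: "'a::euclidean_space set"
  assumes \<Omega>: "open \<Omega>" "bounded \<Omega>" and eps: "0 < \<epsilon>"
  shows "\<exists>(N :: 'a set) b. finite N \<and>
    (\<forall>v h. (v, h) \<in> form_domain \<Omega> \<longrightarrow> v \<bullet> v \<le> \<epsilon> * (h \<bullet> h) + (\<Sum>p\<in>N. (v \<bullet> b p)\<^sup>2))"
proof -
  define d where "d = real DIM('a)"
  have d: "0 < d" by (simp add: d_def)
  \<comment> \<open>The mesh for which the constant of the cell estimate is exactly
    \<epsilon>.\<close>
  define r where "r = sqrt (2 * \<epsilon> / (2 ^ DIM('a) * d))"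
  have r: "0 < r" using eps d by (simp add: r_def)
  have r2: "2 ^ DIM('a) * d * r\<^sup>2 / 2 = \<epsilon>" using eps d by (simp add: r_def)
  define N where "N = cell_corner r ` \<Omega>"
  have N: "finite N" unfolding N_def by (rule finite_cell_corners[OF \<Omega>(2) r])
  define v where "v = r ^ DIM('a)"
  have v: "0 < v" using r by (simp add: v_def)
  \<comment> \<open>Normalized indicators: the division by \<open>sqrt v\<close> makes the squared
    inner product equal to the squared cell integral divided by the volume.\<close>
  define e where "e p x = indicator (cell r p) x / sqrt v" for p x :: 'a
  have e_sq: "square_integrable (e p)" if "p \<in> N" for p
  proof (rule square_integrable_if_nn_integral)
    have m: "e p \<in> borel_measurable borel"
      unfolding e_def using cell_borel[of r p] by measurable
    then show "e p \<in> borel_measurable lebesgue" by (rule borel_imp_lebesgue_measurable)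
    have "(\<integral>\<^sup>+x. ennreal ((norm (e p x))\<^sup>2) \<partial>lebesgue) = (\<integral>\<^sup>+x. ennreal ((norm (e p x))\<^sup>2) \<partial>lborel)"
      by (rule nn_integral_completion)
    also have "\<dots> = (\<integral>\<^sup>+x. ennreal (1 / v) * indicator (cell r p) x \<partial>lborel)"
      using v by (intro nn_integral_cong) (simp add: e_def indicator_def power_divide)
    also have "\<dots> = ennreal (1 / v) * emeasure lborel (cell r p)"
      by (rule nn_integral_cmult_indicator) (simp add: cell_borel)
    also have "\<dots> < \<infinity>"
    proof -
      obtain y where "p = cell_corner r y" using \<open>p \<in> N\<close> by (auto simp: N_def)
      then show ?thesis using emeasure_cell[OF r, of y] by (simp add: ennreal_mult_less_top)
    qed
    finally show "(\<integral>\<^sup>+x. ennreal ((norm (e p x))\<^sup>2) \<partial>lebesgue) < \<infinity>" .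
  qed
  define b where "b p = abs_l2fun (e p)" for p
  have "fst p \<bullet> fst p \<le> \<epsilon> * (snd p \<bullet> snd p) + (\<Sum>q\<in>N. (fst p \<bullet> b q)\<^sup>2)" (is "?P p")
    if "p \<in> form_domain \<Omega>" for p
    using that
  proof (rule form_domain_induct)
    show "closed {p. ?P p}"
      by (intro closed_Collect_le continuous_intros)
    fix \<phi> assume \<phi>: "test_function \<Omega> \<phi>"
    note s = test_function_square_integrable[OF \<Omega>(1) \<phi>]
    obtain K where K: "compactly_supported_C1 K \<phi>" "K \<subseteq> \<Omega>" by (rule test_function_C1_obtain[OF \<Omega>(1) \<phi>])
    have m: "\<phi> \<in> borel_measurable borel" "gradient \<phi> \<in> borel_measurable borel"
      by (intro borel_measurable_continuous_onI compactly_supported_C1_continuous[OF K(1)]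
          compactly_supported_C1D(3)[OF K(1)])+
    have 1: "l2_of \<Omega> \<phi> \<bullet> l2_of \<Omega> \<phi> = (LINT x|lborel. (\<phi> x)\<^sup>2)"
      unfolding s(3) inner_abs_l2fun[OF s(1) s(1)]
      by (subst integral_lebesgue_eq_lborel) (use m in \<open>auto simp: power2_eq_square\<close>)
    have 2: "l2_of \<Omega> (gradient \<phi>) \<bullet> l2_of \<Omega> (gradient \<phi>) = (LINT x|lborel. (norm (gradient \<phi> x))\<^sup>2)"
      unfolding s(4) inner_abs_l2fun[OF s(2) s(2)]
      by (subst integral_lebesgue_eq_lborel) (use m in \<open>auto simp: power2_norm_eq_inner\<close>)
    have 3: "(l2_of \<Omega> \<phi> \<bullet> b p)\<^sup>2 = (LINT x|lborel. indicator (cell r p) x * \<phi> x)\<^sup>2 / r ^ DIM('a)" if "p \<in> N" for p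
    proof -
      have "l2_of \<Omega> \<phi> \<bullet> b p = (LINT x|lebesgue. \<phi> x * e p x)"
        unfolding s(3) b_def inner_abs_l2fun[OF s(1) e_sq[OF that]] by simp
      also have "\<dots> = (LINT x|lborel. \<phi> x * e p x)"
        by (rule integral_lebesgue_eq_lborel) (use m cell_borel[of r p] in \<open>simp add: e_def\<close>)
      also have "\<dots> = (LINT x|lborel. indicator (cell r p) x * \<phi> x) / sqrt v"
        by (simp add: e_def mult.commute)
      finally show ?thesis using v by (simp add: power_divide v_def)
    qed
    have "(LINT x|lborel. (\<phi> x)\<^sup>2) \<le> (2 ^ DIM('a) * DIM('a) * r\<^sup>2 / 2) * (LINT x|lborel. (norm (gradient \<phi> x))\<^sup>2)
        + (\<Sum>p\<in>N. (LINT x|lborel. indicator (cell r p) x * \<phi> x)\<^sup>2 / r ^ DIM('a))"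
      by (rule cells_poincare[OF K(1) r N]) (use K(2) in \<open>auto simp: N_def\<close>)
    then show "?P (l2_of \<Omega> \<phi>, l2_of \<Omega> (gradient \<phi>))"
      using r2 by (simp add: 1 2 3 d_def)
  qed
  then have "\<forall>v h. (v, h) \<in> form_domain \<Omega> \<longrightarrow> v \<bullet> v \<le> \<epsilon> * (h \<bullet> h) + (\<Sum>p\<in>N. (v \<bullet> b p)\<^sup>2)"
    by fastforce
  with N show ?thesis by blast
qed

subsection \<open>Eigenvectors\<close>

definition eigenvectors :: "'a::euclidean_space set \<Rightarrow> real \<Rightarrow> ('a, real) l2fun set" where
  "eigenvectors \<Omega> \<mu> = {v. \<exists>h. eigenpair \<Omega> \<mu> v h}"

lemma eigenvectors_subspace:
  assumes "open \<Omega>"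
  shows "subspace (eigenvectors \<Omega> \<mu>)"
proof -
  note H = form_domain_subspace[OF assms]
  have ep: "eigenpair \<Omega> \<mu> 0 0"
    using subspace_0[OF H] by (simp add: eigenpair_def zero_prod_def)
  have add: "eigenpair \<Omega> \<mu> (v + w) (h + k)" if "eigenpair \<Omega> \<mu> v h" "eigenpair \<Omega> \<mu> w k" for v h w k
    using that subspace_add[OF H, of "(v, h)" "(w, k)"]
    by (simp add: eigenpair_def inner_add_left distrib_left)
  have scale: "eigenpair \<Omega> \<mu> (c *\<^sub>R v) (c *\<^sub>R h)" if "eigenpair \<Omega> \<mu> v h" for c v h
    using that subspace_scale[OF H, of "(v, h)" c]
    by (simp add: eigenpair_def)
  show ?thesis
    unfolding subspace_def eigenvectors_def using ep add scale by blast
qed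

lemma eigenvectors_eq_image:
  assumes "open \<Omega>"
  shows "eigenvectors \<Omega> \<mu> = l2_of \<Omega> ` dirichlet_eigenspace \<Omega> \<mu>"
proof
  show "eigenvectors \<Omega> \<mu> \<subseteq> l2_of \<Omega> ` dirichlet_eigenspace \<Omega> \<mu>"
    unfolding eigenvectors_def using eigenpair_imp_eigenspace[OF assms] by force
  show "l2_of \<Omega> ` dirichlet_eigenspace \<Omega> \<mu> \<subseteq> eigenvectors \<Omega> \<mu>"
    unfolding eigenvectors_def using eigenspace_imp_eigenpair(2)[OF assms] by blast
qed

text \<open>Modulo null sets the given functions become \<open>m\<close> independent vectors of the
  Hilbert space. Orthogonalization could only lower their number; since the span still has dimension
  \<open>m\<close>, exactly \<open>m\<close> vectors remain and none is 0, so all can be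
  normalized.\<close>

lemma orthogonal_eigenbasis:
  fixes \<Omega> :: "'a::euclidean_space set"
  assumes opn: "open \<Omega>" and dim: "has_dimension_ae \<Omega> (dirichlet_eigenspace \<Omega> \<mu>) m"
  obtains C where "finite C" "card C = m" "C \<subseteq> eigenvectors \<Omega> \<mu>" "eigenvectors \<Omega> \<mu> \<subseteq> span C"
    "pairwise orthogonal C" "0 \<notin> C"
proof -
  note leb = domain_lebesgue[OF opn]
  obtain u :: "nat \<Rightarrow> 'a \<Rightarrow> real" where u: "\<And>i. i < m \<Longrightarrow> u i \<in> dirichlet_eigenspace \<Omega> \<mu>"
    and ind: "\<And>c i. (AE x in lebesgue_on \<Omega>. (\<Sum>i<m. c i * u i x) = 0) \<Longrightarrow> i < m \<Longrightarrow> c i = 0"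
    and spn: "\<And>v. v \<in> dirichlet_eigenspace \<Omega> \<mu> \<Longrightarrow> \<exists>c. AE x in lebesgue_on \<Omega>. v x = (\<Sum>i<m. c i * u i x)"
    using dim unfolding has_dimension_ae_def by blast
  have uL: "u i \<in> L2 \<Omega>" if "i < m" for i by (rule eigenspace_imp_eigenpair(1)[OF opn u[OF that]])
  have sumL: "(\<lambda>x. \<Sum>i<m. c i * u i x) \<in> L2 \<Omega>"
    and sum: "l2_of \<Omega> (\<lambda>x. \<Sum>i<m. c i * u i x) = (\<Sum>i<m. c i *\<^sub>R l2_of \<Omega> (u i))" for c
    using L2_sum[OF leb, of "{..<m}" u c] l2_of_sum[OF leb, of "{..<m}" u c] uL by auto
  define U where "U i = l2_of \<Omega> (u i)" for i
  have U_ind: "c i = 0" if "(\<Sum>i<m. c i *\<^sub>R U i) = 0" "i < m" for c i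
  proof -
    have "l2_of \<Omega> (\<lambda>x. \<Sum>i<m. c i * u i x) = l2_of \<Omega> (\<lambda>x. 0)"
      using that(1) by (simp add: sum U_def l2_of_0)
    then have "AE x in lebesgue_on \<Omega>. (\<Sum>i<m. c i * u i x) = 0"
      by (subst (asm) l2_of_eq_iff[OF leb sumL L2_0[OF leb]])
    from ind[OF this that(2)] show ?thesis .
  qed
  have U_inj: "inj_on U {..<m}"
  proof (rule inj_onI, rule ccontr)
    fix i j assume ij: "i \<in> {..<m}" "j \<in> {..<m}" "U i = U j" "i \<noteq> j"
    define c :: "nat \<Rightarrow> real" where "c k = (if k = i then 1 else if k = j then -1 else 0)" for k
    have "(\<Sum>k<m. c k *\<^sub>R U k) = (\<Sum>k\<in>{i, j}. c k *\<^sub>R U k)"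
      by (rule sum.mono_neutral_right) (use ij in \<open>auto simp: c_def\<close>)
    also have "\<dots> = 0" using ij by (simp add: c_def)
    finally have "c i = 0" using U_ind ij by blast
    then show False by (simp add: c_def)
  qed
  define B where "B = U ` {..<m}"
  have B: "finite B" "card B = m" using card_image[OF U_inj] by (auto simp: B_def)
  have B_ind: "independent B"
  proof (rule independent_if_scalars_zero[OF B(1)])
    fix f x assume f: "(\<Sum>x\<in>B. f x *\<^sub>R x) = 0" and "x \<in> B"
    then obtain i where i: "i < m" "x = U i" by (auto simp: B_def)
    have "(\<Sum>i<m. f (U i) *\<^sub>R U i) = 0" using f unfolding B_def sum.reindex[OF U_inj] by simp
    from U_ind[OF this i(1)] show "f x = 0" by (simp add: i)
  qed
  have E_eq: "eigenvectors \<Omega> \<mu> = span B"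
  proof
    show "span B \<subseteq> eigenvectors \<Omega> \<mu>"
      by (rule span_minimal[OF _ eigenvectors_subspace[OF opn]])
        (use u in \<open>auto simp: B_def U_def eigenvectors_eq_image[OF opn]\<close>)
    show "eigenvectors \<Omega> \<mu> \<subseteq> span B"
    proof
      fix w assume "w \<in> eigenvectors \<Omega> \<mu>"
      then obtain v where v: "v \<in> dirichlet_eigenspace \<Omega> \<mu>" "w = l2_of \<Omega> v"
        unfolding eigenvectors_eq_image[OF opn] by blast
      obtain c where "AE x in lebesgue_on \<Omega>. v x = (\<Sum>i<m. c i * u i x)" using spn[OF v(1)] by blast
      then have "w = (\<Sum>i<m. c i *\<^sub>R U i)"
        unfolding v(2) U_def sum[symmetric]
        by (subst l2_of_eq_iff[OF leb eigenspace_imp_eigenpair(1)[OF opn v(1)] sumL])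
      also have "\<dots> \<in> span B"
        by (intro span_sum span_scale span_base) (auto simp: B_def)
      finally show "w \<in> span B" .
    qed
  qed
  obtain C where C: "finite C" "card C \<le> card B" "span C = span B" "pairwise orthogonal C"
    using basis_orthogonal[OF B(1)] by blast
  \<comment> \<open>Independence of \<open>B\<close> bounds every finite spanning set from below. It
    is applied to \<open>C\<close>, and to \<open>C\<close> without 0.\<close>
  have low: "m \<le> card C'" if "finite C'" "span C' = span B" for C'
    using independent_span_bound[OF that(1) B_ind] that(2) B(2) span_superset[of B] by auto
  have "0 \<notin> C"
  proof
    assume "0 \<in> C"
    then have "m \<le> card C - 1"
      using low[of "C - {0}"] C span_delete_0[of C] by (simp add: card_Diff_singleton)
    moreover have "card C > 0" using \<open>0 \<in> C\<close> C(1) card_gt_0_iff by blast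
    ultimately show False using C(2) B(2) by linarith
  qed
  moreover have "card C = m" using low[OF C(1,3)] C(2) B(2) by linarith
  moreover have "C \<subseteq> eigenvectors \<Omega> \<mu>" "eigenvectors \<Omega> \<mu> \<subseteq> span C"
    using C(3) span_superset[of C] unfolding E_eq by auto
  ultimately show ?thesis using that C by blast
qed

section \<open>From the list of eigenvalues to Yang's inequality\<close>

locale dirichlet_problem =
  fixes \<Omega> :: "'a::euclidean_space set" and lam :: "nat \<Rightarrow> real"
  assumes opn: "open \<Omega>" and bdd: "bounded \<Omega>" and ev: "dirichlet_eigenvalues \<Omega> lam"
begin

lemma finite_multiplicity: "finite {k. 1 \<le> k \<and> lam k = \<mu>}"
  using ev by (simp add: dirichlet_eigenvalues_def)

text \<open>For each \<mu> a bijection matches the indices carrying the value \<mu> with an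
  orthogonal basis of the eigenspace; together these form one sequence, orthogonal across different
  eigenvalues by symmetry. The last conjunct is the completeness used later: for an unlisted \<mu>
  it says that \<mu> is no eigenvalue.\<close>

lemma orthonormal_eigenvectors:
  "\<exists>U G. (\<forall>k\<ge>1. eigenpair \<Omega> (lam k) (U k) (G k)) \<and>
    (\<forall>k\<ge>1. \<forall>l\<ge>1. U k \<bullet> U l = (if k = l then 1 else 0)) \<and>
    (\<forall>\<mu> v h. eigenpair \<Omega> \<mu> v h \<longrightarrow> (\<forall>k\<ge>1. lam k = \<mu> \<longrightarrow> v \<bullet> U k = 0) \<longrightarrow> v = 0)"
proof -
  let ?K = "\<lambda>\<mu>. {k. 1 \<le> k \<and> lam k = \<mu>}"
  have "\<forall>\<mu>. \<exists>p. fst p \<subseteq> eigenvectors \<Omega> \<mu> \<and> eigenvectors \<Omega> \<mu> \<subseteq> span (fst p) \<and>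
      pairwise orthogonal (fst p) \<and> 0 \<notin> fst p \<and> bij_betw (snd p) (?K \<mu>) (fst p)"
  proof
    fix \<mu>
    have "has_dimension_ae \<Omega> (dirichlet_eigenspace \<Omega> \<mu>) (card (?K \<mu>))"
      using ev by (simp add: dirichlet_eigenvalues_def)
    from orthogonal_eigenbasis[OF opn this] obtain C where C: "finite C" "card C = card (?K \<mu>)"
      "C \<subseteq> eigenvectors \<Omega> \<mu>" "eigenvectors \<Omega> \<mu> \<subseteq> span C" "pairwise orthogonal C" "0 \<notin> C" .
    then obtain f where "bij_betw f (?K \<mu>) C"
      using finite_same_card_bij[OF finite_multiplicity C(1)] by metis
    with C show "\<exists>p. fst p \<subseteq> eigenvectors \<Omega> \<mu> \<and> eigenvectors \<Omega> \<mu> \<subseteq> span (fst p) \<and>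
      pairwise orthogonal (fst p) \<and> 0 \<notin> fst p \<and> bij_betw (snd p) (?K \<mu>) (fst p)"
      by (intro exI[of _ "(C, f)"]) simp
  qed
  from choice[OF this] obtain p where p: "\<forall>\<mu>. fst (p \<mu>) \<subseteq> eigenvectors \<Omega> \<mu> \<and>
      eigenvectors \<Omega> \<mu> \<subseteq> span (fst (p \<mu>)) \<and> pairwise orthogonal (fst (p \<mu>)) \<and>
      0 \<notin> fst (p \<mu>) \<and> bij_betw (snd (p \<mu>)) (?K \<mu>) (fst (p \<mu>))" ..
  define C where "C \<mu> = fst (p \<mu>)" for \<mu>
  define f where "f \<mu> = snd (p \<mu>)" for \<mu>
  have C: "\<And>\<mu>. C \<mu> \<subseteq> eigenvectors \<Omega> \<mu>" "\<And>\<mu>. eigenvectors \<Omega> \<mu> \<subseteq> span (C \<mu>)"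
      "\<And>\<mu>. pairwise orthogonal (C \<mu>)" "\<And>\<mu>. 0 \<notin> C \<mu>" "\<And>\<mu>. bij_betw (f \<mu>) (?K \<mu>) (C \<mu>)"
    using p by (simp_all add: C_def f_def)
  define V where "V k = f (lam k) k" for k
  define U where "U k = V k /\<^sub>R norm (V k)" for k
  have V: "V k \<in> C (lam k)" if "1 \<le> k" for k
    using bij_betwE[OF C(5)[of "lam k"]] that unfolding V_def by blast
  have V0: "V k \<noteq> 0" if "1 \<le> k" for k using V[OF that] C(4) by metis
  have "\<exists>h. 1 \<le> k \<longrightarrow> eigenpair \<Omega> (lam k) (U k) h" for k
  proof (cases "1 \<le> k")
    case True
    have "U k \<in> eigenvectors \<Omega> (lam k)"
      unfolding U_def using V[OF True] C(1) by (intro subspace_scale[OF eigenvectors_subspace[OF opn]]) blast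
    then show ?thesis by (auto simp: eigenvectors_def)
  qed simp
  then obtain G where G: "\<And>k. 1 \<le> k \<Longrightarrow> eigenpair \<Omega> (lam k) (U k) (G k)" by metis
  have orth: "U k \<bullet> U l = 0" if kl: "1 \<le> k" "1 \<le> l" "k \<noteq> l" for k l
  proof (cases "lam k = lam l")
    case True
    have "V k \<noteq> V l"
      using bij_betw_imp_inj_on[OF C(5)[of "lam l"]] kl True unfolding V_def inj_on_def by auto
    moreover have "V k \<in> C (lam l)" "V l \<in> C (lam l)" using V kl True by metis+
    ultimately have "orthogonal (V k) (V l)" using C(3) unfolding pairwise_def by blast
    then show ?thesis by (simp add: U_def orthogonal_def)
  next
    case False
    have "G k \<bullet> G l = lam k * (U k \<bullet> U l)" "G l \<bullet> G k = lam l * (U l \<bullet> U k)"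
      using G[OF kl(1)] G[OF kl(2)] unfolding eigenpair_def by blast+
    then have "(lam k - lam l) * (U k \<bullet> U l) = 0" by (simp add: inner_commute left_diff_distrib)
    with False show ?thesis by simp
  qed
  have norm: "U k \<bullet> U k = 1" if "1 \<le> k" for k
    using V0[OF that] by (simp add: U_def power2_norm_eq_inner[symmetric] power2_eq_square field_simps)
  have complete: "v = 0"
    if v: "eigenpair \<Omega> \<mu> v h" and 0: "\<And>k. 1 \<le> k \<Longrightarrow> lam k = \<mu> \<Longrightarrow> v \<bullet> U k = 0" for \<mu> v h
  proof -
    have "C \<mu> \<subseteq> {w. v \<bullet> w = 0}"
    proof
      fix w assume "w \<in> C \<mu>"
      then obtain k where k: "1 \<le> k" "lam k = \<mu>" "w = V k"
        using bij_betw_imp_surj_on[OF C(5)[of \<mu>]] unfolding V_def by blast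
      have "v \<bullet> U k = 0" by (rule 0[OF k(1,2)])
      then show "w \<in> {w. v \<bullet> w = 0}" using V0[OF k(1)] k(3) by (simp add: U_def)
    qed
    then have "span (C \<mu>) \<subseteq> {w. v \<bullet> w = 0}"
      by (rule span_minimal) (simp add: subspace_def inner_add_right)
    moreover have "v \<in> span (C \<mu>)" using v C(2) unfolding eigenvectors_def by blast
    ultimately show "v = 0" by auto
  qed
  have "\<forall>k\<ge>1. \<forall>l\<ge>1. U k \<bullet> U l = (if k = l then 1 else 0)" using orth norm by simp
  with G complete show ?thesis by blast
qed

text \<open>All three rest on one orthonormal system. An eigenvalue is the energy of its
  eigenvector, hence nonnegative. Compactness limits the orthonormal vectors of energy below
  \<open>z\<close>, hence finiteness. Yang's inequality is summed over the basis directions, where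
  the squared norms of the partial derivatives add up to the energy \<open>lam k\<close>.\<close>

lemma
  shows finite_eigenvalues_below: "finite {k. 1 \<le> k \<and> lam k < z}"
    and eigenvalue_nonneg: "1 \<le> k \<Longrightarrow> 0 \<le> lam k"
    and harrell_stubbe: "DIM('a) * (\<Sum>k | 1 \<le> k \<and> lam k < z. (z - lam k)\<^sup>2) \<le>
      4 * (\<Sum>k | 1 \<le> k \<and> lam k < z. (z - lam k) * lam k)"
proof -
  obtain U G where UG_all: "(\<forall>k\<ge>1. eigenpair \<Omega> (lam k) (U k) (G k)) \<and>
    (\<forall>k\<ge>1. \<forall>l\<ge>1. U k \<bullet> U l = (if k = l then 1 else 0)) \<and>
    (\<forall>\<mu> v h. eigenpair \<Omega> \<mu> v h \<longrightarrow> (\<forall>k\<ge>1. lam k = \<mu> \<longrightarrow> v \<bullet> U k = 0) \<longrightarrow> v = 0)"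
    using orthonormal_eigenvectors by (elim exE)
  have ep: "eigenpair \<Omega> (lam k) (U k) (G k)" if "1 \<le> k" for k
    using UG_all that by simp
  have on: "U k \<bullet> U l = (if k = l then 1 else 0)" if "1 \<le> k" "1 \<le> l" for k l
    using UG_all that by simp
  have complete: "v = 0" if "eigenpair \<Omega> \<mu> v h" "\<And>k. 1 \<le> k \<Longrightarrow> lam k = \<mu> \<Longrightarrow> v \<bullet> U k = 0" for \<mu> v h
    using UG_all that by blast
  have UG: "(U k, G k) \<in> form_domain \<Omega>" if "1 \<le> k" for k using ep[OF that] by (simp add: eigenpair_def)
  have eig: "G k \<bullet> h = lam k * (U k \<bullet> v)" if "1 \<le> k" "(v, h) \<in> form_domain \<Omega>" for k v h
    using ep[OF that(1)] that(2) by (simp add: eigenpair_def)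
  have GG: "G k \<bullet> G k = lam k" if "1 \<le> k" for k using eig[OF that UG[OF that]] on[OF that that] by simp
  show nonneg: "0 \<le> lam k" if "1 \<le> k" for k using GG[OF that] inner_ge_zero[of "G k"] by simp
  \<comment> \<open>Positive for every real \<open>z\<close>, with \<open>\<epsilon> * z\<close> at
    most one half.\<close>
  define \<epsilon> where "\<epsilon> = 1 / (2 * max 1 z)"
  have eps: "0 < \<epsilon>" "\<epsilon> * z < 1" by (auto simp: \<epsilon>_def max_def divide_simps)
  obtain N :: "'a set" and b where N: "finite N"
    and cpt_all: "\<forall>v h. (v, h) \<in> form_domain \<Omega> \<longrightarrow> v \<bullet> v \<le> \<epsilon> * (h \<bullet> h) + (\<Sum>p\<in>N. (v \<bullet> b p)\<^sup>2)"
    using form_domain_compactness[OF opn bdd eps(1)] by (elim exE conjE)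
  have cpt: "v \<bullet> v \<le> \<epsilon> * (h \<bullet> h) + (\<Sum>p\<in>N. (v \<bullet> b p)\<^sup>2)" if "(v, h) \<in> form_domain \<Omega>" for v h
    using cpt_all that by blast
  define K where "K = {k. 1 \<le> k \<and> lam k < z}"
  have K1: "1 \<le> k" "lam k < z" if "k \<in> K" for k using that by (auto simp: K_def)
  define B where "B = (\<Sum>p\<in>N. b p \<bullet> b p) / (1 - \<epsilon> * z)"
  have fin: "finite K"
  proof -
    \<comment> \<open>The bound does not depend on \<open>F\<close>, so \<open>K\<close> cannot have
      arbitrarily large finite subsets.\<close>
    have "card F \<le> nat \<lceil>B\<rceil>" if F: "F \<subseteq> K" "finite F" for F
    proof -
      have "real (card F) * (1 - \<epsilon> * z) \<le> (\<Sum>p\<in>N. b p \<bullet> b p)"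
      proof (rule eigenvalue_count_bound[OF F(2) less_imp_le[OF eps(1)], of U G])
        fix i assume i: "i \<in> F"
        then have iK: "1 \<le> i" "lam i < z" using K1 F(1) by blast+
        show "G i \<bullet> G i \<le> z" using GG[OF iK(1)] iK(2) by simp
        show "U i \<bullet> U i \<le> \<epsilon> * (G i \<bullet> G i) + (\<Sum>p\<in>N. (U i \<bullet> b p)\<^sup>2)" by (rule cpt[OF UG[OF iK(1)]])
        fix j assume "j \<in> F"
        then have "1 \<le> j" using K1 F(1) by blast
        with iK(1) show "U i \<bullet> U j = (if i = j then 1 else 0)" by (rule on)
      qed
      then have "real (card F) \<le> B" unfolding B_def using eps(2) by (simp add: le_divide_eq)
      then show ?thesis by linarith
    qed
    then show ?thesis by (meson finite_if_finite_subsets_card_bdd)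
  qed
  then show "finite {k. 1 \<le> k \<and> lam k < z}" by (simp add: K_def)
  have gap: "z * (v \<bullet> v) \<le> h \<bullet> h" if "(v, h) \<in> form_domain \<Omega>" "\<forall>i\<in>K. v \<bullet> U i = 0" for v h
  proof (rule spectral_gap[OF form_domain_subspace[OF opn] form_domain_closed N less_imp_le[OF eps(1)] eps(2) cpt fin
        _ _ _ _ that, where g = G and lam = lam])
    fix v h \<mu> assume vh: "(v, h) \<in> form_domain \<Omega>" "\<And>w k. (w, k) \<in> form_domain \<Omega> \<Longrightarrow> h \<bullet> k = \<mu> * (v \<bullet> w)"
      and \<mu>: "\<mu> < z" and orth: "\<forall>i\<in>K. v \<bullet> U i = 0"
    show "v = 0"
    proof (rule complete)
      show "eigenpair \<Omega> \<mu> v h" unfolding eigenpair_def using vh by blast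
      show "v \<bullet> U k = 0" if "1 \<le> k" "lam k = \<mu>" for k using orth that \<mu> by (simp add: K_def)
    qed
  qed (use K1 on UG eig in auto)
  have yang: "(\<Sum>k\<in>K. (z - lam k)\<^sup>2) \<le> 4 * (\<Sum>k\<in>K. (z - lam k) * (Dop i (G k) \<bullet> Dop i (G k)))"
    if i: "i \<in> Basis" for i :: 'a
  proof (rule yang_one_direction[OF fin form_domain_subspace[OF opn], where X = "Xop \<Omega> i" and X' = "Xop \<Omega> i"
        and J = "Jop i" and u = U])
    note bm = bounded_multiplier_coord[OF bdd domain_lebesgue[OF opn]]
    show "Xop \<Omega> i v \<bullet> w = v \<bullet> Xop \<Omega> i w" for v w :: "('a, real) l2fun"
      by (rule inner_pointwise_op[OF bm bm]) (simp add: coord_multiplier_def)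
    show "Xop \<Omega> i h \<bullet> k = h \<bullet> Xop \<Omega> i k" for h k :: "('a, 'a) l2fun"
      by (rule inner_pointwise_op[OF bm bm]) (simp add: coord_multiplier_def)
    show "(Xop \<Omega> i v, Jop i v + Xop \<Omega> i h) \<in> form_domain \<Omega>" if "(v, h) \<in> form_domain \<Omega>" for v h
      by (rule form_domain_coordinate[OF opn bdd i that])
    show "Jop i v \<bullet> h = v \<bullet> Dop i h" for v h by (rule Jop_adjoint)
    show "v \<bullet> Dop i k = - (Dop i h \<bullet> w)" if "(v, h) \<in> form_domain \<Omega>" "(w, k) \<in> form_domain \<Omega>" for v h w k
      by (rule form_domain_by_parts[OF opn that])
    show "Dop i (Jop i v + Xop \<Omega> i h) = v + Xop \<Omega> i (Dop i h)" for v h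
      by (rule Dop_coordinate[OF opn bdd i])
    show "z * (v \<bullet> v) \<le> h \<bullet> h" if "(v, h) \<in> form_domain \<Omega>" "\<forall>i\<in>K. v \<bullet> U i = 0" for v h
      by (rule gap[OF that])
  qed (use K1 on UG eig in auto)
  have "DIM('a) * (\<Sum>k\<in>K. (z - lam k)\<^sup>2) = (\<Sum>i\<in>(Basis :: 'a set). \<Sum>k\<in>K. (z - lam k)\<^sup>2)" by simp
  also have "\<dots> \<le> (\<Sum>i\<in>(Basis :: 'a set). 4 * (\<Sum>k\<in>K. (z - lam k) * (Dop i (G k) \<bullet> Dop i (G k))))"
    by (rule sum_mono) (rule yang)
  also have "\<dots> = 4 * (\<Sum>k\<in>K. (z - lam k) * (\<Sum>i\<in>Basis. Dop i (G k) \<bullet> Dop i (G k)))"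
    unfolding sum_distrib_left by (rule sum.swap)
  also have "(\<Sum>k\<in>K. (z - lam k) * (\<Sum>i\<in>Basis. Dop i (G k) \<bullet> Dop i (G k))) = (\<Sum>k\<in>K. (z - lam k) * lam k)"
    by (rule sum.cong[OF refl]) (simp only: sum_Dop GG K1)
  finally show "DIM('a) * (\<Sum>k | 1 \<le> k \<and> lam k < z. (z - lam k)\<^sup>2) \<le>
      4 * (\<Sum>k | 1 \<le> k \<and> lam k < z. (z - lam k) * lam k)"
    unfolding K_def .
qed

end

subsection \<open>Growth of Riesz means\<close>

lemma DERIV_if_quadratic_error:
  fixes f :: "real \<Rightarrow> real"
  assumes "\<And>h. \<bar>f (x + h) - f x - D * h\<bar> \<le> h\<^sup>2"
  shows "(f has_real_derivative D) (at x)"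
  unfolding DERIV_def
proof (rule LIM_I)
  fix r :: real assume r: "0 < r"
  have "norm ((f (x + h) - f x) / h - D) < r" if h: "h \<noteq> 0 \<and> norm (h - 0) < r" for h
  proof -
    have "\<bar>(f (x + h) - f x) / h - D\<bar> = \<bar>f (x + h) - f x - D * h\<bar> / \<bar>h\<bar>"
      using h by (subst abs_divide[symmetric]) (simp add: diff_divide_distrib)
    also have "\<dots> \<le> h\<^sup>2 / \<bar>h\<bar>" by (intro divide_right_mono assms) simp
    also have "\<dots> = \<bar>h\<bar>" using h by (simp add: power2_eq_square abs_if)
    finally show ?thesis using h by simp
  qed
  with r show "\<exists>s>0. \<forall>h. h \<noteq> 0 \<and> norm (h - 0) < s \<longrightarrow> norm ((f (x + h) - f x) / h - D) < r" by blast
qed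

text \<open>Squaring removes the corner of the positive part at \<open>a\<close>. The error of the
  linear approximation is at most \<open>h^2\<close> on either side of \<open>a\<close> and across
  it, so the point \<open>t = a\<close> needs no separate limit.\<close>

lemma DERIV_positive_part_power2:
  "((\<lambda>t. (max 0 (t - a))\<^sup>2) has_real_derivative 2 * max 0 (t - a)) (at t)"
proof (rule DERIV_if_quadratic_error)
  fix h :: real
  define s where "s = t - a"
  consider "0 \<le> s" "0 \<le> s + h" | "0 \<le> s" "s + h < 0" | "s < 0" "0 \<le> s + h" | "s < 0" "s + h < 0" by linarith
  then have "\<bar>(max 0 (s + h))\<^sup>2 - (max 0 s)\<^sup>2 - 2 * max 0 s * h\<bar> \<le> h\<^sup>2"
  proof cases
    case 1
    then show ?thesis by (simp add: max_def power2_eq_square algebra_simps)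
  next
    case 2
    then have "(max 0 (s + h))\<^sup>2 - (max 0 s)\<^sup>2 - 2 * max 0 s * h = h\<^sup>2 - (s + h)\<^sup>2"
      by (simp add: max_def power2_eq_square algebra_simps)
    moreover have "\<bar>s + h\<bar>\<^sup>2 \<le> \<bar>h\<bar>\<^sup>2" using 2 by (intro power_mono) auto
    ultimately show ?thesis by simp
  next
    case 3
    then have "\<bar>s + h\<bar>\<^sup>2 \<le> \<bar>h\<bar>\<^sup>2" by (intro power_mono) auto
    then show ?thesis using 3 by (simp add: max_def)
  next
    case 4
    then show ?thesis by (simp add: max_def)
  qed
  then show "\<bar>(max 0 (t + h - a))\<^sup>2 - (max 0 (t - a))\<^sup>2 - 2 * max 0 (t - a) * h\<bar> \<le> h\<^sup>2"
    by (simp add: s_def algebra_simps)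
qed

context dirichlet_problem
begin

abbreviation below :: "real \<Rightarrow> nat set" where "below z \<equiv> {k. 1 \<le> k \<and> lam k < z}"

text \<open>Indices with \<open>lam k \<ge> z\<close> contribute \<open>0 powr \<sigma>\<close>,
  which is 0 for every \<sigma>, including \<open>\<sigma> = 0\<close>.\<close>

lemma riesz_mean_eq: "riesz_mean lam \<sigma> z = (\<Sum>k\<in>below z. (z - lam k) powr \<sigma>)"
proof -
  have "riesz_mean lam \<sigma> z = (\<Sum>\<^sub>\<infinity>k\<in>below z. (z - lam k) powr \<sigma>)"
    unfolding riesz_mean_def by (rule infsum_cong_neutral) (auto simp: max_def)
  then show ?thesis using finite_eigenvalues_below by simp
qed

lemma riesz_mean_1: "riesz_mean lam 1 z = (\<Sum>k\<in>below z. z - lam k)"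
  unfolding riesz_mean_eq by (rule sum.cong) auto

lemma riesz_mean_2: "riesz_mean lam 2 z = (\<Sum>k\<in>below z. (z - lam k)\<^sup>2)"
  unfolding riesz_mean_eq by (rule sum.cong) (auto simp: powr_numeral)

text \<open>Yang's inequality rewritten with \<open>(z - \<lambda>) \<lambda> = z (z - \<lambda>) -
  (z - \<lambda>)^2\<close>.\<close>

lemma riesz_mean_2_le: "(1 + DIM('a) / 4) * riesz_mean lam 2 z \<le> z * riesz_mean lam 1 z"
proof -
  have "(\<Sum>k\<in>below z. (z - lam k) * lam k) = z * riesz_mean lam 1 z - riesz_mean lam 2 z"
    unfolding riesz_mean_1 riesz_mean_2 sum_distrib_left sum_subtractf[symmetric]
    by (rule sum.cong) (auto simp: power2_eq_square algebra_simps)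
  with harrell_stubbe[of z] show ?thesis by (simp add: riesz_mean_2 algebra_simps)
qed

text \<open>The index set \<open>below t\<close> moves with \<open>t\<close>. A fixed larger set
  with positive parts allows termwise differentiation and lets eigenvalues above \<open>t\<close> be
  included freely.\<close>

lemma riesz_mean_superset:
  assumes "finite F" "below t \<subseteq> F" "\<And>k. k \<in> F \<Longrightarrow> 1 \<le> k"
  shows "riesz_mean lam 1 t = (\<Sum>k\<in>F. max 0 (t - lam k))"
    and "riesz_mean lam 2 t = (\<Sum>k\<in>F. (max 0 (t - lam k))\<^sup>2)"
proof -
  show "riesz_mean lam 1 t = (\<Sum>k\<in>F. max 0 (t - lam k))"
    unfolding riesz_mean_1 by (rule sum.mono_neutral_cong_left) (use assms(1,2) in \<open>auto simp: max_def dest: assms(3)\<close>)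
  show "riesz_mean lam 2 t = (\<Sum>k\<in>F. (max 0 (t - lam k))\<^sup>2)"
    unfolding riesz_mean_2 by (rule sum.mono_neutral_cong_left) (use assms(1,2) in \<open>auto simp: max_def dest: assms(3)\<close>)
qed

lemma riesz_mean_2_growth:
  assumes "0 < s" "s \<le> z"
  shows "riesz_mean lam 2 s / s powr (2 + DIM('a) / 2) \<le> riesz_mean lam 2 z / z powr (2 + DIM('a) / 2)"
proof -
  define p where "p = 2 + real DIM('a) / 2"
  define F where "F = below z"
  have F: "finite F" unfolding F_def by (rule finite_eigenvalues_below)
  \<comment> \<open>\<open>R\<close> agrees with the Riesz mean only up to \<open>z\<close>, but
    being a fixed finite sum it has a two-sided derivative at the endpoint \<open>z\<close> as
    well.\<close>
  define R where "R t = (\<Sum>k\<in>F. (max 0 (t - lam k))\<^sup>2)" for t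
  have R1: "riesz_mean lam 1 t = (\<Sum>k\<in>F. max 0 (t - lam k))" if "t \<le> z" for t
    by (rule riesz_mean_superset(1)[OF F]) (use that in \<open>auto simp: F_def\<close>)
  have R2: "riesz_mean lam 2 t = R t" if "t \<le> z" for t
    unfolding R_def by (rule riesz_mean_superset(2)[OF F]) (use that in \<open>auto simp: F_def\<close>)
  have "R s * s powr (- p) \<le> R z * z powr (- p)"
  proof (rule DERIV_nonneg_imp_nondecreasing[OF assms(2)])
    fix t assume t: "s \<le> t" "t \<le> z"
    have t0: "0 < t" using t assms by simp
    have "(R has_real_derivative (\<Sum>k\<in>F. 2 * max 0 (t - lam k))) (at t)"
      unfolding R_def by (intro DERIV_sum DERIV_positive_part_power2)
    then have "(R has_real_derivative 2 * riesz_mean lam 1 t) (at t)"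
      by (simp add: R1[OF t(2)] sum_distrib_left)
    moreover have "((\<lambda>t. t powr (- p)) has_real_derivative (- p) * t powr (- p - 1)) (at t)"
      by (rule has_real_derivative_powr[OF t0])
    ultimately have "((\<lambda>t. R t * t powr (- p)) has_real_derivative
        (2 * riesz_mean lam 1 t) * t powr (- p) + ((- p) * t powr (- p - 1)) * R t) (at t)"
      by (rule DERIV_mult)
    moreover have "0 \<le> (2 * riesz_mean lam 1 t) * t powr (- p) + ((- p) * t powr (- p - 1)) * R t"
    proof -
      have pow: "t powr (- p) = t powr (- p - 1) * t" using t0 powr_add[of t "- p - 1" 1] by simp
      have "(2 * riesz_mean lam 1 t) * t powr (- p) + ((- p) * t powr (- p - 1)) * R t =
          t powr (- p - 1) * (2 * (t * riesz_mean lam 1 t) - p * R t)"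
        unfolding pow by (simp add: algebra_simps)
      \<comment> \<open>Twice Yang's inequality, since \<open>p = 2 * (1 + d / 4)\<close>.\<close>
      moreover have "p * R t \<le> 2 * (t * riesz_mean lam 1 t)"
        using riesz_mean_2_le[of t] unfolding R2[OF t(2)] p_def by (simp add: algebra_simps)
      ultimately show ?thesis by simp
    qed
    ultimately show "\<exists>y. ((\<lambda>t. R t * t powr (- p)) has_real_derivative y) (at t) \<and> 0 \<le> y" by blast
  qed
  then show ?thesis
    unfolding R2[OF assms(2)] R2[OF order_refl] p_def[symmetric] by (simp only: powr_minus divide_inverse)
qed

text \<open>Were 0 an eigenvalue, a small positive \<open>z\<close> would have only zero eigenvalues
  below it. The right side of Yang's inequality would then vanish while the left side is
  positive.\<close>

lemma first_eigenvalue_pos: "0 < lam 1"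
proof (rule ccontr)
  assume "\<not> 0 < lam 1"
  then have lam1: "lam 1 = 0" using eigenvalue_nonneg[of 1] by simp
  \<comment> \<open>A positive number not exceeding any positive eigenvalue. Including 1 keeps the
    set nonempty and confines the search to the finitely many eigenvalues below 1.\<close>
  define z where "z = Min (insert 1 (lam ` {k \<in> below 1. 0 < lam k}))"
  have fin: "finite (insert 1 (lam ` {k \<in> below 1. 0 < lam k}))"
    by (intro finite.insertI finite_imageI finite_subset[OF _ finite_eigenvalues_below[of 1]]) blast
  have z: "0 < z" unfolding z_def using fin by (subst Min_gr_iff) auto
  have z_le: "z \<le> y" if "y \<in> insert 1 (lam ` {k \<in> below 1. 0 < lam k})" for y
    unfolding z_def using fin that by (rule Min_le)
  have zero: "lam k = 0" if "k \<in> below z" for k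
  proof -
    have "z \<le> 1" using z_le by blast
    then have "lam k < 1" using that by simp
    then have "z \<le> lam k" if "0 < lam k"
      using z_le[of "lam k"] \<open>k \<in> below z\<close> that by blast
    then show ?thesis using that eigenvalue_nonneg[of k] by force
  qed
  have "0 < (z - lam 1)\<^sup>2" using z lam1 by simp
  also have "\<dots> \<le> (\<Sum>k\<in>below z. (z - lam k)\<^sup>2)"
    using z lam1 by (intro member_le_sum finite_eigenvalues_below) auto
  finally have "0 < DIM('a) * (\<Sum>k\<in>below z. (z - lam k)\<^sup>2)" by simp
  also have "\<dots> \<le> 4 * (\<Sum>k\<in>below z. (z - lam k) * lam k)" by (rule harrell_stubbe)
  also have "(\<Sum>k\<in>below z. (z - lam k) * lam k) = 0"
    by (rule sum.neutral) (use zero in simp)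
  finally show False by simp
qed

section \<open>Bounds in terms of the mean of the first eigenvalues\<close>

lemma eigenvalue_mean_pos:
  assumes "1 \<le> j"
  shows "0 < eigenvalue_mean lam j"
proof -
  have "0 < (\<Sum>l=1..j. lam l)"
    by (rule sum_pos2[of _ 1]) (use assms first_eigenvalue_pos eigenvalue_nonneg in auto)
  then show ?thesis using assms by (simp add: eigenvalue_mean_def)
qed

lemma riesz_mean_2_at_mean:
  assumes "1 \<le> j" and s: "eigenvalue_mean lam j \<le> s"
  shows "real j * (s - eigenvalue_mean lam j)\<^sup>2 \<le> riesz_mean lam 2 s"
proof -
  let ?m = "eigenvalue_mean lam j"
  \<comment> \<open>Some of the first \<open>j\<close> eigenvalues may lie above \<open>s\<close>.
    Adding their indices changes no sum of positive parts and makes the first \<open>j\<close> terms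
    part of the Riesz mean.\<close>
  define F where "F = below s \<union> {1..j}"
  have F: "finite F" unfolding F_def using finite_eigenvalues_below by simp
  have "real j * (s - ?m) = (\<Sum>l=1..j. s - lam l)"
    using assms by (simp add: sum_subtractf eigenvalue_mean_def right_diff_distrib)
  also have "\<dots> \<le> (\<Sum>l=1..j. max 0 (s - lam l))" by (rule sum_mono) simp
  \<comment> \<open>Squaring preserves the inequality because \<open>s\<close> is at least the mean,
    so the left side is nonnegative.\<close>
  finally have "(real j * (s - ?m))\<^sup>2 \<le> (\<Sum>l=1..j. max 0 (s - lam l))\<^sup>2"
    using s by (intro power_mono) auto
  also have "\<dots> \<le> real j * (\<Sum>l=1..j. (max 0 (s - lam l))\<^sup>2)"
    using Cauchy_Schwarz_ineq_sum[of "\<lambda>_. 1" "\<lambda>l. max 0 (s - lam l)" "{1..j}"] by simp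
  also have "(\<Sum>l=1..j. (max 0 (s - lam l))\<^sup>2) \<le> (\<Sum>l\<in>F. (max 0 (s - lam l))\<^sup>2)"
    by (rule sum_mono2[OF F]) (auto simp: F_def)
  also have "\<dots> = riesz_mean lam 2 s"
    by (rule riesz_mean_superset(2)[OF F, symmetric]) (auto simp: F_def)
  finally have "real j * (real j * (s - ?m)\<^sup>2) \<le> real j * riesz_mean lam 2 s"
    using assms(1) by (simp add: power_mult_distrib power2_eq_square[of "real j"] mult.assoc)
  then show ?thesis using assms by (subst (asm) mult_le_cancel_left_pos) auto
qed

lemma riesz_bounds:
  fixes j :: nat and z :: real
  defines "d \<equiv> real DIM('a)"
  defines "s \<equiv> (1 + 4 / d) * eigenvalue_mean lam j"
  assumes j: "1 \<le> j" and z: "s \<le> z"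
  shows "real j * z powr (2 + d / 2) / ((1 + d / 4)\<^sup>2 * s powr (d / 2)) \<le> riesz_mean lam 2 z" (is ?R2)
    and "real j * z powr (1 + d / 2) / ((1 + d / 4) * s powr (d / 2)) \<le> riesz_mean lam 1 z" (is ?R1)
    and "real j * (z / s) powr (d / 2) \<le> counting_function lam z" (is ?N)
proof -
  have d: "0 < d" by (simp add: d_def)
  let ?m = "eigenvalue_mean lam j"
  have m: "0 < ?m" by (rule eigenvalue_mean_pos[OF j])
  have s: "0 < s" using m d by (simp add: s_def add_pos_pos)
  have z0: "0 < z" using s z by simp
  have c: "0 < 1 + d / 4" using d by simp
  \<comment> \<open>The difference is \<open>4 / d\<close> times the mean. This is the source of the
    factors \<open>1 + d / 4\<close> in the denominators.\<close>
  have sm: "s - ?m = s / (1 + d / 4)"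
    using d by (simp add: s_def divide_simps) (simp add: algebra_simps)
  have "real j * (s - ?m)\<^sup>2 \<le> riesz_mean lam 2 s"
    by (rule riesz_mean_2_at_mean[OF j]) (use m d in \<open>simp add: s_def algebra_simps\<close>)
  then have "real j * s\<^sup>2 / (1 + d / 4)\<^sup>2 / s powr (2 + d / 2) \<le> riesz_mean lam 2 s / s powr (2 + d / 2)"
    unfolding sm using s by (intro divide_right_mono) (auto simp: power_divide)
  also have "\<dots> \<le> riesz_mean lam 2 z / z powr (2 + d / 2)"
    unfolding d_def by (rule riesz_mean_2_growth[OF s z])
  finally have "real j * s\<^sup>2 / (1 + d / 4)\<^sup>2 / s powr (2 + d / 2) * z powr (2 + d / 2) \<le> riesz_mean lam 2 z"
    using z0 by (simp add: le_divide_eq)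
  moreover have "real j * s\<^sup>2 / (1 + d / 4)\<^sup>2 / s powr (2 + d / 2) * z powr (2 + d / 2) =
      real j * z powr (2 + d / 2) / ((1 + d / 4)\<^sup>2 * s powr (d / 2))"
  proof -
    have "s powr (2 + d / 2) = s\<^sup>2 * s powr (d / 2)" using s by (simp add: powr_add powr_numeral)
    then show ?thesis using s by simp
  qed
  ultimately show R2: ?R2 by simp
  have "z * (real j * z powr (1 + d / 2) / ((1 + d / 4) * s powr (d / 2))) =
      (1 + d / 4) * (real j * z powr (2 + d / 2) / ((1 + d / 4)\<^sup>2 * s powr (d / 2)))"
    using s c z0 by (simp add: powr_add powr_numeral power2_eq_square)
  also have "\<dots> \<le> (1 + d / 4) * riesz_mean lam 2 z"
    using c by (intro mult_left_mono R2) auto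
  also have "\<dots> \<le> z * riesz_mean lam 1 z"
    unfolding d_def by (rule riesz_mean_2_le)
  finally show R1: ?R1 using z0 by (subst (asm) mult_le_cancel_left_pos) auto
  have "0 < real j * z powr (1 + d / 2) / ((1 + d / 4) * s powr (d / 2))"
    using j z0 s c by (intro divide_pos_pos mult_pos_pos) auto
  \<comment> \<open>Positivity allows one factor \<open>riesz_mean lam 1 z\<close> to be cancelled
    below; it follows from the bound just proved and \<open>j \<ge> 1\<close>.\<close>
  then have R1_pos: "0 < riesz_mean lam 1 z" using R1 by linarith
  let ?n = "counting_function lam z"
  have n: "?n = real (card (below z))"
    by (rule counting_function_eq_card[OF finite_eigenvalues_below])
  \<comment> \<open>Cauchy-Schwarz against the constant 1. Bounding the second Riesz mean by the
    first through Yang's inequality and cancelling turns this into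
    \<open>(1 + d / 4) R_1 \<le> z N\<close>, to which the lower bound for \<open>R_1\<close>
    applies.\<close>
  have "(riesz_mean lam 1 z)\<^sup>2 \<le> ?n * riesz_mean lam 2 z"
    using Cauchy_Schwarz_ineq_sum[of "\<lambda>_. 1" "\<lambda>k. z - lam k" "below z"]
    by (simp add: riesz_mean_1 riesz_mean_2 n)
  then have "(1 + d / 4) * (riesz_mean lam 1 z)\<^sup>2 \<le> (1 + d / 4) * (?n * riesz_mean lam 2 z)"
    using c by (intro mult_left_mono) auto
  also have "\<dots> = ?n * ((1 + d / 4) * riesz_mean lam 2 z)" by (simp only: mult.left_commute)
  also have "\<dots> \<le> ?n * (z * riesz_mean lam 1 z)"
    unfolding d_def by (intro mult_left_mono riesz_mean_2_le) (simp add: n)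
  finally have "riesz_mean lam 1 z * ((1 + d / 4) * riesz_mean lam 1 z) \<le> riesz_mean lam 1 z * (z * ?n)"
    by (simp add: power2_eq_square mult_ac)
  then have "(1 + d / 4) * riesz_mean lam 1 z \<le> z * ?n"
    using R1_pos by (subst (asm) mult_le_cancel_left_pos) auto
  moreover have "(1 + d / 4) * (real j * z powr (1 + d / 2) / ((1 + d / 4) * s powr (d / 2))) \<le>
      (1 + d / 4) * riesz_mean lam 1 z"
    using c by (intro mult_left_mono R1) auto
  moreover have "(1 + d / 4) * (real j * z powr (1 + d / 2) / ((1 + d / 4) * s powr (d / 2))) =
      z * (real j * (z / s) powr (d / 2))"
    using c z0 s by (simp add: powr_add powr_divide)
  ultimately have "z * (real j * (z / s) powr (d / 2)) \<le> z * ?n" by linarith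
  then show ?N using z0 by (subst (asm) mult_le_cancel_left_pos) auto
qed

text \<open>The lower bound for the counting function at \<open>z = lam (k + 1)\<close> meets the
  trivial upper bound \<open>k\<close>; solving for the eigenvalue inverts the power
  \<open>d / 2\<close>.\<close>

lemma eigenvalue_ratio_bound:
  fixes j k :: nat
  defines "d \<equiv> real DIM('a)"
  assumes j: "1 \<le> j" and k: "j \<le> k"
  shows "lam (k + 1) / eigenvalue_mean lam j \<le> (1 + 4 / d) * (real k / real j) powr (2 / d)"
proof -
  have d: "0 < d" by (simp add: d_def)
  let ?m = "eigenvalue_mean lam j"
  define s where "s = (1 + 4 / d) * ?m"
  have m: "0 < ?m" by (rule eigenvalue_mean_pos[OF j])
  have s: "0 < s" using m d by (simp add: s_def add_pos_pos)
  have "lam (k + 1) / s \<le> (real k / real j) powr (2 / d)"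
  proof (cases "s \<le> lam (k + 1)")
    case True
    define q where "q = lam (k + 1) / s"
    have q: "0 < q" using True s by (simp add: q_def)
    \<comment> \<open>Counting is strict, so index \<open>k + 1\<close> and any later index with the
      same eigenvalue are left out.\<close>
    have "below (lam (k + 1)) \<subseteq> {1..k}"
    proof
      fix i assume i: "i \<in> below (lam (k + 1))"
      have "\<not> k + 1 \<le> i"
      proof
        assume "k + 1 \<le> i"
        moreover have "mono_on {1..} lam" using ev by (simp add: dirichlet_eigenvalues_def)
        ultimately have "lam (k + 1) \<le> lam i" by (intro mono_onD[of "{1..}" lam]) auto
        then show False using i by simp
      qed
      then show "i \<in> {1..k}" using i by simp
    qed
    then have "card (below (lam (k + 1))) \<le> k" using card_mono[of "{1..k}"] by fastforce
    then have "counting_function lam (lam (k + 1)) \<le> real k"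
      by (simp add: counting_function_eq_card[OF finite_eigenvalues_below])
    moreover have "real j * q powr (d / 2) \<le> counting_function lam (lam (k + 1))"
      using riesz_bounds(3)[OF j, of "lam (k + 1)"] True unfolding q_def s_def d_def by simp
    ultimately have "q powr (d / 2) \<le> real k / real j" using j by (simp add: le_divide_eq mult.commute)
    then have "(q powr (d / 2)) powr (2 / d) \<le> (real k / real j) powr (2 / d)"
      using d by (intro powr_mono2) auto
    moreover have "(q powr (d / 2)) powr (2 / d) = q" using q d by (simp add: powr_powr)
    ultimately show ?thesis by (simp add: q_def)
  next
    \<comment> \<open>Below the threshold \<open>s\<close> the counting bound does not apply, but
      then the ratio is less than 1, while \<open>k / j\<close> is at least 1.\<close>
    case False
    then have "lam (k + 1) / s \<le> 1" using s by simp
    also have "\<dots> \<le> (real k / real j) powr (2 / d)"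
      using j k d by (intro ge_one_powr_ge_zero) auto
    finally show ?thesis .
  qed
  then have "(1 + 4 / d) * (lam (k + 1) / s) \<le> (1 + 4 / d) * (real k / real j) powr (2 / d)"
    using d by (intro mult_left_mono) auto
  moreover have "(1 + 4 / d) * (lam (k + 1) / s) = lam (k + 1) / ?m"
  proof -
    have "1 + 4 / d \<noteq> 0" using d by (simp add: add_pos_pos less_imp_neq[symmetric])
    then show ?thesis by (simp add: s_def)
  qed
  ultimately show ?thesis by simp
qed

end

theorem corollary2p8:
  fixes \<Omega> :: "'a::euclidean_space set" and lam :: "nat \<Rightarrow> real" and d j :: nat
  assumes "d = DIM('a)"
    and "open \<Omega>" and "connected \<Omega>" and "bounded \<Omega>" and "\<Omega> \<noteq> {}"
    and "dirichlet_eigenvalues \<Omega> lam"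
    and "j \<ge> 1"
  shows "(\<forall>z. z \<ge> (1 + 4 / real d) * eigenvalue_mean lam j \<longrightarrow>
            riesz_mean lam 2 z \<ge>
              real j * z powr (2 + real d / 2) /
                ((1 + real d / 4)\<^sup>2 *
                 ((1 + 4 / real d) * eigenvalue_mean lam j) powr (real d / 2)) \<and>
            riesz_mean lam 1 z \<ge>
              real j * z powr (1 + real d / 2) /
                ((1 + real d / 4) *
                 ((1 + 4 / real d) * eigenvalue_mean lam j) powr (real d / 2)) \<and>
            counting_function lam z \<ge>
              real j * (z / ((1 + 4 / real d) * eigenvalue_mean lam j)) powr (real d / 2)) \<and>
         (\<forall>k\<ge>j. lam (k + 1) / eigenvalue_mean lam j \<le>
            (1 + 4 / real d) * (real k / real j) powr (2 / real d))"
proof -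
  interpret dirichlet_problem \<Omega> lam
    using assms by unfold_locales auto
  show ?thesis
    unfolding assms(1) using riesz_bounds[OF assms(7)] eigenvalue_ratio_bound[OF assms(7)] by blast
qed

end
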